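(* Suppose that $d=2$. Let $\Omega$ be a simply connected bounded domain in $\mathbb{R}^2$ with Lipschitz boundary. Let $\lambda,\mu,\tilde\lambda,\tilde\mu$ be real numbers with $$\mu>0,\quad 2\lambda+2\mu>0,\quad \tilde\mu>0,\quad 2\tilde\lambda+2\tilde\mu>0,\quad (\lambda-\tilde\lambda)(\mu-\tilde\mu)\ge 0,$$ and let $C=(C_{ijkl})$ be the elasticity tensor with Lamé parameters $(\tilde\lambda,\tilde\mu)$ in $\Omega$ and $(\lambda,\mu)$ in $\mathbb{R}^2\setminus\overline{\Omega}$. For a constant $2\times 2$ matrix $A$, let $\mathbf{u}$ be the solution of $$\nabla\cdot\big(C(\nabla\mathbf{u}+\nabla\mathbf{u}^T)\big)=0\ \text{ in }\mathbb{R}^2,\qquad \mathbf{u}(x)-Ax=O(|x|^{-1})\ \text{ as }|x|\to\infty.$$ If the solution $\mathbf{u}$ is linear inside $\Omega$ for a single nonzero $A$, then $\Omega$ must be an ellipse.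
   Context: The elasticity tensor of the inclusion-matrix composite is $$C_{ijkl}=\big(\lambda\,\chi(\mathbb{R}^2\setminus\overline\Omega)+\tilde\lambda\,\chi(\Omega)\big)\delta_{ij}\delta_{kl}+\big(\mu\,\chi(\mathbb{R}^2\setminus\overline\Omega)+\tilde\mu\,\chi(\Omega)\big)(\delta_{ik}\delta_{jl}+\delta_{il}\delta_{jk}),$$ where $\chi(D)$ denotes the indicator function of a set $D$ and $\delta_{ij}$ is the Kronecker delta. "Linear inside $\Omega$" means $\mathbf{u}(x)=Bx+b$ for $x\in\Omega$, for some constant $2\times 2$ matrix $B$ and constant vector $b$. An ellipse means the solid planar region.
   Formalization: The formal theorem also assumes that the matrix and inclusion tensors act differently on A+A^T; otherwise (e.g. equal Lamé parameters, or A skew-symmetric) u(x)=Ax solves the problem for every Ω, so the claim as stated fails. *)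

theory Defs
  imports "HOL-Analysis.Analysis" "HOL-Library.Landau_Symbols"
begin

definition lipschitz_boundary :: "(real^2) set \<Rightarrow> bool" where
  "lipschitz_boundary S \<longleftrightarrow>
    (\<forall>p\<in>frontier S. \<exists>e f r h L g.
        norm e = 1 \<and> norm f = 1 \<and> e \<bullet> f = 0 \<and> r > 0 \<and> h > 0 \<and>
        L-lipschitz_on UNIV (g :: real \<Rightarrow> real) \<and>
        (\<forall>s t. \<bar>s\<bar> < r \<and> \<bar>t\<bar> < h \<longrightarrow>
           (p + s *\<^sub>R e + t *\<^sub>R f \<in> S \<longleftrightarrow> t < g s)))"

(* Open solid ellipse: the theorem concerns an open set, so the bounding curve is excluded. *)
definition is_ellipse :: "(real^2) set \<Rightarrow> bool" where
  "is_ellipse S \<longleftrightarrow>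
    (\<exists>c e f a b. norm e = 1 \<and> norm f = 1 \<and> e \<bullet> f = 0 \<and> a > 0 \<and> b > 0 \<and>
       S = {x. (((x - c) \<bullet> e) / a)\<^sup>2 + (((x - c) \<bullet> f) / b)\<^sup>2 < 1})"

definition kron :: "2 \<Rightarrow> 2 \<Rightarrow> real" where
  "kron i j = (if i = j then 1 else 0)"

definition iso_tensor :: "real \<Rightarrow> real \<Rightarrow> 2 \<Rightarrow> 2 \<Rightarrow> 2 \<Rightarrow> 2 \<Rightarrow> real" where
  "iso_tensor lam mu i j k l =
     lam * (kron i j * kron k l) + mu * (kron i k * kron j l + kron i l * kron j k)"

(* lam, mu: matrix parameters; lam', mu': inclusion parameters *)
definition composite_tensor ::
  "(real^2) set \<Rightarrow> real \<Rightarrow> real \<Rightarrow> real \<Rightarrow> real \<Rightarrow> real^2 \<Rightarrow> 2 \<Rightarrow> 2 \<Rightarrow> 2 \<Rightarrow> 2 \<Rightarrow> real" where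
  "composite_tensor \<Omega> lam mu lam' mu' x =
     iso_tensor (lam * indicator (UNIV - closure \<Omega>) x + lam' * indicator \<Omega> x)
                (mu * indicator (UNIV - closure \<Omega>) x + mu' * indicator \<Omega> x)"

definition partial_deriv :: "2 \<Rightarrow> (real^2 \<Rightarrow> real) \<Rightarrow> real^2 \<Rightarrow> real" where
  "partial_deriv j f x = frechet_derivative f (at x) (axis j 1)"

fun Ck :: "nat \<Rightarrow> (real^2 \<Rightarrow> real) \<Rightarrow> bool" where
  "Ck 0 f = continuous_on UNIV f"
| "Ck (Suc k) f = ((\<forall>x. f differentiable (at x)) \<and> (\<forall>j. Ck k (partial_deriv j f)))"

definition test_function :: "(real^2 \<Rightarrow> real) \<Rightarrow> bool" where
  "test_function \<phi> \<longleftrightarrow> (\<forall>k. Ck k \<phi>) \<and> compact (closure {x. \<phi> x \<noteq> 0})"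

definition L2_loc :: "(real^2 \<Rightarrow> real) \<Rightarrow> bool" where
  "L2_loc f \<longleftrightarrow> f \<in> borel_measurable lebesgue \<and>
     (\<forall>K. compact K \<longrightarrow> set_integrable lebesgue K (\<lambda>x. (f x)\<^sup>2))"

definition weak_partial :: "2 \<Rightarrow> (real^2 \<Rightarrow> real) \<Rightarrow> (real^2 \<Rightarrow> real) \<Rightarrow> bool" where
  "weak_partial j f g \<longleftrightarrow>
     (\<forall>\<phi>. test_function \<phi> \<longrightarrow>
        (LINT x|lebesgue. f x * partial_deriv j \<phi> x) = - (LINT x|lebesgue. g x * \<phi> x))"

(* u is in H^1_loc with gradient G, where G x $ k $ l is the derivative of u_k in direction l *)
definition H1_loc_grad :: "(real^2 \<Rightarrow> real^2) \<Rightarrow> (real^2 \<Rightarrow> real^2^2) \<Rightarrow> bool" where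
  "H1_loc_grad u G \<longleftrightarrow>
     (\<forall>k. L2_loc (\<lambda>x. u x $ k)) \<and>
     (\<forall>k l. L2_loc (\<lambda>x. G x $ k $ l) \<and> weak_partial l (\<lambda>x. u x $ k) (\<lambda>x. G x $ k $ l))"

definition contract :: "(2 \<Rightarrow> 2 \<Rightarrow> 2 \<Rightarrow> 2 \<Rightarrow> real) \<Rightarrow> real^2^2 \<Rightarrow> real^2^2" where
  "contract C E = (\<chi> i j. \<Sum>k\<in>UNIV. \<Sum>l\<in>UNIV. C i j k l * E $ k $ l)"

(* div (C (grad u + grad u^T)) = 0 on the whole plane, in the weak sense. This encodes
   the transmission conditions across the frontier of the inclusion. *)
definition weak_elastic_solution ::
  "(real^2 \<Rightarrow> 2 \<Rightarrow> 2 \<Rightarrow> 2 \<Rightarrow> 2 \<Rightarrow> real) \<Rightarrow> (real^2 \<Rightarrow> real^2) \<Rightarrow> bool" where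
  "weak_elastic_solution C u \<longleftrightarrow>
     (\<exists>G. H1_loc_grad u G \<and>
       (\<forall>\<phi> i. test_function \<phi> \<longrightarrow>
          (LINT x|lebesgue. (\<Sum>j\<in>UNIV.
             contract (C x) (G x + transpose (G x)) $ i $ j * partial_deriv j \<phi> x)) = 0))"

end

(*
  Since u is affine in Omega, w = u - Ax satisfies the constant-coefficient Lame system of the matrix
  on the whole plane with right-hand side div (tau chi_Omega), where tau is the constant stress
  jump.  Testing with derivatives of truncated, mollified fundamental solutions of the Laplacian and
  of the bilaplacian centred in Omega, and letting the truncation radius tend to infinity, shows that
  the Hessian of the logarithmic potential of Omega is constant in Omega: if tau has a deviatoric part
  the nonlocal terms cancel in the shear combinations of the equations, and if tau is isotropic
  derivatives of the Kelvin solution eliminate them.  If tau vanishes, then w is constant in Omega,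
  which is excluded by the hypothesis on A.

  Hence the Cauchy transform of chi_Omega is an affine function of z and cnj z in Omega.  Subtracting its
  holomorphic part gives a Schwarz function: a continuous S, holomorphic outside the closure of
  Omega, equal to cnj z on the boundary and with at most a simple pole at infinity.  Some real
  quadratic polynomial in z and S has no pole at infinity; it is bounded and real on the boundary, so by the maximum
  principle it is a constant.  On the boundary this constant equals a real quadratic polynomial in
  z and cnj z, so the boundary lies on a conic, and the conic bounds Omega.
*)
theory Submission
  imports Defs "HOL-Complex_Analysis.Conformal_Mappings"
begin

section \<open>Smooth functions on the line\<close>

text \<open>Inside \<open>\<Omega>\<close> the Hessian of the logarithmic potential is symmetric
  with known trace, which leaves two unknowns. Each test potential yields four scalar equations,
  polluted by a matrix of nonlocal terms: the divergence of \<open>w\<close> paired with second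
  derivatives. That matrix is symmetric and its trace is local in the limit, so two combinations are
  usable, the antisymmetric one and the trace. Their determinant is
  \<open>(\<tau>11 - \<tau>22)^2 + 4 \<tau>12^2\<close>; hence an isotropic jump needs gradient test
  fields, for which both terms on the left coincide up to their weights. Test functions must be
  smooth with compact support, hence the mollification; it costs nothing, since \<open>w\<close> is
  affine on the mollified ball. The truncation error vanishes because five derivatives of a
  potential of size \<open>R^2\<close> are \<open>O(R^-3)\<close>, \<open>w\<close> is
  \<open>O(R^-1)\<close> and the annulus has area \<open>O(R^2)\<close>. If the Schwarz function is
  \<open>-\<alpha> z - \<beta> + O(1/z)\<close>, cancelling the \<open>z^2\<close> and
  \<open>z\<close> terms dictates the quadratic form. It is definite unless
  \<open>norm \<alpha> = 1\<close>, a degenerate case refuted separately.\<close>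

fun CkR :: "nat \<Rightarrow> real set \<Rightarrow> (real \<Rightarrow> real) \<Rightarrow> bool" where
  "CkR 0 S f = continuous_on S f"
| "CkR (Suc k) S f = (\<exists>f'. (\<forall>x\<in>S. (f has_real_derivative f' x) (at x)) \<and> CkR k S f')"

lemma CkR_SucI:
  "(\<And>x. x \<in> S \<Longrightarrow> (f has_real_derivative f' x) (at x)) \<Longrightarrow> CkR k S f' \<Longrightarrow> CkR (Suc k) S f"
  by auto

lemma CkR_SucE:
  assumes "CkR (Suc k) S f"
  obtains f' where "\<And>x. x \<in> S \<Longrightarrow> (f has_real_derivative f' x) (at x)" "CkR k S f'"
  using assms by auto

lemma CkR_Suc_imp: "CkR (Suc k) S f \<Longrightarrow> CkR k S f"
proof (induction k arbitrary: f)
  case 0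
  then show ?case
    by (auto intro!: continuous_at_imp_continuous_on intro: DERIV_isCont)
next
  case (Suc k)
  from Suc.prems obtain f' where
    "\<And>x. x \<in> S \<Longrightarrow> (f has_real_derivative f' x) (at x)" "CkR (Suc k) S f'"
    by (rule CkR_SucE) blast
  then show ?case
    using Suc.IH by (intro CkR_SucI[of S f f']) auto
qed

text \<open>Derivatives are taken in a full neighbourhood, so agreement on \<open>S\<close>
  transfers them because \<open>S\<close> is open.\<close>

lemma CkR_cong:
  assumes "open S" "\<And>x. x \<in> S \<Longrightarrow> f x = g x" "CkR k S f"
  shows "CkR k S g"
proof (cases k)
  case 0
  then show ?thesis using assms by (auto cong: continuous_on_cong)
next
  case (Suc m)
  from assms(3) obtain f' where f': "\<And>x. x \<in> S \<Longrightarrow> (f has_real_derivative f' x) (at x)" "CkR m S f'"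
    unfolding Suc by (rule CkR_SucE) blast
  show ?thesis unfolding Suc
  proof (rule CkR_SucI[OF _ f'(2)])
    fix x assume "x \<in> S"
    then show "(g has_real_derivative f' x) (at x)"
      using has_field_derivative_transform_within_open[OF f'(1) assms(1)] assms(2) by blast
  qed
qed

text \<open>The two derivative witnesses need not agree off their own sets; replacing both by
  \<open>deriv f\<close> gives one witness for the union. This glues \<open>reg_ln\<close> from two
  regions.\<close>

lemma CkR_Un:
  assumes "open S" "open T"
  shows "CkR k S f \<Longrightarrow> CkR k T f \<Longrightarrow> CkR k (S \<union> T) f"
proof (induction k arbitrary: f)
  case 0
  then show ?case using assms by (auto intro: continuous_on_open_Un)
next
  case (Suc k)
  obtain f1 where f1: "\<And>x. x \<in> S \<Longrightarrow> (f has_real_derivative f1 x) (at x)" "CkR k S f1"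
    using Suc.prems(1) by (rule CkR_SucE) blast
  obtain f2 where f2: "\<And>x. x \<in> T \<Longrightarrow> (f has_real_derivative f2 x) (at x)" "CkR k T f2"
    using Suc.prems(2) by (rule CkR_SucE) blast
  have eq: "f1 x = deriv f x" if "x \<in> S" for x
    using DERIV_imp_deriv[OF f1(1)[OF that]] by simp
  have eq2: "f2 x = deriv f x" if "x \<in> T" for x
    using DERIV_imp_deriv[OF f2(1)[OF that]] by simp
  have "CkR k S (deriv f)" "CkR k T (deriv f)"
    using CkR_cong[OF assms(1) eq f1(2)] CkR_cong[OF assms(2) eq2 f2(2)] by auto
  then have "CkR k (S \<union> T) (deriv f)" by (rule Suc.IH)
  then show ?case
    using f1(1) f2(1) eq eq2 by (intro CkR_SucI[of _ f "deriv f"]) auto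
qed

lemma CkR_const [simp]: "CkR k S (\<lambda>x. c)"
  by (induction k arbitrary: c) (auto intro!: exI[of _ "\<lambda>x. 0"])

lemma CkR_ident [simp]: "CkR k S (\<lambda>x. x)"
proof (cases k)
  case (Suc m)
  show ?thesis unfolding Suc by (rule CkR_SucI[of _ _ "\<lambda>x. 1"]) auto
qed simp

lemma CkR_add: "CkR k S f \<Longrightarrow> CkR k S g \<Longrightarrow> CkR k S (\<lambda>x. f x + g x)"
proof (induction k arbitrary: f g)
  case 0
  then show ?case by (auto intro: continuous_on_add)
next
  case (Suc k)
  obtain f1 where f1: "\<And>x. x \<in> S \<Longrightarrow> (f has_real_derivative f1 x) (at x)" "CkR k S f1"
    using Suc.prems(1) by (rule CkR_SucE) blast
  obtain f2 where f2: "\<And>x. x \<in> S \<Longrightarrow> (g has_real_derivative f2 x) (at x)" "CkR k S f2"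
    using Suc.prems(2) by (rule CkR_SucE) blast
  show ?case
    by (rule CkR_SucI[of _ _ "\<lambda>x. f1 x + f2 x"]) (auto intro!: derivative_eq_intros f1 f2 Suc.IH)
qed

lemma CkR_mult: "CkR k S f \<Longrightarrow> CkR k S g \<Longrightarrow> CkR k S (\<lambda>x. f x * g x)"
proof (induction k arbitrary: f g)
  case 0
  then show ?case by (auto intro: continuous_on_mult)
next
  case (Suc k)
  obtain f1 where f1: "\<And>x. x \<in> S \<Longrightarrow> (f has_real_derivative f1 x) (at x)" "CkR k S f1"
    using Suc.prems(1) by (rule CkR_SucE) blast
  obtain f2 where f2: "\<And>x. x \<in> S \<Longrightarrow> (g has_real_derivative f2 x) (at x)" "CkR k S f2"
    using Suc.prems(2) by (rule CkR_SucE) blast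
  have "CkR k S (\<lambda>x. f1 x * g x + f2 x * f x)"
    using Suc.prems[THEN CkR_Suc_imp] by (intro CkR_add Suc.IH f1 f2)
  then show ?case
    by (intro CkR_SucI[of _ _ "\<lambda>x. f1 x * g x + f2 x * f x"]) (auto intro!: derivative_eq_intros f1 f2)
qed

lemma CkR_diff: "CkR k S f \<Longrightarrow> CkR k S g \<Longrightarrow> CkR k S (\<lambda>x. f x - g x)"
  using CkR_add[of k S f "\<lambda>x. -1 * g x"] CkR_mult[of k S "\<lambda>x. -1" g] by simp

lemma CkR_compose:
  "CkR k T f \<Longrightarrow> CkR k S g \<Longrightarrow> g ` S \<subseteq> T \<Longrightarrow> CkR k S (\<lambda>x. f (g x))"
proof (induction k arbitrary: f)
  case 0
  then show ?case by (auto intro: continuous_on_compose2)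
next
  case (Suc k)
  obtain f1 where f1: "\<And>x. x \<in> T \<Longrightarrow> (f has_real_derivative f1 x) (at x)" "CkR k T f1"
    using Suc.prems(1) by (rule CkR_SucE) blast
  obtain g1 where g1: "\<And>x. x \<in> S \<Longrightarrow> (g has_real_derivative g1 x) (at x)" "CkR k S g1"
    using Suc.prems(2) by (rule CkR_SucE) blast
  have "CkR k S (\<lambda>x. f1 (g x) * g1 x)"
    by (rule CkR_mult[OF Suc.IH[OF f1(2) CkR_Suc_imp[OF Suc.prems(2)] Suc.prems(3)] g1(2)])
  then show ?case
    using Suc.prems(3)
    by (intro CkR_SucI[of _ _ "\<lambda>x. f1 (g x) * g1 x"]) (auto intro!: DERIV_chain2[of f _ g] f1 g1)
qed

text \<open>The derivative of \<open>inverse\<close> is a polynomial in \<open>inverse\<close>,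
  which closes the induction.\<close>

lemma CkR_inverse: "CkR k {0<..} inverse"
proof (induction k)
  case 0
  then show ?case by (auto intro!: continuous_intros)
next
  case (Suc k)
  have "CkR k {0<..} (\<lambda>x. (-1) * (inverse x * inverse x))"
    by (intro CkR_mult CkR_const Suc.IH)
  then show ?case
    by (intro CkR_SucI[of _ _ "\<lambda>x. (-1) * (inverse x * inverse x)"])
       (auto intro!: derivative_eq_intros simp: power2_eq_square)
qed

lemma CkR_ln: "CkR k {0<..} (\<lambda>x. ln x)"
proof (cases k)
  case 0
  then show ?thesis by (auto intro!: continuous_intros)
next
  case (Suc m)
  show ?thesis unfolding Suc
    by (rule CkR_SucI[OF _ CkR_inverse]) (auto intro!: derivative_eq_intros simp: inverse_eq_divide)
qed

section \<open>Flat functions, a smooth step and a regularised logarithm\<close>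

definition flat_aux :: "nat \<Rightarrow> real \<Rightarrow> real" where
  "flat_aux m t = (if t > 0 then (1 / t) ^ m * exp (- 1 / t) else 0)"

lemma flat_aux_tendsto_0: "(flat_aux m \<longlongrightarrow> 0) (at 0)"
proof -
  have "((\<lambda>x::real. x ^ m / exp x) \<longlongrightarrow> 0) at_top"
    by (rule tendsto_power_div_exp_0)
  then have "((\<lambda>x::real. (inverse x) ^ m / exp (inverse x)) \<longlongrightarrow> 0) (at_right 0)"
    by (rule filterlim_compose) (rule filterlim_inverse_at_top_right)
  then have R: "(flat_aux m \<longlongrightarrow> 0) (at_right 0)"
    by (rule Lim_transform_eventually)
       (auto simp: eventually_at_filter flat_aux_def exp_minus field_simps)
  have L: "(flat_aux m \<longlongrightarrow> 0) (at_left 0)"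
    by (rule Lim_transform_eventually[OF tendsto_const])
       (auto simp: eventually_at_filter flat_aux_def)
  show ?thesis using L R by (simp add: filterlim_at_split)
qed

text \<open>The powers of \<open>1 / t\<close> make the family closed under differentiation, so one
  induction gives smoothness of all members. At the origin the difference quotient of
  \<open>flat_aux m\<close> is \<open>flat_aux (m + 1)\<close>, which tends to zero.\<close>

lemma flat_aux_deriv:
  "(flat_aux m has_real_derivative flat_aux (m + 2) t - real m * flat_aux (m + 1) t) (at t)"
proof -
  consider "t > 0" | "t < 0" | "t = 0" by linarith
  then show ?thesis
  proof cases
    case 1
    have "((\<lambda>t. (1 / t) ^ m * exp (- 1 / t)) has_real_derivative
        (flat_aux (m + 2) t - real m * flat_aux (m + 1) t)) (at t)"
    proof (cases m)
      case 0
      then show ?thesis using 1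
        by (auto intro!: derivative_eq_intros simp: flat_aux_def power2_eq_square)
    next
      case (Suc n)
      have "((\<lambda>t. inverse t ^ Suc n * exp (- inverse t)) has_real_derivative
        (inverse t ^ (Suc n + 2) * exp (- inverse t) - real (Suc n) * (inverse t ^ (Suc n + 1) * exp (- inverse t)))) (at t)"
        using 1 by (auto intro!: derivative_eq_intros simp: algebra_simps power2_eq_square)
          (cases n; simp)
      then show ?thesis using 1 by (simp add: Suc flat_aux_def divide_inverse)
    qed
    then show ?thesis
      by (rule has_field_derivative_transform_within_open[of _ _ _ "{0<..}"])
         (use 1 in \<open>auto simp: flat_aux_def\<close>)
  next
    case 2
    have "((\<lambda>t. 0) has_real_derivative (flat_aux (m + 2) t - real m * flat_aux (m + 1) t)) (at t)"
      using 2 by (auto simp: flat_aux_def)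
    then show ?thesis
      by (rule has_field_derivative_transform_within_open[of _ _ _ "{..<0}"])
         (use 2 in \<open>auto simp: flat_aux_def\<close>)
  next
    case 3
    have "((\<lambda>h. (flat_aux m (0 + h) - flat_aux m 0) / h) \<longlongrightarrow> 0) (at 0)"
      by (rule Lim_transform_eventually[OF flat_aux_tendsto_0[of "m+1"]])
         (auto simp: eventually_at_filter flat_aux_def)
    then show ?thesis unfolding 3 DERIV_def by (simp add: flat_aux_def)
  qed
qed

lemma CkR_flat_aux: "CkR k UNIV (flat_aux m)"
proof (induction k arbitrary: m)
  case 0
  then show ?case using flat_aux_deriv
    by (auto intro!: continuous_at_imp_continuous_on DERIV_isCont)
next
  case (Suc k)
  show ?case
    by (rule CkR_SucI[OF flat_aux_deriv]) (intro CkR_diff CkR_mult CkR_const Suc.IH)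
qed

definition flat_exp :: "real \<Rightarrow> real" where
  "flat_exp t = (if t > 0 then exp (- 1 / t) else 0)"

lemma CkR_flat_exp: "CkR k UNIV flat_exp"
  proof -
  have "flat_aux 0 = flat_exp" by (rule ext) (simp add: flat_aux_def flat_exp_def)
  then show ?thesis using CkR_flat_aux[of k 0] by simp
qed

lemma flat_exp_nonneg [simp]: "flat_exp t \<ge> 0"
  and flat_exp_le_1: "flat_exp t \<le> 1"
  and flat_exp_pos: "t > 0 \<Longrightarrow> flat_exp t > 0"
  and flat_exp_neg [simp]: "t \<le> 0 \<Longrightarrow> flat_exp t = 0"
  by (auto simp: flat_exp_def)

lemma flat_exp_mono: "s \<le> t \<Longrightarrow> flat_exp s \<le> flat_exp t"
  by (auto simp: flat_exp_def frac_le)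

lemma flat_exp_scaled_tendsto: "t > 0 \<Longrightarrow> (\<lambda>n. flat_exp (real n * t)) \<longlonglongrightarrow> 1"
proof -
  assume t: "t > 0"
  have "(\<lambda>n. exp (- 1 * (1 / t) * inverse (real (Suc n)))) \<longlonglongrightarrow> exp (- 1 * (1 / t) * 0)"
    by (intro tendsto_intros LIMSEQ_inverse_real_of_nat)
  then have "(\<lambda>n. flat_exp (real (Suc n) * t)) \<longlonglongrightarrow> 1"
    using t by (simp add: flat_exp_def divide_inverse mult.commute)
  then show ?thesis by (subst (asm) filterlim_sequentially_Suc)
qed

text \<open>One flat step fed into another gives a transition from 1 to 0. The inner step is 0 up to
  \<open>t = 1\<close>, and from \<open>t = 3\<close> on it is at least
  \<open>flat_exp 2 = exp (-1/2)\<close>, which exceeds 1/2.\<close>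

definition cutoff :: "real \<Rightarrow> real" where
  "cutoff t = flat_exp (1/2 - flat_exp (t - 1)) / flat_exp (1/2)"

lemma CkR_cutoff: "CkR k UNIV cutoff"
proof -
  have "CkR k UNIV (\<lambda>t. flat_exp (1/2 - flat_exp (t - 1)) * (1 / flat_exp (1/2)))"
    by (intro CkR_mult CkR_const CkR_compose[OF CkR_flat_exp] CkR_diff CkR_ident) auto
  then show ?thesis by (simp add: cutoff_def[abs_def])
qed

lemma cutoff_eq_1: "t \<le> 1 \<Longrightarrow> cutoff t = 1"
  using flat_exp_pos[of "1/2"] by (simp add: cutoff_def)

lemma cutoff_eq_0: "t \<ge> 3 \<Longrightarrow> cutoff t = 0"
proof -
  assume t: "t \<ge> 3"
  have "1 + (-1/2::real) \<le> exp (-1/2)" by (rule exp_ge_add_one_self)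
  also have "\<dots> = flat_exp 2" by (simp add: flat_exp_def)
  also have "\<dots> \<le> flat_exp (t - 1)" using t by (intro flat_exp_mono) auto
  finally show ?thesis by (simp add: cutoff_def)
qed

lemma cutoff_antimono: "s \<le> t \<Longrightarrow> cutoff t \<le> cutoff s"
  unfolding cutoff_def by (intro divide_right_mono flat_exp_mono) (auto intro: flat_exp_mono)

text \<open>The affine argument places the transition between \<open>t = 1/2\<close> and
  \<open>t = 1\<close>. For \<open>t \<le> 1/2\<close> the factor in front of \<open>ln\<close> is
  zero, so the value of \<open>ln\<close> at nonpositive arguments does not matter.\<close>

definition reg_ln :: "real \<Rightarrow> real" where
  "reg_ln t = (1 - cutoff (4 * t - 1)) * ln t"

lemma reg_ln_eq: "t \<ge> 1 \<Longrightarrow> reg_ln t = ln t"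
  by (simp add: reg_ln_def cutoff_eq_0)

lemma CkR_reg_ln: "CkR k UNIV reg_ln"
proof -
  have *: "CkR k {0<..} reg_ln"
    unfolding reg_ln_def[abs_def]
    by (intro CkR_mult CkR_diff CkR_const CkR_ln CkR_compose[OF CkR_cutoff] CkR_ident) auto
  have "CkR k {..<1/2} reg_ln"
    by (rule CkR_cong[of _ "\<lambda>x. 0"]) (auto simp: reg_ln_def cutoff_eq_1)
  from CkR_Un[OF _ _ * this] have "CkR k ({0<..} \<union> {..<1/2}) reg_ln" by auto
  moreover have "{0<..} \<union> {..<1/2} = (UNIV :: real set)" by auto
  ultimately show ?thesis by simp
qed

section \<open>Smooth functions on the plane\<close>

abbreviation pd :: "2 \<Rightarrow> (real^2 \<Rightarrow> real) \<Rightarrow> real^2 \<Rightarrow> real" where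
  "pd \<equiv> partial_deriv"

lemma pd_eqI:
  "(f has_derivative f') (at x) \<Longrightarrow> pd j f x = f' (axis j 1)"
  by (simp add: partial_deriv_def frechet_derivative_at[symmetric])

lemma sum_axis_mult: "(\<Sum>k\<in>UNIV. axis i (1::real) $ k * F k) = F i" for F :: "2 \<Rightarrow> real"
  using exhaust_2[of i] by (auto simp: sum_2 axis_def)

lemma has_derivative_partial_deriv:
  assumes "f differentiable (at x)"
  shows "(f has_derivative (\<lambda>h. \<Sum>j\<in>UNIV. h $ j * pd j f x)) (at x)"
proof -
  obtain f' where f': "(f has_derivative f') (at x)"
    using assms by (auto simp: differentiable_def)
  interpret bounded_linear f' by (rule has_derivative_bounded_linear[OF f'])
  have "f' h = (\<Sum>j\<in>UNIV. h $ j * pd j f x)" for h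
  proof -
    have "f' h = f' (\<Sum>j\<in>UNIV. h $ j *\<^sub>R axis j 1)" using basis_expansion[of h] by (simp add: scalar_mult_eq_scaleR)
    also have "\<dots> = (\<Sum>j\<in>UNIV. h $ j * pd j f x)"
      by (simp add: sum scale pd_eqI[OF f'])
    finally show ?thesis .
  qed
  then show ?thesis using f' by (metis (no_types, lifting) ext)
qed

lemma has_real_derivative_line:
  fixes f :: "real^2 \<Rightarrow> real"
  assumes "\<And>y. f differentiable (at y)"
  shows "((\<lambda>t. f (x + t *\<^sub>R v)) has_real_derivative
    (\<Sum>j\<in>UNIV. v $ j * pd j f (x + t *\<^sub>R v))) (at t)"
proof -
  have "((\<lambda>t. x + t *\<^sub>R v) has_derivative (\<lambda>h. h *\<^sub>R v)) (at t)"
    by (auto intro!: derivative_eq_intros)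
  from has_derivative_compose[OF this has_derivative_partial_deriv[OF assms]]
  have "((\<lambda>t. f (x + t *\<^sub>R v)) has_derivative
    (\<lambda>h. \<Sum>j\<in>UNIV. (h *\<^sub>R v) $ j * pd j f (x + t *\<^sub>R v))) (at t)" .
  then show ?thesis
    unfolding has_field_derivative_def
    by (rule has_derivative_eq_rhs) (auto simp: sum_distrib_left sum_distrib_right mult_ac)
qed

lemma Ck_Suc_imp: "Ck (Suc k) f \<Longrightarrow> Ck k f"
proof (induction k arbitrary: f)
  case 0
  then show ?case
    by (auto intro!: continuous_at_imp_continuous_on differentiable_imp_continuous_within)
qed auto

lemma pd_const [simp]: "pd j (\<lambda>x. c) = (\<lambda>x. 0)"
  by (rule ext) (rule pd_eqI, rule has_derivative_const)

lemma pd_nth [simp]: "pd j (\<lambda>x. x $ i) = (\<lambda>x. kron i j)"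
  by (rule ext, subst pd_eqI[OF bounded_linear_imp_has_derivative[OF bounded_linear_vec_nth]])
     (auto simp: axis_def kron_def)

lemma pd_add:
  "f differentiable (at x) \<Longrightarrow> g differentiable (at x) \<Longrightarrow>
   pd j (\<lambda>x. f x + g x) x = pd j f x + pd j g x"
  using pd_eqI[OF has_derivative_add[OF has_derivative_partial_deriv has_derivative_partial_deriv], of f x g j]
  by (simp add: sum_axis_mult)

lemma pd_mult:
  "f differentiable (at x) \<Longrightarrow> g differentiable (at x) \<Longrightarrow>
   pd j (\<lambda>x. f x * g x) x = f x * pd j g x + pd j f x * g x"
  using pd_eqI[OF has_derivative_mult[OF has_derivative_partial_deriv has_derivative_partial_deriv], of f x g j]
  by (simp add: sum_axis_mult)

lemma pd_cmult:
  assumes "f differentiable (at x)"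
  shows "pd j (\<lambda>x. c * f x) x = c * pd j f x"
  using pd_mult[of "\<lambda>x. c" x f j] assms by simp

lemma pd_compose:
  assumes "(h has_real_derivative h') (at (f x))" "f differentiable (at x)"
  shows "pd j (\<lambda>x. h (f x)) x = h' * pd j f x"
proof -
  obtain f' where f': "(f has_derivative f') (at x)"
    using assms by (auto simp: differentiable_def)
  show ?thesis
    using pd_eqI[OF has_derivative_compose[OF f' assms(1)[unfolded has_field_derivative_def]]]
    by (simp add: pd_eqI[OF f'])
qed

lemma pd_affine:
  assumes "f differentiable (at (c *\<^sub>R x + a))"
  shows "pd j (\<lambda>x. f (c *\<^sub>R x + a)) x = c * pd j f (c *\<^sub>R x + a)"
    and "(\<lambda>x. f (c *\<^sub>R x + a)) differentiable (at x)"
proof -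
  obtain f' where f': "(f has_derivative f') (at (c *\<^sub>R x + a))"
    using assms by (auto simp: differentiable_def)
  interpret bounded_linear f' by (rule has_derivative_bounded_linear[OF f'])
  have "((\<lambda>x. c *\<^sub>R x + a) has_derivative (\<lambda>h. c *\<^sub>R h)) (at x)"
    by (auto intro!: derivative_eq_intros)
  note d = has_derivative_compose[OF this f']
  show "pd j (\<lambda>x. f (c *\<^sub>R x + a)) x = c * pd j f (c *\<^sub>R x + a)"
    using pd_eqI[OF d] by (simp add: pd_eqI[OF f'] scale)
  show "(\<lambda>x. f (c *\<^sub>R x + a)) differentiable (at x)"
    using d by (auto simp: differentiable_def)
qed

lemma pd_cong_open:
  assumes "open S" "\<And>y. y \<in> S \<Longrightarrow> f y = g y" "x \<in> S"
  shows "pd j f x = pd j g x"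
proof -
  have "(f has_derivative D) (at x) = (g has_derivative D) (at x)" for D
    using has_derivative_transform_within_open[OF _ assms(1,3)] assms(2) by (metis (no_types))
  then show ?thesis by (simp add: partial_deriv_def frechet_derivative_def)
qed

lemma Ck_const: "Ck k (\<lambda>x. c)"
proof (induction k arbitrary: c)
  case (Suc k)
  show ?case unfolding Ck.simps pd_const using Suc by simp
qed simp

lemma Ck_nth: "Ck k (\<lambda>x. x $ i)"
proof (cases k)
  case 0
  show ?thesis unfolding 0 Ck.simps by (intro continuous_intros)
next
  case (Suc m)
  show ?thesis unfolding Suc Ck.simps pd_nth
    using Ck_const bounded_linear_imp_differentiable[OF bounded_linear_vec_nth] by blast
qed

lemma Ck_add: "Ck k f \<Longrightarrow> Ck k g \<Longrightarrow> Ck k (\<lambda>x. f x + g x)"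
proof (induction k arbitrary: f g)
  case 0
  then show ?case by (auto intro!: continuous_intros)
next
  case (Suc k)
  then have "pd j (\<lambda>x. f x + g x) = (\<lambda>x. pd j f x + pd j g x)" for j
    by (auto intro!: pd_add)
  with Suc show ?case by auto
qed

lemma Ck_mult: "Ck k f \<Longrightarrow> Ck k g \<Longrightarrow> Ck k (\<lambda>x. f x * g x)"
proof (induction k arbitrary: f g)
  case 0
  then show ?case by (auto intro!: continuous_intros)
next
  case (Suc k)
  then have "pd j (\<lambda>x. f x * g x) = (\<lambda>x. f x * pd j g x + pd j f x * g x)" for j
    by (auto intro!: pd_mult)
  moreover have "Ck k f" "Ck k g" using Suc.prems by (auto dest: Ck_Suc_imp simp del: Ck.simps)
  ultimately show ?case using Suc by (auto intro!: Ck_add)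
qed

lemma Ck_compose: "CkR k UNIV h \<Longrightarrow> Ck k f \<Longrightarrow> Ck k (\<lambda>x. h (f x))"
proof (induction k arbitrary: h)
  case 0
  then show ?case by (auto intro: continuous_on_compose2)
next
  case (Suc k)
  obtain h' where h': "\<And>x. (h has_real_derivative h' x) (at x)" "CkR k UNIV h'"
    using Suc.prems(1) by (rule CkR_SucE) blast
  have "pd j (\<lambda>x. h (f x)) = (\<lambda>x. h' (f x) * pd j f x)" for j
    using Suc.prems(2) h' by (auto intro!: pd_compose)
  moreover have "(\<lambda>x. h (f x)) differentiable (at x)" for x
  proof -
    obtain D where "(f has_derivative D) (at x)"
      using Suc.prems(2) by (auto simp: differentiable_def)
    from has_derivative_compose[OF this h'(1)[unfolded has_field_derivative_def]]
    show ?thesis by (auto simp: differentiable_def)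
  qed
  moreover have "Ck k f" using Suc.prems by (auto dest: Ck_Suc_imp simp del: Ck.simps)
  ultimately show ?case using Suc h' by (auto intro!: Ck_mult)
qed

lemma Ck_affine: "Ck k f \<Longrightarrow> Ck k (\<lambda>x. f (c *\<^sub>R x + a))"
proof (induction k arbitrary: f)
  case 0
  then show ?case by (auto intro!: continuous_intros intro: continuous_on_compose2)
next
  case (Suc k)
  then have "pd j (\<lambda>x. f (c *\<^sub>R x + a)) = (\<lambda>x. c * pd j f (c *\<^sub>R x + a))" for j
    by (auto intro!: pd_affine)
  with Suc show ?case by (auto intro!: Ck_mult Ck_const pd_affine)
qed

definition smooth :: "(real^2 \<Rightarrow> real) \<Rightarrow> bool" where
  "smooth f \<longleftrightarrow> (\<forall>k. Ck k f)"

lemma smoothD: "smooth f \<Longrightarrow> f differentiable (at x)"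
  unfolding smooth_def by (drule spec[of _ "Suc 0"]) simp

lemma smooth_partial_deriv: "smooth f \<Longrightarrow> smooth (pd j f)"
  unfolding smooth_def
proof
  fix k assume "\<forall>k. Ck k f"
  then have "Ck (Suc k) f" by blast
  then show "Ck k (pd j f)" by simp
qed

lemma smooth_continuous: "smooth f \<Longrightarrow> continuous_on S f"
  unfolding smooth_def by (drule spec[of _ 0]) (auto intro: continuous_on_subset)

lemma smooth_const: "smooth (\<lambda>x. c)" and smooth_nth: "smooth (\<lambda>x. x $ i)"
  by (auto simp: smooth_def Ck_const Ck_nth)

lemma smooth_add: "smooth f \<Longrightarrow> smooth g \<Longrightarrow> smooth (\<lambda>x. f x + g x)"
  and smooth_mult: "smooth f \<Longrightarrow> smooth g \<Longrightarrow> smooth (\<lambda>x. f x * g x)"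
  by (auto simp: smooth_def Ck_add Ck_mult)

lemma smooth_compose: "(\<And>k. CkR k UNIV h) \<Longrightarrow> smooth f \<Longrightarrow> smooth (\<lambda>x. h (f x))"
  by (auto simp: smooth_def Ck_compose)

lemma smooth_affine: "smooth f \<Longrightarrow> smooth (\<lambda>x. f (c *\<^sub>R x + a))"
  by (auto simp: smooth_def Ck_affine)

lemma smooth_sum: "finite I \<Longrightarrow> (\<And>i. i \<in> I \<Longrightarrow> smooth (f i)) \<Longrightarrow> smooth (\<lambda>x. \<Sum>i\<in>I. f i x)"
  by (induction I rule: finite_induct) (auto intro: smooth_const smooth_add)

lemma pd_sum:
  "(\<And>i. smooth (f i)) \<Longrightarrow> pd j (\<lambda>x. \<Sum>i\<in>UNIV. f (i::2) x) = (\<lambda>x. \<Sum>i\<in>UNIV. pd j (f i) x)"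
  by (auto simp: sum_2 intro!: pd_add smoothD)

lemma smooth_inner_self: "smooth (\<lambda>x. x \<bullet> x)"
  by (simp add: inner_vec_def sum_2 smooth_add smooth_mult smooth_nth)

lemma pd_affine_form:
  fixes c :: "2 \<Rightarrow> real"
  shows "smooth (\<lambda>x. (\<Sum>l\<in>UNIV. c l * x $ l) + d)"
    and "pd m (\<lambda>x. (\<Sum>l\<in>UNIV. c l * x $ l) + d) x = c m"
proof -
  show "smooth (\<lambda>x. (\<Sum>l\<in>UNIV. c l * x $ l) + d)"
    by (intro smooth_add smooth_sum smooth_mult smooth_const smooth_nth) simp
  have "((\<lambda>x::real^2. (\<Sum>l\<in>UNIV. c l * x $ l) + d) has_derivative (\<lambda>h. \<Sum>l\<in>UNIV. c l * h $ l)) (at x)"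
    by (auto intro!: derivative_eq_intros bounded_linear.has_derivative[OF bounded_linear_vec_nth])
  then have "pd m (\<lambda>x. (\<Sum>l\<in>UNIV. c l * x $ l) + d) x = (\<Sum>l\<in>UNIV. axis m 1 $ l * c l)"
    by (simp add: pd_eqI mult.commute)
  then show "pd m (\<lambda>x. (\<Sum>l\<in>UNIV. c l * x $ l) + d) x = c m"
    by (simp add: sum_axis_mult)
qed

lemma pd_inner_self: "pd j (\<lambda>x. x \<bullet> x) x = 2 * x $ j"
proof -
  have "((\<lambda>x. x \<bullet> x) has_derivative (\<lambda>h. 2 * (x \<bullet> h))) (at x)"
    by (auto intro!: derivative_eq_intros simp: inner_commute)
  then show ?thesis by (simp add: pd_eqI inner_axis)
qed

lemma pd_shift:
  "smooth f \<Longrightarrow> pd j (\<lambda>x. f (x - a)) = (\<lambda>x. pd j f (x - a))"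
  using pd_affine(1)[of f 1 _ "-a"] smoothD by auto

lemma smooth_shift: "smooth f \<Longrightarrow> smooth (\<lambda>x. f (x - a))"
  using smooth_affine[of f 1 "-a"] by simp

lemma pd_scale:
  "smooth f \<Longrightarrow> pd j (\<lambda>x. f (c *\<^sub>R x)) = (\<lambda>x. c * pd j f (c *\<^sub>R x))"
  using pd_affine(1)[of f c _ 0] smoothD by auto

lemma smooth_scale: "smooth f \<Longrightarrow> smooth (\<lambda>x. f (c *\<^sub>R x))"
  using smooth_affine[of f c 0] by simp

lemma pd_cmult_smooth:
  "smooth f \<Longrightarrow> pd j (\<lambda>x. c * f x) = (\<lambda>x. c * pd j f x)"
  by (rule ext) (rule pd_cmult, rule smoothD)

section \<open>Mean value and Taylor estimates on balls\<close>

lemma continuous_bounded_on_cball: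
  fixes f :: "real^2 \<Rightarrow> real"
  assumes "continuous_on UNIV f"
  obtains B where "\<And>x. norm x \<le> r \<Longrightarrow> \<bar>f x\<bar> \<le> B"
proof -
  have "compact (f ` cball 0 r)"
    by (intro compact_continuous_image continuous_on_subset[OF assms]) auto
  then have "\<exists>B. \<forall>x\<in>cball 0 r. \<bar>f x\<bar> \<le> B"
    by (auto dest!: compact_imp_bounded simp: bounded_iff simp del: mem_cball)
  then obtain B where "\<forall>x\<in>cball 0 r. \<bar>f x\<bar> \<le> B" ..
  then show ?thesis by (intro that[of B]) simp
qed

text \<open>The ball is convex, so the intermediate point stays where bounds on the derivatives
  hold.\<close>

lemma smooth_mvt_on_cball:
  assumes f: "smooth f" and xy: "norm x \<le> r" "norm y \<le> r"
  obtains p where "norm p \<le> r" "norm (p - y) \<le> norm (x - y)"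
    "f x - f y = (\<Sum>j\<in>UNIV. (x - y) $ j * pd j f p)"
proof -
  obtain s where s: "0 < s" "s < 1"
    "f (y + 1 *\<^sub>R (x - y)) - f (y + 0 *\<^sub>R (x - y)) = (1 - 0) * (\<Sum>j\<in>UNIV. (x - y) $ j * pd j f (y + s *\<^sub>R (x - y)))"
    using MVT2[OF zero_less_one has_real_derivative_line[OF smoothD[OF f], of y "x - y"]] by blast
  have "y + s *\<^sub>R (x - y) = (1 - s) *\<^sub>R y + s *\<^sub>R x" by (simp add: algebra_simps)
  also have "\<dots> \<in> cball 0 r"
    using convexD[OF convex_cball, of y 0 r x "1 - s" s] xy s by simp
  finally have "norm (y + s *\<^sub>R (x - y)) \<le> r" by simp
  then show ?thesis
    using s by (intro that[of "y + s *\<^sub>R (x - y)"]) (auto simp: mult_left_le_one_le)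
qed

lemma smooth_lipschitz_on_cball:
  assumes f: "smooth f"
  obtains M where "M \<ge> 0"
    "\<And>x y. norm x \<le> r \<Longrightarrow> norm y \<le> r \<Longrightarrow> \<bar>f x - f y\<bar> \<le> M * norm (x - y)"
proof -
  have "\<exists>B. \<forall>x. norm x \<le> r \<longrightarrow> \<bar>pd j f x\<bar> \<le> B" for j
    by (rule continuous_bounded_on_cball[OF smooth_continuous[OF smooth_partial_deriv[OF f]], of r j]) blast
  then obtain B where B: "\<And>j x. norm x \<le> r \<Longrightarrow> \<bar>pd j f x\<bar> \<le> B j" by metis
  show ?thesis
  proof (rule that[of "\<bar>B 1\<bar> + \<bar>B 2\<bar>"])
    fix x y :: "real^2" assume xy: "norm x \<le> r" "norm y \<le> r"
    obtain p where p: "norm p \<le> r" "f x - f y = (\<Sum>j\<in>UNIV. (x - y) $ j * pd j f p)"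
      by (rule smooth_mvt_on_cball[OF f xy])
    have "\<bar>(x - y) $ j * pd j f p\<bar> \<le> norm (x - y) * \<bar>B j\<bar>" for j
      using B[OF p(1), of j] unfolding abs_mult by (intro mult_mono component_le_norm_cart) auto
    from this[of 1] this[of 2] show "\<bar>f x - f y\<bar> \<le> (\<bar>B 1\<bar> + \<bar>B 2\<bar>) * norm (x - y)"
      unfolding p(2) by (simp add: sum_2 algebra_simps)
  qed simp
qed

text \<open>A quadratic remainder with a constant uniform on the ball permits differentiating
  integrals over \<open>\<Omega>\<close> with respect to a shift.\<close>

lemma smooth_taylor_on_cball:
  assumes f: "smooth f"
  obtains M where "M \<ge> 0"
    "\<And>x y. norm x \<le> r \<Longrightarrow> norm y \<le> r \<Longrightarrow>
      \<bar>f x - f y - (\<Sum>j\<in>UNIV. (x - y) $ j * pd j f y)\<bar> \<le> M * (norm (x - y))\<^sup>2"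
proof -
  have "\<exists>M\<ge>0. \<forall>x y. norm x \<le> r \<longrightarrow> norm y \<le> r \<longrightarrow> \<bar>pd j f x - pd j f y\<bar> \<le> M * norm (x - y)" for j
    using smooth_lipschitz_on_cball[OF smooth_partial_deriv[OF f], of r j] by metis
  then obtain M where M: "\<And>j. M j \<ge> 0"
    "\<And>j x y. norm x \<le> r \<Longrightarrow> norm y \<le> r \<Longrightarrow> \<bar>pd j f x - pd j f y\<bar> \<le> M j * norm (x - y)" by metis
  show ?thesis
  proof (rule that[of "M 1 + M 2"])
    fix x y :: "real^2" assume xy: "norm x \<le> r" "norm y \<le> r"
    obtain p where p: "norm p \<le> r" "norm (p - y) \<le> norm (x - y)"
      "f x - f y = (\<Sum>j\<in>UNIV. (x - y) $ j * pd j f p)"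
      by (rule smooth_mvt_on_cball[OF f xy])
    have b: "\<bar>(x - y) $ j * (pd j f p - pd j f y)\<bar> \<le> norm (x - y) * (M j * norm (x - y))" for j
    proof -
      have "\<bar>pd j f p - pd j f y\<bar> \<le> M j * norm (x - y)"
        using M(2)[OF p(1) xy(2), of j] mult_left_mono[OF p(2) M(1)[of j]] by linarith
      then show ?thesis unfolding abs_mult by (intro mult_mono component_le_norm_cart) auto
    qed
    have "f x - f y - (\<Sum>j\<in>UNIV. (x - y) $ j * pd j f y)
       = (\<Sum>j\<in>UNIV. (x - y) $ j * (pd j f p - pd j f y))"
      unfolding p(3) by (simp add: sum_2 algebra_simps)
    then show "\<bar>f x - f y - (\<Sum>j\<in>UNIV. (x - y) $ j * pd j f y)\<bar> \<le> (M 1 + M 2) * (norm (x - y))\<^sup>2"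
      using b[of 1] b[of 2] by (simp add: sum_2 algebra_simps power2_eq_square)
  qed (use M in auto)
qed

text \<open>Both mixed partials are limits of the same second difference quotient.\<close>

lemma second_difference_mvt:
  assumes f: "smooth f" and h: "h > 0"
  obtains s t where "0 < s" "s < h" "0 < t" "t < h"
    "f (x + h *\<^sub>R axis i 1 + h *\<^sub>R axis j 1) - f (x + h *\<^sub>R axis i 1) - f (x + h *\<^sub>R axis j 1) + f x
      = h\<^sup>2 * pd j (pd i f) (x + s *\<^sub>R axis i 1 + t *\<^sub>R axis j 1)"
proof -
  let ?g = "\<lambda>s. f (x + h *\<^sub>R axis j 1 + s *\<^sub>R axis i 1) - f (x + s *\<^sub>R axis i 1)"
  let ?g' = "\<lambda>s. pd i f (x + h *\<^sub>R axis j 1 + s *\<^sub>R axis i 1) - pd i f (x + s *\<^sub>R axis i 1)"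
  have "(?g has_real_derivative ?g' s) (at s)" for s
    using has_real_derivative_line[OF smoothD[OF f], of "x + h *\<^sub>R axis j 1" "axis i 1" s]
      has_real_derivative_line[OF smoothD[OF f], of x "axis i 1" s]
    unfolding sum_axis_mult by (intro DERIV_diff)
  from MVT2[OF h this] obtain s where s: "0 < s" "s < h" "?g h - ?g 0 = (h - 0) * ?g' s"
    by blast
  let ?k = "\<lambda>t. pd i f (x + s *\<^sub>R axis i 1 + t *\<^sub>R axis j 1)"
  have "(?k has_real_derivative pd j (pd i f) (x + s *\<^sub>R axis i 1 + t *\<^sub>R axis j 1)) (at t)" for t
    using has_real_derivative_line[OF smoothD[OF smooth_partial_deriv[OF f]], of i "x + s *\<^sub>R axis i 1" "axis j 1" t]
    unfolding sum_axis_mult .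
  from MVT2[OF h this] obtain t where t: "0 < t" "t < h"
    "?k h - ?k 0 = (h - 0) * pd j (pd i f) (x + s *\<^sub>R axis i 1 + t *\<^sub>R axis j 1)"
    by blast
  have "?k h - ?k 0 = ?g' s" by (simp add: algebra_simps)
  then show ?thesis using s t that[of s t] by (simp add: algebra_simps power2_eq_square)
qed

lemma pd_commute:
  assumes f: "smooth f"
  shows "pd i (pd j f) = pd j (pd i f)"
proof
  fix x
  let ?A = "pd j (pd i f)" and ?B = "pd i (pd j f)"
  have "isCont ?A x" "isCont ?B x"
    using smooth_continuous[of _ UNIV] smooth_partial_deriv f
    by (auto simp: continuous_on_eq_continuous_at)
  show "?B x = ?A x"
  proof (rule ccontr)
    assume ne: "?B x \<noteq> ?A x"
    \<comment> \<open>Half the gap: values within \<open>e\<close> of \<open>?A x\<close> and of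
      \<open>?B x\<close> cannot be equal.\<close>
    define e where "e = \<bar>?B x - ?A x\<bar> / 2"
    have e: "e > 0" using ne by (simp add: e_def)
    obtain d1 where d1: "d1 > 0" "\<And>y. dist y x < d1 \<Longrightarrow> dist (?A y) (?A x) < e"
      using \<open>isCont ?A x\<close> e unfolding continuous_within_eps_delta by blast
    obtain d2 where d2: "d2 > 0" "\<And>y. dist y x < d2 \<Longrightarrow> dist (?B y) (?B x) < e"
      using \<open>isCont ?B x\<close> e unfolding continuous_within_eps_delta by blast
    \<comment> \<open>The intermediate points lie within \<open>s + t < 2 * h\<close> of
      \<open>x\<close>.\<close>
    define h where "h = min d1 d2 / 2"
    have h: "h > 0" using d1 d2 by (simp add: h_def)
    have near: "dist (x + s *\<^sub>R axis k 1 + t *\<^sub>R axis l 1) x < min d1 d2"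
      if "0 < s" "s < h" "0 < t" "t < h" for s t and k l :: 2
    proof -
      have "dist (x + s *\<^sub>R axis k 1 + t *\<^sub>R axis l 1) x = norm (s *\<^sub>R axis k 1 + t *\<^sub>R (axis l 1 :: real^2))"
        by (simp add: dist_norm add.assoc)
      also have "\<dots> \<le> s + t" using that by (intro order_trans[OF norm_triangle_ineq]) simp
      also have "\<dots> < min d1 d2" using that by (simp add: h_def)
      finally show ?thesis .
    qed
    obtain s t where st: "0 < s" "s < h" "0 < t" "t < h"
      "f (x + h *\<^sub>R axis i 1 + h *\<^sub>R axis j 1) - f (x + h *\<^sub>R axis i 1) - f (x + h *\<^sub>R axis j 1) + f x
      = h\<^sup>2 * ?A (x + s *\<^sub>R axis i 1 + t *\<^sub>R axis j 1)"
      by (rule second_difference_mvt[OF f h])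
    obtain s' t' where st': "0 < s'" "s' < h" "0 < t'" "t' < h"
      "f (x + h *\<^sub>R axis j 1 + h *\<^sub>R axis i 1) - f (x + h *\<^sub>R axis j 1) - f (x + h *\<^sub>R axis i 1) + f x
      = h\<^sup>2 * ?B (x + s' *\<^sub>R axis j 1 + t' *\<^sub>R axis i 1)"
      by (rule second_difference_mvt[OF f h])
    have "h\<^sup>2 * ?A (x + s *\<^sub>R axis i 1 + t *\<^sub>R axis j 1) = h\<^sup>2 * ?B (x + s' *\<^sub>R axis j 1 + t' *\<^sub>R axis i 1)"
      using st(5) st'(5) by (simp add: algebra_simps)
    then have "?A (x + s *\<^sub>R axis i 1 + t *\<^sub>R axis j 1) = ?B (x + s' *\<^sub>R axis j 1 + t' *\<^sub>R axis i 1)"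
      using h by simp
    moreover have "dist (?A (x + s *\<^sub>R axis i 1 + t *\<^sub>R axis j 1)) (?A x) < e"
      using d1(2) near st by simp
    moreover have "dist (?B (x + s' *\<^sub>R axis j 1 + t' *\<^sub>R axis i 1)) (?B x) < e"
      using d2(2) near st' by simp
    ultimately show False by (simp add: e_def dist_real_def abs_if split: if_splits)
  qed
qed

section \<open>Compactly supported functions\<close>

definition cpt_supp :: "(real^2 \<Rightarrow> real) \<Rightarrow> bool" where
  "cpt_supp f \<longleftrightarrow> (\<exists>R. \<forall>x. norm x > R \<longrightarrow> f x = 0)"

lemma test_function_iff: "test_function f \<longleftrightarrow> smooth f \<and> cpt_supp f"
proof -
  have "compact (closure {x. f x \<noteq> 0}) \<longleftrightarrow> cpt_supp f"
  proof -
    have "compact (closure {x. f x \<noteq> 0}) \<longleftrightarrow> bounded {x. f x \<noteq> 0}"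
      by (metis bounded_closure bounded_subset closed_closure closure_subset compact_eq_bounded_closed)
    also have "\<dots> \<longleftrightarrow> cpt_supp f"
      unfolding bounded_iff cpt_supp_def by (metis (mono_tags, lifting) mem_Collect_eq linorder_not_less)
    finally show ?thesis .
  qed
  then show ?thesis by (simp add: test_function_def smooth_def)
qed

lemma cpt_suppI: "(\<And>x. norm x > R \<Longrightarrow> f x = 0) \<Longrightarrow> cpt_supp f"
  by (auto simp: cpt_supp_def)

text \<open>The exterior of a closed ball is open, so \<open>f\<close> vanishes in a neighbourhood
  of each of its points.\<close>

lemma cpt_supp_partial_deriv:
  assumes "cpt_supp f" shows "cpt_supp (pd j f)"
proof -
  obtain R where R: "\<And>x. norm x > R \<Longrightarrow> f x = 0" using assms by (auto simp: cpt_supp_def)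
  have "pd j f x = pd j (\<lambda>x. 0) x" if "norm x > R" for x
    by (rule pd_cong_open[of "{x. norm x > R}"])
       (use R that in \<open>auto intro!: open_Collect_less continuous_intros\<close>)
  then show ?thesis by (intro cpt_suppI) auto
qed

lemma cpt_supp_mult: "cpt_supp f \<Longrightarrow> cpt_supp (\<lambda>x. g x * f x)"
  by (auto simp: cpt_supp_def)

lemma cpt_supp_add: "cpt_supp f \<Longrightarrow> cpt_supp g \<Longrightarrow> cpt_supp (\<lambda>x. f x + g x)"
proof -
  assume "cpt_supp f" "cpt_supp g"
  then obtain R S where "\<And>x. norm x > R \<Longrightarrow> f x = 0" "\<And>x. norm x > S \<Longrightarrow> g x = 0"
    by (auto simp: cpt_supp_def)
  then show ?thesis by (intro cpt_suppI[of "max R S"]) auto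
qed

lemma cpt_supp_shift: "cpt_supp f \<Longrightarrow> cpt_supp (\<lambda>x. f (x - a))"
proof -
  assume "cpt_supp f"
  then obtain R where R: "\<And>x. norm x > R \<Longrightarrow> f x = 0" by (auto simp: cpt_supp_def)
  show ?thesis
  proof (rule cpt_suppI)
    fix x :: "real^2" assume "norm x > R + norm a"
    then have "norm (x - a) > R" using norm_triangle_ineq2[of x a] by linarith
    then show "f (x - a) = 0" by (rule R)
  qed
qed

lemma test_function_partial_deriv: "test_function f \<Longrightarrow> test_function (pd j f)"
  by (simp add: test_function_iff smooth_partial_deriv cpt_supp_partial_deriv)

lemma test_function_shift: "test_function f \<Longrightarrow> test_function (\<lambda>x. f (x - a))"
  by (simp add: test_function_iff smooth_shift cpt_supp_shift)

lemma cpt_supp_bounded: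
  assumes "continuous_on UNIV f" "cpt_supp f"
  obtains C where "C > 0" "\<And>x. \<bar>f x\<bar> \<le> C"
proof -
  obtain R where R: "\<And>x. norm x > R \<Longrightarrow> f x = 0" using assms by (auto simp: cpt_supp_def)
  obtain B where B: "\<And>x. norm x \<le> R \<Longrightarrow> \<bar>f x\<bar> \<le> B"
    by (rule continuous_bounded_on_cball[OF assms(1)]) blast
  show ?thesis
  proof (rule that[of "\<bar>B\<bar> + 1"])
    show "\<bar>f x\<bar> \<le> \<bar>B\<bar> + 1" for x
      using R[of x] B[of x] by (cases "norm x > R") auto
  qed auto
qed

section \<open>Integration against test functions\<close>

text \<open>\<open>lebesgue\<close> is the completion of \<open>lborel\<close>, and continuous
  functions are Borel measurable. Translation invariance is applied on the \<open>lborel\<close>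
  side.\<close>

lemma lebesgue_integral_continuous:
  fixes f :: "real^2 \<Rightarrow> real"
  assumes "continuous_on UNIV f"
  shows "(LINT x|lebesgue. f x) = (LINT x|lborel. f x)"
  using assms by (intro integral_completion) (simp add: borel_measurable_continuous_onI)

lemma integrable_continuous_cpt_supp_lborel:
  fixes f :: "real^2 \<Rightarrow> real"
  assumes "continuous_on UNIV f" "cpt_supp f"
  shows "integrable lborel f"
proof -
  obtain R where R: "\<And>x. norm x > R \<Longrightarrow> f x = 0" using assms by (auto simp: cpt_supp_def)
  have "integrable lborel (\<lambda>x. indicator (cball 0 R) x *\<^sub>R f x)"
    by (intro borel_integrable_compact continuous_on_subset[OF assms(1)]) auto
  moreover have "(\<lambda>x. indicator (cball 0 R) x *\<^sub>R f x) = f"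
    using R by (auto simp: indicator_def fun_eq_iff not_le)
  ultimately show ?thesis by simp
qed

lemma integrable_continuous_cpt_supp:
  fixes f :: "real^2 \<Rightarrow> real"
  assumes "continuous_on UNIV f" "cpt_supp f"
  shows "integrable lebesgue f"
  using integrable_continuous_cpt_supp_lborel[OF assms]
  by (subst integrable_completion) (use assms in \<open>auto simp: borel_measurable_continuous_onI\<close>)

text \<open>On a set of finite measure, square integrability implies integrability through
  \<open>\<bar>t\<bar> \<le> t^2 + 1\<close>.\<close>

lemma L2_loc_set_integrable:
  assumes f: "L2_loc f" and K: "compact K"
  shows "set_integrable lebesgue K f"
proof -
  have Ks: "K \<in> sets lebesgue" using K by (simp add: borel_compact)
  have f2: "set_integrable lebesgue K (\<lambda>x. (f x)\<^sup>2)" using f K by (auto simp: L2_loc_def)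
  have "integrable lebesgue (indicator K :: _ \<Rightarrow> real)"
    using emeasure_bounded_finite[OF compact_imp_bounded[OF K]] K
    by (intro integrable_real_indicator Ks) (auto simp: borel_compact)
  then have "integrable lebesgue (\<lambda>x. indicator K x *\<^sub>R (f x)\<^sup>2 + indicator K x)"
    using f2 unfolding set_integrable_def by (intro Bochner_Integration.integrable_add)
  then show ?thesis
    unfolding set_integrable_def
  proof (rule Bochner_Integration.integrable_bound)
    have "f \<in> borel_measurable lebesgue" using f by (simp add: L2_loc_def)
    then show "(\<lambda>x. indicat_real K x *\<^sub>R f x) \<in> borel_measurable lebesgue"
      using Ks by (intro borel_measurable_scaleR borel_measurable_indicator)
    have "\<bar>t\<bar> \<le> t\<^sup>2 + 1" for t :: real
    proof -
      have "0 \<le> (\<bar>t\<bar> - 1)\<^sup>2 + (t\<^sup>2 + 1)" by (intro add_nonneg_nonneg) auto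
      then show ?thesis by (simp add: power2_eq_square algebra_simps)
    qed
    then show "AE x in lebesgue. norm (indicat_real K x *\<^sub>R f x) \<le> norm (indicat_real K x *\<^sub>R (f x)\<^sup>2 + indicat_real K x)"
      by (intro AE_I2) (auto simp: indicator_def)
  qed
qed

lemma L2_loc_integrable_mult:
  assumes f: "L2_loc f" and g: "continuous_on UNIV g" "cpt_supp g"
  shows "integrable lebesgue (\<lambda>x. f x * g x)"
proof -
  obtain R where R: "\<And>x. norm x > R \<Longrightarrow> g x = 0" using g by (auto simp: cpt_supp_def)
  obtain C where C: "C > 0" "\<And>x. \<bar>g x\<bar> \<le> C" using cpt_supp_bounded[OF g] by blast
  have "integrable lebesgue (\<lambda>x. C * (indicator (cball 0 R) x *\<^sub>R f x))"
    using L2_loc_set_integrable[OF f compact_cball] unfolding set_integrable_def by (rule integrable_mult_right)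
  then show ?thesis
  proof (rule Bochner_Integration.integrable_bound)
    have "g \<in> borel_measurable lebesgue"
      using g(1) by (intro measurable_completion) (simp add: borel_measurable_continuous_onI)
    then show "(\<lambda>x. f x * g x) \<in> borel_measurable lebesgue"
      using f by (auto simp: L2_loc_def)
    show "AE x in lebesgue. norm (f x * g x) \<le> norm (C * (indicator (cball 0 R) x *\<^sub>R f x))"
    proof (rule AE_I2)
      fix x
      have "\<bar>f x\<bar> * \<bar>g x\<bar> \<le> \<bar>f x\<bar> * C" by (intro mult_left_mono C) auto
      then show "norm (f x * g x) \<le> norm (C * (indicator (cball 0 R) x *\<^sub>R f x))"
        using R[of x] C(1) by (auto simp: indicator_def abs_mult mult.commute not_le)
    qed
  qed
qed

lemma integral_translation:
  fixes f :: "real^2 \<Rightarrow> real"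
  assumes "continuous_on UNIV f"
  shows "(LINT x|lborel. f (a + x)) = (LINT x|lborel. f x)"
proof -
  have "(LINT x|lborel. f x) = (LINT x|distr lborel borel ((+) a). f x)"
    by (simp add: lborel_distr_plus)
  also have "\<dots> = (LINT x|lborel. f (a + x))"
    using assms by (intro integral_distr) (auto simp: borel_measurable_continuous_onI)
  finally show ?thesis by simp
qed

text \<open>The integral is the limit of integrals of difference quotients, and these vanish by
  translation invariance.\<close>

lemma integral_pd_eq_0:
  assumes f: "smooth f" "cpt_supp f"
  shows "(LINT x|lebesgue. pd j f x) = 0"
proof -
  let ?e = "axis j 1 :: real^2"
  let ?h = "\<lambda>n. inverse (real (Suc n))"
  let ?q = "\<lambda>n x. (f (x + ?h n *\<^sub>R ?e) - f x) / ?h n"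
  have cf: "continuous_on UNIV f" and cd: "continuous_on UNIV (pd j f)"
    using f by (auto intro: smooth_continuous smooth_partial_deriv)
  obtain R where R: "\<And>x. norm x > R \<Longrightarrow> f x = 0" using f by (auto simp: cpt_supp_def)
  obtain C where C: "C > 0" "\<And>x. \<bar>pd j f x\<bar> \<le> C"
    using cpt_supp_bounded[OF cd cpt_supp_partial_deriv[OF f(2)]] by blast
  have line: "((\<lambda>t. f (x + t *\<^sub>R ?e)) has_real_derivative pd j f (x + t *\<^sub>R ?e)) (at t)" for x t
    using has_real_derivative_line[OF smoothD[OF f(1)], of x ?e t] by (simp add: sum_axis_mult)
  have q0: "(LINT x|lborel. ?q n x) = 0" for n
  proof -
    have c1: "continuous_on UNIV (\<lambda>x. f (x + ?h n *\<^sub>R ?e))"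
      by (intro continuous_on_compose2[OF cf] continuous_intros) auto
    have "integrable lborel (\<lambda>x. f (x + ?h n *\<^sub>R ?e))"
      using cpt_supp_shift[OF f(2), of "- (?h n *\<^sub>R ?e)"] c1
      by (intro integrable_continuous_cpt_supp_lborel) auto
    moreover have "integrable lborel f"
      by (intro integrable_continuous_cpt_supp_lborel cf f)
    moreover have "(LINT x|lborel. f (x + ?h n *\<^sub>R ?e)) = (LINT x|lborel. f x)"
      using integral_translation[OF cf, of "?h n *\<^sub>R ?e"] by (simp add: add.commute)
    ultimately show ?thesis by simp
  qed
  have "(\<lambda>n. LINT x|lborel. ?q n x) \<longlonglongrightarrow> (LINT x|lborel. pd j f x)"
  proof (rule integral_dominated_convergence)
    show "pd j f \<in> borel_measurable lborel"
      using cd by (simp add: borel_measurable_continuous_onI)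
    show "?q n \<in> borel_measurable lborel" for n
    proof -
      have "continuous_on UNIV (?q n)"
        by (intro continuous_intros cf continuous_on_compose2[OF cf]) auto
      then show ?thesis by (simp add: borel_measurable_continuous_onI)
    qed
    \<comment> \<open>The steps have length at most 1, so all quotients are supported in the ball of
      radius \<open>R + 1\<close>; the mean value theorem bounds them by \<open>C\<close>.\<close>
    show "integrable lborel (\<lambda>x. indicator (cball 0 (R + 1)) x *\<^sub>R C)"
      by (intro borel_integrable_compact continuous_intros) auto
    show "AE x in lborel. (\<lambda>n. ?q n x) \<longlonglongrightarrow> pd j f x"
    proof (rule AE_I2)
      fix x
      have "((\<lambda>h. (f (x + (0 + h) *\<^sub>R ?e) - f (x + 0 *\<^sub>R ?e)) / h) \<longlongrightarrow> pd j f (x + 0 *\<^sub>R ?e)) (at 0)"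
        using line[of x 0] unfolding DERIV_def .
      then have "((\<lambda>h. (f (x + h *\<^sub>R ?e) - f x) / h) \<longlongrightarrow> pd j f x) (at 0)"
        by simp
      moreover have "filterlim ?h (at 0) sequentially"
        by (rule filterlim_atI[OF LIMSEQ_inverse_real_of_nat]) auto
      ultimately show "(\<lambda>n. ?q n x) \<longlonglongrightarrow> pd j f x"
        by (rule filterlim_compose)
    qed
    show "AE x in lborel. norm (?q n x) \<le> indicator (cball 0 (R + 1)) x *\<^sub>R C" for n
    proof (rule AE_I2)
      fix x
      have h: "0 < ?h n" "?h n \<le> 1" by (auto simp: field_simps)
      show "norm (?q n x) \<le> indicator (cball 0 (R + 1)) x *\<^sub>R C"
      proof (cases "norm x \<le> R + 1")
        case True
        obtain s where s: "f (x + ?h n *\<^sub>R ?e) - f (x + 0 *\<^sub>R ?e) = (?h n - 0) * pd j f (x + s *\<^sub>R ?e)"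
          using MVT2[OF h(1) line[of x]] by blast
        then have "?q n x = pd j f (x + s *\<^sub>R ?e)" using h by (simp add: field_simps)
        then show ?thesis using True C by simp
      next
        case False
        have "norm x - norm (?h n *\<^sub>R ?e) \<le> norm (x + ?h n *\<^sub>R ?e)"
          using norm_triangle_ineq2[of x "- (?h n *\<^sub>R ?e)"] by simp
        then have "norm (x + ?h n *\<^sub>R ?e) > R" using False h by simp
        then show ?thesis using R False by simp
      qed
    qed
  qed
  then have "(LINT x|lborel. pd j f x) = 0"
    unfolding q0 by (rule LIMSEQ_unique[OF tendsto_const, symmetric])
  then show ?thesis using lebesgue_integral_continuous[OF cd] by simp
qed

text \<open>The product inherits compact support from \<open>g\<close>, so \<open>f\<close> may be
  affine or a kernel.\<close>

lemma integration_by_parts: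
  assumes f: "smooth f" and g: "test_function g"
  shows "(LINT x|lebesgue. f x * pd j g x) = - (LINT x|lebesgue. pd j f x * g x)"
proof -
  have g': "smooth g" "cpt_supp g" using g by (auto simp: test_function_iff)
  have "pd j (\<lambda>x. f x * g x) x = f x * pd j g x + pd j f x * g x" for x
    by (intro pd_mult smoothD f g')
  then have "0 = (LINT x|lebesgue. f x * pd j g x + pd j f x * g x)"
    using integral_pd_eq_0[OF smooth_mult[OF f g'(1)] cpt_supp_mult[OF g'(2)], of j] by simp
  also have "\<dots> = (LINT x|lebesgue. f x * pd j g x) + (LINT x|lebesgue. pd j f x * g x)"
    by (intro Bochner_Integration.integral_add integrable_continuous_cpt_supp continuous_intros
        smooth_continuous cpt_supp_mult cpt_supp_partial_deriv smooth_partial_deriv f g')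
  finally show ?thesis by simp
qed

section \<open>Recovering functions from their integrals against test functions\<close>

definition box_bump :: "real^2 \<Rightarrow> real^2 \<Rightarrow> nat \<Rightarrow> real^2 \<Rightarrow> real" where
  "box_bump a b n x = (flat_exp (real n * (x $ 1 - a $ 1)) * flat_exp (real n * (b $ 1 - x $ 1))) *
     (flat_exp (real n * (x $ 2 - a $ 2)) * flat_exp (real n * (b $ 2 - x $ 2)))"

lemma mem_box_2: "(x::real^2) \<in> box a b \<longleftrightarrow> a $ 1 < x $ 1 \<and> x $ 1 < b $ 1 \<and> a $ 2 < x $ 2 \<and> x $ 2 < b $ 2"
  by (auto simp: mem_box_cart forall_2)

lemma box_bump_bounds: "0 \<le> box_bump a b n x" "box_bump a b n x \<le> 1"
  unfolding box_bump_def by (auto intro!: mult_le_one flat_exp_le_1)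

lemma box_bump_eq_0:
  assumes "x \<notin> box a b" shows "box_bump a b n x = 0"
proof -
  have *: "flat_exp (real n * t) = 0" if "t \<le> 0" for t
    using that by (simp add: mult_nonneg_nonpos)
  consider "x $ 1 - a $ 1 \<le> 0" | "b $ 1 - x $ 1 \<le> 0" | "x $ 2 - a $ 2 \<le> 0" | "b $ 2 - x $ 2 \<le> 0"
    using assms unfolding mem_box_2 by linarith
  then show ?thesis unfolding box_bump_def by cases (auto simp: * simp del: flat_exp_neg)
qed

lemma box_bump_tendsto: "(\<lambda>n. box_bump a b n x) \<longlonglongrightarrow> indicator (box a b) x"
proof (cases "x \<in> box a b")
  case True
  then have "(\<lambda>n. box_bump a b n x) \<longlonglongrightarrow> (1 * 1) * (1 * 1)"
    unfolding box_bump_def mem_box_2 by (intro tendsto_mult flat_exp_scaled_tendsto) auto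
  then show ?thesis using True by simp
qed (simp add: box_bump_eq_0)

lemma test_function_box_bump: "test_function (box_bump a b n)"
proof -
  have *: "smooth (\<lambda>x. flat_exp (real n * (x $ i - c)))" "smooth (\<lambda>x. flat_exp (real n * (c - x $ i)))" for i c
    using smooth_compose[OF CkR_flat_exp smooth_mult[OF smooth_const smooth_add[OF smooth_nth smooth_const]], of "real n" i "-c"]
      smooth_compose[OF CkR_flat_exp smooth_mult[OF smooth_const smooth_add[OF smooth_const smooth_mult[OF smooth_const smooth_nth]]], of "real n" c "-1" i]
    by simp_all
  have "bounded (box a b)" by (rule bounded_box)
  then obtain R where "\<And>x. x \<in> box a b \<Longrightarrow> norm x \<le> R" by (auto simp: bounded_iff)
  then have "cpt_supp (box_bump a b n)"
    by (intro cpt_suppI[of R]) (metis box_bump_eq_0 not_le)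
  moreover have "smooth (box_bump a b n)"
    unfolding box_bump_def[abs_def] by (intro smooth_mult *)
  ultimately show ?thesis by (simp add: test_function_iff)
qed

text \<open>The fundamental lemma of the calculus of variations: box bumps make the integrals over
  all boxes in \<open>U\<close> vanish, and Lebesgue differentiation recovers \<open>h\<close>
  almost everywhere.\<close>

lemma AE_eq_0_if_integral_test_functions_eq_0:
  fixes h :: "real^2 \<Rightarrow> real"
  assumes U: "open U" and h: "\<And>a b. h absolutely_integrable_on cbox a b"
    and zero: "\<And>\<phi> a b. test_function \<phi> \<Longrightarrow> cbox a b \<subseteq> U \<Longrightarrow> (\<And>x. x \<notin> box a b \<Longrightarrow> \<phi> x = 0)
      \<Longrightarrow> (LINT x|lebesgue. h x * \<phi> x) = 0"
  shows "AE x in lebesgue. x \<in> U \<longrightarrow> h x = 0"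
proof -
  have int0: "integral (cbox a b) h = 0" if ab: "cbox a b \<subseteq> U" for a b
  proof -
    have hi: "integrable lebesgue (\<lambda>x. indicator (cbox a b) x *\<^sub>R h x)"
      using h[of a b] by (simp add: set_integrable_def)
    have bx: "h absolutely_integrable_on box a b"
      by (rule set_integrable_subset[OF h]) (auto intro: box_subset_cbox[THEN subsetD])
    have "(\<lambda>n. LINT x|lebesgue. h x * box_bump a b n x) \<longlonglongrightarrow> (LINT x|lebesgue. indicator (box a b) x *\<^sub>R h x)"
    proof (rule integral_dominated_convergence)
      show "(\<lambda>x. indicator (box a b) x *\<^sub>R h x) \<in> borel_measurable lebesgue"
        using bx by (simp add: set_integrable_def borel_measurable_integrable)
      show "(\<lambda>x. h x * box_bump a b n x) \<in> borel_measurable lebesgue" for n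
      proof -
        have "box_bump a b n \<in> borel_measurable lebesgue"
          using test_function_box_bump[of a b n]
          by (intro measurable_completion) (simp add: test_function_iff smooth_continuous borel_measurable_continuous_onI)
        \<comment> \<open>The bump vanishes off the box, so the extra indicator changes nothing;
          with it, measurability follows from local integrability of \<open>h\<close>.\<close>
        then have "(\<lambda>x. (indicator (cbox a b) x *\<^sub>R h x) * box_bump a b n x) \<in> borel_measurable lebesgue"
          by (intro borel_measurable_times borel_measurable_integrable[OF hi])
        moreover have "(\<lambda>x. (indicator (cbox a b) x *\<^sub>R h x) * box_bump a b n x) = (\<lambda>x. h x * box_bump a b n x)"
        proof
          fix x show "(indicator (cbox a b) x *\<^sub>R h x) * box_bump a b n x = h x * box_bump a b n x"
            using box_bump_eq_0[of x a b n] box_subset_cbox[of a b] by (cases "x \<in> cbox a b") auto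
        qed
        ultimately show ?thesis by simp
      qed
      show "integrable lebesgue (\<lambda>x. \<bar>indicator (cbox a b) x *\<^sub>R h x\<bar>)"
        using hi by (rule integrable_abs)
      show "AE x in lebesgue. (\<lambda>n. h x * box_bump a b n x) \<longlonglongrightarrow> indicator (box a b) x *\<^sub>R h x"
        using tendsto_mult[OF tendsto_const box_bump_tendsto] by (auto simp: mult.commute)
      show "AE x in lebesgue. norm (h x * box_bump a b n x) \<le> \<bar>indicator (cbox a b) x *\<^sub>R h x\<bar>" for n
      proof (rule AE_I2)
        fix x
        show "norm (h x * box_bump a b n x) \<le> \<bar>indicator (cbox a b) x *\<^sub>R h x\<bar>"
        proof (cases "x \<in> cbox a b")
          case True
          have "\<bar>h x\<bar> * \<bar>box_bump a b n x\<bar> \<le> \<bar>h x\<bar> * 1"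
            using box_bump_bounds[of a b n x] by (intro mult_left_mono) auto
          then show ?thesis using True by (simp add: abs_mult)
        next
          case False
          then have "box_bump a b n x = 0" using box_bump_eq_0 box_subset_cbox by blast
          then show ?thesis by simp
        qed
      qed
    qed
    moreover have "(LINT x|lebesgue. h x * box_bump a b n x) = 0" for n
      by (rule zero[OF test_function_box_bump ab box_bump_eq_0])
    ultimately have "(LINT x|lebesgue. indicator (box a b) x *\<^sub>R h x) = 0"
      by (simp add: LIMSEQ_const_iff)
    then have "integral (box a b) h = 0"
      using set_lebesgue_integral_eq_integral(2)[OF bx] by (simp add: set_lebesgue_integral_def)
    then show ?thesis by (simp add: integral_open_interval)
  qed
  have "h integrable_on cbox a b" for a b
    using h set_lebesgue_integral_eq_integral(1) by blast
  \<comment> \<open>Lebesgue differentiation along squares with lower left corner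
    \<open>x\<close>.\<close>
  then obtain N where N: "negligible N" "\<And>x e. \<lbrakk>x \<notin> N; 0 < e\<rbrakk> \<Longrightarrow>
      \<exists>d>0. \<forall>s. 0 < s \<and> s < d \<longrightarrow> norm (integral (cbox x (x + s *\<^sub>R One)) h /\<^sub>R s ^ DIM(real^2) - h x) < e"
    using integrable_ccontinuous_explicit by blast
  have "h x = 0" if x: "x \<in> U" "x \<notin> N" for x
  proof (rule ccontr)
    assume "h x \<noteq> 0"
    then obtain d where d: "d > 0" "\<And>s. 0 < s \<Longrightarrow> s < d \<Longrightarrow>
      norm (integral (cbox x (x + s *\<^sub>R One)) h /\<^sub>R s ^ DIM(real^2) - h x) < \<bar>h x\<bar>"
      using N(2)[OF x(2), of "\<bar>h x\<bar>"] by auto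
    obtain r where r: "r > 0" "ball x r \<subseteq> U" using U x openE by blast
    \<comment> \<open>Comparison with the l1 norm gives \<open>norm (y - x) \<le> 2 * s\<close> on
      the square, so \<open>s < r / 3\<close> keeps it in the ball.\<close>
    define s where "s = min d (r / 3) / 2"
    have s: "0 < s" "s < d" "s < r / 3" using d r by (auto simp: s_def)
    have "cbox x (x + s *\<^sub>R One) \<subseteq> ball x r"
    proof
      fix y assume y: "y \<in> cbox x (x + s *\<^sub>R One)"
      have "\<bar>(y - x) \<bullet> i\<bar> \<le> s" if "i \<in> Basis" for i
        using y s that unfolding mem_box by (auto simp: inner_simps dest!: bspec[of _ _ i])
      then have "(\<Sum>i\<in>Basis. \<bar>(y - x) \<bullet> i\<bar>) \<le> of_nat (card (Basis :: (real^2) set)) * s"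
        by (intro sum_bounded_above)
      then have "norm (y - x) \<le> 2 * s"
        using norm_le_l1[of "y - x"] by simp
      then show "y \<in> ball x r" using s by (simp add: dist_norm norm_minus_commute)
    qed
    then have "integral (cbox x (x + s *\<^sub>R One)) h = 0" using int0 r by blast
    then show False using d(2)[OF s(1,2)] by simp
  qed
  then have "AE x in lebesgue. x \<notin> N \<longrightarrow> (x \<in> U \<longrightarrow> h x = 0)" by auto
  moreover have "AE x in lebesgue. x \<notin> N"
    using N(1) by (intro AE_not_in) (simp add: negligible_iff_null_sets)
  ultimately show ?thesis by eventually_elim auto
qed

text \<open>Uniqueness of weak gradients: on boxes inside \<open>U\<close> the field
  \<open>u\<close> can be exchanged for a globally smooth affine function, which is then integrated
  by parts.\<close>

lemma weak_gradient_eq_on_open: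
  assumes H: "H1_loc_grad u G" and U: "open U" and u: "\<And>x. x \<in> U \<Longrightarrow> u x = B *v x + b"
  shows "AE x in lebesgue. x \<in> U \<longrightarrow> G x = B"
proof -
  have "AE x in lebesgue. x \<in> U \<longrightarrow> G x $ k $ l - B $ k $ l = 0" for k l
  proof (rule AE_eq_0_if_integral_test_functions_eq_0[OF U])
    have G: "L2_loc (\<lambda>x. G x $ k $ l)" and W: "weak_partial l (\<lambda>x. u x $ k) (\<lambda>x. G x $ k $ l)"
      using H by (auto simp: H1_loc_grad_def)
    show "(\<lambda>x. G x $ k $ l - B $ k $ l) absolutely_integrable_on cbox p q" for p q
      by (intro set_integral_diff L2_loc_set_integrable[OF G compact_cbox] absolutely_integrable_on_const) simp
    fix \<phi> p q assume \<phi>: "test_function \<phi>" and ab: "cbox p q \<subseteq> U" and out: "\<And>x. x \<notin> box p q \<Longrightarrow> \<phi> x = 0"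
    have \<phi>': "smooth \<phi>" "cpt_supp \<phi>" using \<phi> by (auto simp: test_function_iff)
    have out': "pd l \<phi> x = 0" if "x \<notin> cbox p q" for x
    proof -
      have "pd l \<phi> x = pd l (\<lambda>x. 0) x"
        by (rule pd_cong_open[of "- cbox p q"])
           (use that out box_subset_cbox in \<open>auto simp: closed_cbox open_Compl\<close>)
      then show ?thesis by simp
    qed
    define g where "g x = (\<Sum>i\<in>UNIV. B $ k $ i * x $ i) + b $ k" for x :: "real^2"
    have g: "smooth g" and dg: "pd l g x = B $ k $ l" for x
      unfolding g_def by (rule pd_affine_form)+
    have u_g: "u x $ k * pd l \<phi> x = g x * pd l \<phi> x" for x
    proof (cases "x \<in> cbox p q")
      case True
      then have "u x = B *v x + b" using u ab by blast
      then show ?thesis by (simp add: g_def matrix_vector_mult_def)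
    qed (simp add: out')
    have "(LINT x|lebesgue. u x $ k * pd l \<phi> x) = - (LINT x|lebesgue. G x $ k $ l * \<phi> x)"
      using W \<phi> unfolding weak_partial_def by blast
    then have "(LINT x|lebesgue. G x $ k $ l * \<phi> x) = - (LINT x|lebesgue. g x * pd l \<phi> x)"
      unfolding u_g by linarith
    also have "\<dots> = (LINT x|lebesgue. B $ k $ l * \<phi> x)"
      unfolding integration_by_parts[OF g \<phi>] dg by simp
    finally have eq: "(LINT x|lebesgue. G x $ k $ l * \<phi> x) = (LINT x|lebesgue. B $ k $ l * \<phi> x)" .
    have "(LINT x|lebesgue. (G x $ k $ l - B $ k $ l) * \<phi> x) =
        (LINT x|lebesgue. G x $ k $ l * \<phi> x) - (LINT x|lebesgue. B $ k $ l * \<phi> x)"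
      unfolding left_diff_distrib
      by (intro Bochner_Integration.integral_diff L2_loc_integrable_mult[OF G] integrable_continuous_cpt_supp
          continuous_intros smooth_continuous \<phi>' cpt_supp_mult)
    then show "(LINT x|lebesgue. (G x $ k $ l - B $ k $ l) * \<phi> x) = 0" using eq by simp
  qed
  from this[of 1 1] this[of 1 2] this[of 2 1] this[of 2 2] show ?thesis
    by eventually_elim (auto simp: vec_eq_iff forall_2)
qed

section \<open>Consequences of the Lipschitz boundary\<close>

lemma lipschitz_chart:
  assumes "lipschitz_boundary S" "p \<in> frontier S"
  obtains N e f L g where "open N" "p \<in> N" "norm e = 1" "norm f = 1" "e \<bullet> f = 0"
    "L-lipschitz_on UNIV (g :: real \<Rightarrow> real)"
    "\<And>x. x = p + ((x - p) \<bullet> e) *\<^sub>R e + ((x - p) \<bullet> f) *\<^sub>R f"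
    "\<And>x. x \<in> N \<Longrightarrow> x \<in> S \<longleftrightarrow> (x - p) \<bullet> f < g ((x - p) \<bullet> e)"
    "\<And>x. x \<in> N \<Longrightarrow> x \<in> closure S \<Longrightarrow> (x - p) \<bullet> f \<le> g ((x - p) \<bullet> e)"
proof -
  obtain e f r h L g where g: "norm e = 1" "norm f = 1" "e \<bullet> f = 0" "r > 0" "h > 0"
    "L-lipschitz_on UNIV (g :: real \<Rightarrow> real)"
    "\<And>s t. \<bar>s\<bar> < r \<Longrightarrow> \<bar>t\<bar> < h \<Longrightarrow> (p + s *\<^sub>R e + t *\<^sub>R f \<in> S \<longleftrightarrow> t < g s)"
    using assms unfolding lipschitz_boundary_def by metis
  define N where "N = {x. \<bar>(x - p) \<bullet> e\<bar> < r \<and> \<bar>(x - p) \<bullet> f\<bar> < h}"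
  have rep: "x = p + ((x - p) \<bullet> e) *\<^sub>R e + ((x - p) \<bullet> f) *\<^sub>R f" for x
  proof -
    have ef: "e \<bullet> e = 1" "f \<bullet> f = 1" using g by (auto simp: dot_square_norm)
    define v where "v = x - p"
    have "(v $ 1 - ((v \<bullet> e) * e $ 1 + (v \<bullet> f) * f $ 1) = 0) \<and> (v $ 2 - ((v \<bullet> e) * e $ 2 + (v \<bullet> f) * f $ 2) = 0)"
      using ef g(3) unfolding inner_vec_def sum_2 inner_real_def by algebra
    then have "v = (v \<bullet> e) *\<^sub>R e + (v \<bullet> f) *\<^sub>R f" by (simp add: vec_eq_iff forall_2)
    then show ?thesis unfolding v_def by (simp add: algebra_simps)
  qed
  have mem: "x \<in> S \<longleftrightarrow> (x - p) \<bullet> f < g ((x - p) \<bullet> e)" if "x \<in> N" for x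
    using g(7)[of "(x - p) \<bullet> e" "(x - p) \<bullet> f"] rep[of x] that by (simp add: N_def)
  have N: "open N" "p \<in> N"
    using g by (auto simp: N_def intro!: open_Collect_conj open_Collect_less continuous_intros)
  \<comment> \<open>The points strictly above the graph form an open set disjoint from
    \<open>S\<close>, so the closure cannot reach them.\<close>
  have cl: "(x - p) \<bullet> f \<le> g ((x - p) \<bullet> e)" if x: "x \<in> N" "x \<in> closure S" for x
  proof (rule ccontr)
    assume gt: "\<not> (x - p) \<bullet> f \<le> g ((x - p) \<bullet> e)"
    let ?V = "N \<inter> {x. (x - p) \<bullet> f > g ((x - p) \<bullet> e)}"
    have "open ?V"
      by (intro open_Int N open_Collect_less continuous_intros
          continuous_on_compose2[OF lipschitz_on_continuous_on[OF g(6)]]) auto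
    moreover have "?V \<inter> S = {}" using mem by auto
    ultimately have "?V \<inter> closure S = {}" using open_Int_closure_eq_empty by blast
    then show False using x gt by auto
  qed
  show ?thesis by (rule that[OF N g(1-3) g(6) rep mem cl])
qed

text \<open>Locally the frontier lies on a Lipschitz graph, the Lipschitz image of a line;
  compactness leaves finitely many charts. The result is used because
  \<open>composite_tensor\<close> is zero on the frontier, since both indicators vanish
  there.\<close>

lemma negligible_frontier_lipschitz:
  assumes S: "open S" "bounded S" "lipschitz_boundary S"
  shows "negligible (frontier S)"
proof -
  have "\<exists>T. open T \<and> p \<in> T \<and> negligible (frontier S \<inter> T)" if p: "p \<in> frontier S" for p
  proof -
    obtain T e f L g where T: "open T" "p \<in> T" and ef: "norm e = 1" "norm f = 1"
      and g: "L-lipschitz_on UNIV (g :: real \<Rightarrow> real)"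
      and rep: "\<And>x. x = p + ((x - p) \<bullet> e) *\<^sub>R e + ((x - p) \<bullet> f) *\<^sub>R f"
      and mem: "\<And>x. x \<in> T \<Longrightarrow> x \<in> S \<longleftrightarrow> (x - p) \<bullet> f < g ((x - p) \<bullet> e)"
      and cl: "\<And>x. x \<in> T \<Longrightarrow> x \<in> closure S \<Longrightarrow> (x - p) \<bullet> f \<le> g ((x - p) \<bullet> e)"
      by (rule lipschitz_chart[OF S(3) p]) blast
    define P where "P x = p + x $ 1 *\<^sub>R e + g (x $ 1) *\<^sub>R f" for x :: "real^2"
    have "frontier S \<inter> T \<subseteq> P ` {x. x $ 2 = 0}"
    proof
      fix x assume x: "x \<in> frontier S \<inter> T"
      then have "x \<notin> S" "x \<in> closure S" using S(1) by (auto simp: frontier_def interior_open)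
      then have "(x - p) \<bullet> f = g ((x - p) \<bullet> e)" using mem[of x] cl[of x] x by auto
      then have "x = p + ((x - p) \<bullet> e) *\<^sub>R e + g ((x - p) \<bullet> e) *\<^sub>R f" using rep[of x] by simp
      then have "x = P (axis 1 ((x - p) \<bullet> e))" by (simp add: P_def axis_def)
      moreover have "axis 1 ((x - p) \<bullet> e) $ (2::2) = 0" by (simp add: axis_def)
      ultimately show "x \<in> P ` {x. x $ 2 = 0}" by blast
    qed
    moreover have "negligible (P ` {x. x $ 2 = 0})"
    proof (rule negligible_locally_Lipschitz_image)
      show "negligible {x::real^2. x $ 2 = 0}" by (rule negligible_standard_hyperplane_cart)
      fix x :: "real^2"
      have "norm (P y - P x) \<le> (1 + L) * norm (y - x)" for y
      proof -
        have "P y - P x = (y $ 1 - x $ 1) *\<^sub>R e + (g (y $ 1) - g (x $ 1)) *\<^sub>R f"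
          by (simp add: P_def algebra_simps)
        then have "norm (P y - P x) \<le> \<bar>y $ 1 - x $ 1\<bar> + \<bar>g (y $ 1) - g (x $ 1)\<bar>"
          using norm_triangle_ineq[of "(y $ 1 - x $ 1) *\<^sub>R e" "(g (y $ 1) - g (x $ 1)) *\<^sub>R f"] ef by simp
        also have "\<bar>g (y $ 1) - g (x $ 1)\<bar> \<le> L * \<bar>y $ 1 - x $ 1\<bar>"
          using lipschitz_onD[OF g, of "y $ 1" "x $ 1"] by (simp add: dist_real_def)
        also have "\<bar>y $ 1 - x $ 1\<bar> + L * \<bar>y $ 1 - x $ 1\<bar> = (1 + L) * \<bar>(y - x) $ 1\<bar>"
          by (simp add: algebra_simps)
        also have "\<dots> \<le> (1 + L) * norm (y - x)"
          using lipschitz_on_nonneg[OF g] by (intro mult_left_mono component_le_norm_cart) auto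
        finally show ?thesis by simp
      qed
      then show "\<exists>T B. open T \<and> x \<in> T \<and> (\<forall>y\<in>{x. x $ 2 = 0} \<inter> T. norm (P y - P x) \<le> B * norm (y - x))"
        by (intro exI[of _ UNIV] exI[of _ "1 + L"]) auto
    qed simp
    ultimately show ?thesis using T negligible_subset by blast
  qed
  then obtain T where T: "\<And>p. p \<in> frontier S \<Longrightarrow> open (T p) \<and> p \<in> T p \<and> negligible (frontier S \<inter> T p)"
    by metis
  have "compact (frontier S)" by (rule compact_frontier_bounded[OF S(2)])
  then obtain D where D: "D \<subseteq> frontier S" "finite D" "frontier S \<subseteq> (\<Union>p\<in>D. T p)"
    using compactE_image[of "frontier S" "frontier S" T] T by blast
  have "negligible (\<Union>p\<in>D. frontier S \<inter> T p)" using D T by (intro negligible_Union finite_imageI) auto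
  then show ?thesis by (rule negligible_subset) (use D(3) in auto)
qed

text \<open>Just above a frontier point the chart contains points outside the closure, so
  \<open>S\<close> has no slits. Later this identifies the frontier of the complement of the closure
  with that of \<open>S\<close>.\<close>

lemma interior_closure_lipschitz:
  assumes S: "open S" "lipschitz_boundary S"
  shows "interior (closure S) = S"
proof
  show "S \<subseteq> interior (closure S)" by (simp add: S(1) closure_subset interior_maximal)
  show "interior (closure S) \<subseteq> S"
  proof
    fix p assume pi: "p \<in> interior (closure S)"
    show "p \<in> S"
    proof (rule ccontr)
      assume p: "p \<notin> S"
      then have "p \<in> frontier S" using pi S(1) interior_subset by (auto simp: frontier_def interior_open)
      then obtain N e f L g where N: "open N" "p \<in> N" and ef: "norm f = 1" "e \<bullet> f = 0"
        and mem: "\<And>x. x \<in> N \<Longrightarrow> x \<in> S \<longleftrightarrow> (x - p) \<bullet> f < g ((x - p) \<bullet> e)"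
        and cl: "\<And>x. x \<in> N \<Longrightarrow> x \<in> closure S \<Longrightarrow> (x - p) \<bullet> f \<le> g ((x - p) \<bullet> e)"
        by (rule lipschitz_chart[OF S(2)]) blast
      have g0: "g 0 \<le> 0" using mem[OF N(2)] p by simp
      have "open (N \<inter> interior (closure S))" using N(1) by blast
      then obtain d where d: "d > 0" "ball p d \<subseteq> N \<inter> interior (closure S)"
        using N(2) pi unfolding open_contains_ball by blast
      let ?x = "p + (d / 2) *\<^sub>R f"
      have "?x \<in> ball p d" using d(1) ef by (simp add: dist_norm)
      then have "?x \<in> N" "?x \<in> closure S" using d(2) interior_subset by blast+
      from cl[OF this] show False using ef g0 d(1) by (simp add: inner_commute dot_square_norm)
    qed
  qed
qed

section \<open>The equation with constant coefficients\<close>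

text \<open>Both factors 2 come from applying the tensor to \<open>G + transpose G\<close>, twice
  the strain.\<close>

lemma contract_iso_tensor:
  "contract (iso_tensor l m) (G + transpose G) $ i $ j =
     2 * l * kron i j * (G $ 1 $ 1 + G $ 2 $ 2) + 2 * m * (G $ i $ j + G $ j $ i)"
  using exhaust_2[of i] exhaust_2[of j]
  by (auto simp: contract_def iso_tensor_def kron_def sum_2 transpose_def algebra_simps)

lemma composite_tensor_outside:
  "x \<notin> closure \<Omega> \<Longrightarrow> composite_tensor \<Omega> lam mu lam' mu' x = iso_tensor lam mu"
  using closure_subset[of \<Omega>] by (auto simp: composite_tensor_def indicator_def)

lemma composite_tensor_inside:
  "x \<in> \<Omega> \<Longrightarrow> composite_tensor \<Omega> lam mu lam' mu' x = iso_tensor lam' mu'"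
  using closure_subset[of \<Omega>] by (auto simp: composite_tensor_def indicator_def)

text \<open>Inside \<open>\<Omega>\<close> the inclusion stress is the matrix stress minus the
  constant \<open>\<tau>\<close>, so the composite equation becomes one with constant coefficients
  and a source on \<open>\<Omega>\<close>. The weak derivatives are then moved from \<open>u\<close>
  to the test function.\<close>

lemma weak_equation:
  fixes \<Omega> :: "(real^2) set"
  assumes \<Omega>: "open \<Omega>" "negligible (frontier \<Omega>)"
    and sol: "weak_elastic_solution (composite_tensor \<Omega> lam mu lam' mu') u"
    and u: "\<And>x. x \<in> \<Omega> \<Longrightarrow> u x = B *v x + b"
    and \<phi>: "test_function \<phi>"
  defines "\<tau> \<equiv> contract (iso_tensor lam mu) (B + transpose B) - contract (iso_tensor lam' mu') (B + transpose B)"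
  shows "2 * mu * (\<Sum>j\<in>UNIV. LINT x|lebesgue. u x $ i * pd j (pd j \<phi>) x)
     + 2 * (lam + mu) * (\<Sum>k\<in>UNIV. LINT x|lebesgue. u x $ k * pd k (pd i \<phi>) x)
     = - (\<Sum>j\<in>UNIV. \<tau> $ i $ j * (LINT x|lebesgue. indicator \<Omega> x * pd j \<phi> x))"
proof -
  obtain G where H: "H1_loc_grad u G" and eq: "\<And>\<phi> i. test_function \<phi> \<Longrightarrow>
      (LINT x|lebesgue. (\<Sum>j\<in>UNIV. contract (composite_tensor \<Omega> lam mu lam' mu' x) (G x + transpose (G x)) $ i $ j
        * pd j \<phi> x)) = 0"
    using sol by (auto simp: weak_elastic_solution_def)
  have GB: "AE x in lebesgue. x \<in> \<Omega> \<longrightarrow> G x = B"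
    by (rule weak_gradient_eq_on_open[OF H \<Omega>(1) u])
  have fr: "AE x in lebesgue. x \<notin> frontier \<Omega>"
    using \<Omega>(2) by (intro AE_not_in) (simp add: negligible_iff_null_sets)
  let ?D = "\<lambda>j. pd j \<phi>"
  let ?g = "\<lambda>k l j. \<lambda>x. G x $ k $ l * ?D j x"
  have D: "smooth (?D j)" "cpt_supp (?D j)" "test_function (?D j)" for j
    using test_function_partial_deriv[OF \<phi>, of j] by (auto simp: test_function_iff)
  have Gi: "integrable lebesgue (?g k l j)" for k l j
    using H D by (intro L2_loc_integrable_mult smooth_continuous) (auto simp: H1_loc_grad_def)
  have Oi: "integrable lebesgue (\<lambda>x. indicator \<Omega> x * ?D j x)" for j
    using integrable_mult_indicator[OF _ integrable_continuous_cpt_supp[OF smooth_continuous[OF D(1)] D(2)], of \<Omega> j] \<Omega>(1)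
    by simp
  let ?S = "\<lambda>x. \<Sum>j\<in>UNIV. contract (iso_tensor lam mu) (G x + transpose (G x)) $ i $ j * ?D j x"
  let ?T = "\<lambda>x. \<Sum>j\<in>UNIV. \<tau> $ i $ j * (indicator \<Omega> x * ?D j x)"
  \<comment> \<open>Two null sets are discarded: the frontier, where the composite tensor is zero,
    and the points of \<open>\<Omega>\<close> where \<open>G\<close> differs from
    \<open>B\<close>.\<close>
  have "AE x in lebesgue. (\<Sum>j\<in>UNIV. contract (composite_tensor \<Omega> lam mu lam' mu' x) (G x + transpose (G x)) $ i $ j * ?D j x)
      = ?S x - ?T x"
    using GB fr
  proof eventually_elim
    case (elim x)
    show ?case
    proof (cases "x \<in> \<Omega>")
      case True
      then show ?thesis using elim
        by (simp add: composite_tensor_inside \<tau>_def left_diff_distrib sum_subtractf)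
    next
      case False
      then have "x \<notin> closure \<Omega>" using elim \<Omega>(1) by (auto simp: frontier_def interior_open)
      then show ?thesis using False by (simp add: composite_tensor_outside)
    qed
  qed
  \<comment> \<open>Expansion into the products \<open>?g k l j\<close>, each of which is integrable
    and carries a single weak derivative.\<close>
  have Scont: "?S = (\<lambda>x. 2 * lam * (kron i 1 * (?g 1 1 1 x + ?g 2 2 1 x) + kron i 2 * (?g 1 1 2 x + ?g 2 2 2 x))
      + 2 * mu * ((?g i 1 1 x + ?g 1 i 1 x) + (?g i 2 2 x + ?g 2 i 2 x)))"
    by (simp add: fun_eq_iff contract_iso_tensor sum_2 algebra_simps)
  have Si: "integrable lebesgue ?S"
    unfolding Scont by (intro integrable_mult_right Bochner_Integration.integrable_add Gi)
  have Ti: "integrable lebesgue ?T"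
    by (intro Bochner_Integration.integrable_sum integrable_mult_right Oi)
  have "0 = (LINT x|lebesgue. (\<Sum>j\<in>UNIV. contract (composite_tensor \<Omega> lam mu lam' mu' x) (G x + transpose (G x)) $ i $ j * ?D j x))"
    using eq[OF \<phi>, of i] by simp
  also have "\<dots> = (LINT x|lebesgue. ?S x - ?T x)"
  proof (rule integral_cong_AE)
    show diff: "(\<lambda>x. ?S x - ?T x) \<in> borel_measurable lebesgue"
      using Si Ti by (intro borel_measurable_diff) auto
    have Gm: "(\<lambda>x. G x $ k $ l) \<in> borel_measurable lebesgue" for k l
      using H by (auto simp: H1_loc_grad_def L2_loc_def)
    have Dm: "?D j \<in> borel_measurable lebesgue" for j
      using smooth_continuous[OF D(1)[of j]]
      by (intro measurable_completion) (simp add: borel_measurable_continuous_onI)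
    have I: "(indicator \<Omega> :: _ \<Rightarrow> real) \<in> borel_measurable lebesgue"
        "(indicator (UNIV - closure \<Omega>) :: _ \<Rightarrow> real) \<in> borel_measurable lebesgue"
      using \<Omega>(1) by (auto intro!: borel_measurable_indicator)
    show "(\<lambda>x. \<Sum>j\<in>UNIV. contract (composite_tensor \<Omega> lam mu lam' mu' x) (G x + transpose (G x)) $ i $ j * ?D j x)
        \<in> borel_measurable lebesgue"
      unfolding composite_tensor_def contract_iso_tensor
      by (intro borel_measurable_sum borel_measurable_times borel_measurable_add borel_measurable_const Gm Dm I)
  qed fact
  also have "\<dots> = (LINT x|lebesgue. ?S x) - (LINT x|lebesgue. ?T x)"
    by (rule Bochner_Integration.integral_diff[OF Si Ti])
  finally have ST: "(LINT x|lebesgue. ?S x) = (LINT x|lebesgue. ?T x)" by simp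
  have T: "(LINT x|lebesgue. ?T x) = (\<Sum>j\<in>UNIV. \<tau> $ i $ j * (LINT x|lebesgue. indicator \<Omega> x * ?D j x))"
    by (simp add: Bochner_Integration.integral_sum integrable_mult_right Oi)
  have M: "(LINT x|lebesgue. ?g k l j x) = - (LINT x|lebesgue. u x $ k * pd l (?D j) x)" for k l j
    using H D(3)[of j] by (auto simp: H1_loc_grad_def weak_partial_def)
  have S: "(LINT x|lebesgue. ?S x) =
      2 * lam * (kron i 1 * ((LINT x|lebesgue. ?g 1 1 1 x) + (LINT x|lebesgue. ?g 2 2 1 x))
        + kron i 2 * ((LINT x|lebesgue. ?g 1 1 2 x) + (LINT x|lebesgue. ?g 2 2 2 x)))
      + 2 * mu * (((LINT x|lebesgue. ?g i 1 1 x) + (LINT x|lebesgue. ?g 1 i 1 x))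
        + ((LINT x|lebesgue. ?g i 2 2 x) + (LINT x|lebesgue. ?g 2 i 2 x)))"
    unfolding Scont
    by (simp only: Bochner_Integration.integral_add integral_mult_right_zero integrable_mult_right
        Bochner_Integration.integrable_add Gi)
  have comm: "pd 2 (?D 1) = pd 1 (?D 2)"
    using \<phi> by (intro pd_commute) (simp add: test_function_iff)
  have "i = 1 \<or> i = 2" by (rule exhaust_2)
  then show ?thesis
    using ST unfolding S T M by (elim disjE) (simp_all add: sum_2 kron_def comm algebra_simps)
qed

section \<open>Mollified and truncated fundamental solutions\<close>

definition lap :: "(real^2 \<Rightarrow> real) \<Rightarrow> real^2 \<Rightarrow> real" where
  "lap f x = (\<Sum>j\<in>UNIV. pd j (pd j f) x)"

lemma smooth_lap: "smooth f \<Longrightarrow> smooth (lap f)"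
  unfolding lap_def[abs_def] by (intro smooth_sum smooth_partial_deriv) auto

lemma cpt_supp_lap: "cpt_supp f \<Longrightarrow> cpt_supp (lap f)"
  unfolding lap_def[abs_def] sum_2 by (intro cpt_supp_add cpt_supp_partial_deriv)

lemma test_function_lap: "test_function f \<Longrightarrow> test_function (lap f)"
  by (simp add: test_function_iff smooth_lap cpt_supp_lap)

lemma pd_lap:
  assumes "smooth f" shows "pd m (lap f) = lap (pd m f)"
proof -
  have c: "pd m (pd j (pd j f)) = pd j (pd j (pd m f))" for j
    by (metis assms pd_commute smooth_partial_deriv)
  have "pd m (lap f) = (\<lambda>x. \<Sum>j\<in>UNIV. pd m (pd j (pd j f)) x)"
    unfolding lap_def[abs_def] by (intro pd_sum smooth_partial_deriv assms)
  then show ?thesis by (simp add: lap_def[abs_def] c)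
qed

lemma lap_shift: "smooth f \<Longrightarrow> lap (\<lambda>x. f (x - a)) = (\<lambda>x. lap f (x - a))"
  by (simp add: lap_def[abs_def] pd_shift smooth_partial_deriv)

lemma pd_scaled:
  "smooth f \<Longrightarrow> pd j (\<lambda>x. a * f (c *\<^sub>R x)) = (\<lambda>x. (a * c) * pd j f (c *\<^sub>R x))"
  using pd_cmult_smooth[OF smooth_scale, of f j a c] by (simp add: pd_scale mult.assoc)

lemma lap_scaled: "smooth f \<Longrightarrow> lap (\<lambda>x. a * f (c *\<^sub>R x)) = (\<lambda>x. (a * c\<^sup>2) * lap f (c *\<^sub>R x))"
  unfolding lap_def[abs_def]
  by (simp only: pd_scaled smooth_partial_deriv sum_distrib_left power2_eq_square mult.assoc[symmetric])

lemma lap_cong_open: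
  assumes "open S" "\<And>y. y \<in> S \<Longrightarrow> f y = g y" "x \<in> S"
  shows "lap f x = lap g x"
  unfolding lap_def
  by (intro sum.cong refl pd_cong_open[OF assms(1) _ assms(3)]) (rule pd_cong_open[OF assms(1,2)])

text \<open>Outside the ball of radius \<open>\<epsilon>\<close> the function \<open>rad_pot \<epsilon>\<close> is \<open>\<bar>x\<bar>\<^sup>2 ln (\<bar>x\<bar> / \<epsilon>) / 4\<close>, a fundamental
  solution of the bilaplacian up to a factor and lower order terms, and its Laplacian is \<open>ln \<bar>x\<bar>\<close> up to
  a constant. The function \<open>cut_pot \<epsilon> R\<close> is a truncation at radius \<open>R\<close>; the constant
  \<open>ln (\<epsilon>\<^sup>2 / R\<^sup>2)\<close> makes the outer parts for different \<open>R\<close> rescalings of each other.\<close>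

definition rad_pot :: "real \<Rightarrow> real^2 \<Rightarrow> real" where
  "rad_pot \<epsilon> x = (1/8) * ((x \<bullet> x) * reg_ln ((1 / \<epsilon>\<^sup>2) * (x \<bullet> x)))"

definition cut_pot :: "real \<Rightarrow> real \<Rightarrow> real^2 \<Rightarrow> real" where
  "cut_pot \<epsilon> R x = (1/8) * ((x \<bullet> x) * (reg_ln ((1 / \<epsilon>\<^sup>2) * (x \<bullet> x)) + ln (\<epsilon>\<^sup>2 / R\<^sup>2))) * cutoff ((1 / R\<^sup>2) * (x \<bullet> x))"

lemma smooth_rad_pot: "smooth (rad_pot \<epsilon>)"
  unfolding rad_pot_def[abs_def]
  by (intro smooth_mult smooth_const smooth_inner_self smooth_compose[OF CkR_reg_ln])

lemma smooth_cut_pot: "smooth (cut_pot \<epsilon> R)"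
  unfolding cut_pot_def[abs_def]
  by (intro smooth_mult smooth_add smooth_const smooth_inner_self smooth_compose[OF CkR_reg_ln] smooth_compose[OF CkR_cutoff])

lemma inner_self_le: "norm (x::real^2) \<le> r \<Longrightarrow> x \<bullet> x \<le> r\<^sup>2"
  by (simp add: dot_square_norm power_mono)

lemma inner_self_gt: "norm (x::real^2) > r \<Longrightarrow> r \<ge> 0 \<Longrightarrow> x \<bullet> x > r\<^sup>2"
  by (simp add: dot_square_norm power_strict_mono)

text \<open>The argument of \<open>cutoff\<close> is at least 4 here, beyond its threshold
  3.\<close>

lemma cut_pot_eq_0: "R > 0 \<Longrightarrow> norm x \<ge> 2 * R \<Longrightarrow> cut_pot \<epsilon> R x = 0"
proof -
  assume R: "R > 0" "norm x \<ge> 2 * R"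
  have "(2 * R)\<^sup>2 \<le> x \<bullet> x" unfolding dot_square_norm by (intro power_mono R) (use R in auto)
  then have "4 * R\<^sup>2 \<le> x \<bullet> x" by (simp add: power_mult_distrib)
  moreover have "0 \<le> R\<^sup>2" by simp
  ultimately have "3 * R\<^sup>2 \<le> x \<bullet> x" by linarith
  then have "3 \<le> (1 / R\<^sup>2) * (x \<bullet> x)" using R by (simp add: field_simps)
  then show ?thesis by (simp add: cut_pot_def cutoff_eq_0)
qed

lemma test_function_cut_pot: "R > 0 \<Longrightarrow> test_function (cut_pot \<epsilon> R)"
  using cut_pot_eq_0[of R] by (auto simp: test_function_iff smooth_cut_pot intro!: cpt_suppI[of "2 * R"])

lemma lap_inner_self: "lap (\<lambda>x. c * (x \<bullet> x)) = (\<lambda>x. 4 * c)"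
proof -
  have "pd j (\<lambda>x. c * (x \<bullet> x)) = (\<lambda>x. (2 * c) * x $ j)" for j
    using pd_cmult_smooth[OF smooth_inner_self, of j c] by (simp add: pd_inner_self fun_eq_iff)
  moreover have "pd j (\<lambda>x. (2 * c) * x $ j) = (\<lambda>x. 2 * c)" for j
    using pd_cmult_smooth[OF smooth_nth, of j "2 * c" j] by (simp add: kron_def)
  ultimately show ?thesis by (simp add: lap_def[abs_def] sum_2)
qed

lemma lap_add: "smooth f \<Longrightarrow> smooth g \<Longrightarrow> lap (\<lambda>x. f x + g x) = (\<lambda>x. lap f x + lap g x)"
proof -
  assume s: "smooth f" "smooth g"
  have add: "pd j (\<lambda>x. f x + g x) = (\<lambda>x. pd j f x + pd j g x)"
    if "smooth f" "smooth g" for f g j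
    using that by (intro ext pd_add smoothD)
  show ?thesis
    by (simp add: lap_def[abs_def] add s smooth_partial_deriv sum.distrib)
qed

text \<open>Inside the cutoff radius the truncated potential differs from the untruncated one by a
  multiple of the square of the norm, which the derivatives considered here annihilate.\<close>

lemma lap_cut_pot_inside:
  assumes "norm x < R"
  shows "lap (cut_pot \<epsilon> R) x = lap (rad_pot \<epsilon>) x + ln (\<epsilon>\<^sup>2 / R\<^sup>2) / 2"
proof -
  let ?c = "ln (\<epsilon>\<^sup>2 / R\<^sup>2) / 8"
  have "lap (cut_pot \<epsilon> R) x = lap (\<lambda>x. rad_pot \<epsilon> x + ?c * (x \<bullet> x)) x"
  proof (rule lap_cong_open[of "ball 0 R"])
    fix y :: "real^2" assume "y \<in> ball 0 R"
    then have "norm y < R" by simp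
    then have "y \<bullet> y < R\<^sup>2" unfolding dot_square_norm by (intro power_strict_mono) auto
    then have "(1 / R\<^sup>2) * (y \<bullet> y) \<le> 1" using le_less_trans[OF norm_ge_zero \<open>norm y < R\<close>] by (simp add: field_simps)
    then show "cut_pot \<epsilon> R y = rad_pot \<epsilon> y + ?c * (y \<bullet> y)"
      by (simp add: cut_pot_def rad_pot_def cutoff_eq_1 algebra_simps)
  qed (use assms in auto)
  also have "\<dots> = lap (rad_pot \<epsilon>) x + ln (\<epsilon>\<^sup>2 / R\<^sup>2) / 2"
    by (simp only: lap_add[OF smooth_rad_pot smooth_mult[OF smooth_const smooth_inner_self]] lap_inner_self)
  finally show ?thesis .
qed

text \<open>A mollification of \<open>x $ m / (x \<bullet> x)\<close>, the gradient of
  \<open>ln (norm x)\<close>.\<close>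

definition kern :: "2 \<Rightarrow> real \<Rightarrow> real^2 \<Rightarrow> real" where
  "kern m \<epsilon> = pd m (lap (rad_pot \<epsilon>))"

text \<open>The mollified Laplacian of \<open>ln (norm x)\<close>: a smooth approximation to a
  multiple of the Dirac mass, zero outside the ball of radius \<open>\<epsilon>\<close>.\<close>

definition bump :: "real \<Rightarrow> real^2 \<Rightarrow> real" where
  "bump \<epsilon> = lap (lap (rad_pot \<epsilon>))"

lemma smooth_kern: "smooth (kern m \<epsilon>)" and smooth_bump: "smooth (bump \<epsilon>)"
  unfolding kern_def bump_def by (intro smooth_partial_deriv smooth_lap smooth_rad_pot)+

lemma bump_eq_div_kern: "bump \<epsilon> x = (\<Sum>j\<in>UNIV. pd j (kern j \<epsilon>) x)"
  by (simp add: bump_def kern_def lap_def)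

lemma pd_kern_commute: "pd j (kern m \<epsilon>) = pd m (kern j \<epsilon>)"
  unfolding kern_def by (intro pd_commute smooth_lap smooth_rad_pot)

lemma pd_cut_pot_inside:
  assumes "norm x < R"
  shows "pd m (lap (cut_pot \<epsilon> R)) x = kern m \<epsilon> x"
proof -
  have "pd m (lap (cut_pot \<epsilon> R)) x = pd m (\<lambda>x. lap (rad_pot \<epsilon>) x + ln (\<epsilon>\<^sup>2 / R\<^sup>2) / 2) x"
    by (rule pd_cong_open[of "ball 0 R"]) (use assms lap_cut_pot_inside in auto)
  also have "\<dots> = kern m \<epsilon> x"
    by (subst pd_add) (auto simp: kern_def intro: smoothD smooth_lap smooth_rad_pot)
  finally show ?thesis .
qed

lemma open_outside: "open {x::real^2. norm x > r}"
  by (intro open_Collect_less continuous_intros)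

text \<open>In terms of \<open>t = x \<bullet> x\<close> the potential is
  \<open>t * (ln t - ln (\<epsilon>^2)) / 8\<close> there, so everything reduces to calculus in
  \<open>t\<close>.\<close>

lemma lap_rad_pot_outside:
  assumes "\<epsilon> > 0" "norm x > \<epsilon>"
  shows "lap (rad_pot \<epsilon>) x = (1/2) * ln (x \<bullet> x) + (1 - ln (\<epsilon>\<^sup>2) / 2)"
proof -
  let ?S = "{x::real^2. norm x > \<epsilon>}"
  let ?c = "ln (\<epsilon>\<^sup>2)"
  have pos: "y \<bullet> y > 0" if "y \<in> ?S" for y
    using that assms by auto
  have f: "rad_pot \<epsilon> y = (\<lambda>t. (1/8) * (t * (ln t - ?c))) (y \<bullet> y)" if "y \<in> ?S" for y
  proof -
    have "1 \<le> (1 / \<epsilon>\<^sup>2) * (y \<bullet> y)" using inner_self_gt[of \<epsilon> y] that assms by (simp add: field_simps)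
    then show ?thesis using pos[OF that] assms(1)
      by (simp add: rad_pot_def reg_ln_eq ln_div)
  qed
  have d: "((\<lambda>t. (1/8) * (t * (ln t - ?c))) has_real_derivative (1/8) * (ln t - ?c + 1)) (at t)" if "t > 0" for t :: real
    using that by (auto intro!: derivative_eq_intros simp: field_simps)
  have d2: "((\<lambda>t. (1/4) * (ln t - ?c + 1)) has_real_derivative (1/4) / t) (at t)" if "t > 0" for t :: real
    using that by (auto intro!: derivative_eq_intros)
  have D1: "pd j (rad_pot \<epsilon>) y = y $ j * (\<lambda>t. (1/4) * (ln t - ?c + 1)) (y \<bullet> y)" if y: "y \<in> ?S" for j y
  proof -
    have "pd j (rad_pot \<epsilon>) y = pd j (\<lambda>y. (\<lambda>t. (1/8) * (t * (ln t - ?c))) (y \<bullet> y)) y"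
      by (rule pd_cong_open[OF open_outside _ y[unfolded mem_Collect_eq, folded mem_Collect_eq[of y "\<lambda>x. norm x > \<epsilon>"]]]) (rule f)
    also have "\<dots> = (1/8) * (ln (y \<bullet> y) - ?c + 1) * pd j (\<lambda>x. x \<bullet> x) y"
      by (rule pd_compose[OF d[OF pos[OF y]] smoothD[OF smooth_inner_self]])
    finally show ?thesis by (simp add: pd_inner_self)
  qed
  have x: "x \<in> ?S" using assms by simp
  have "pd j (pd j (rad_pot \<epsilon>)) x
      = (1/4) * (ln (x \<bullet> x) - ?c + 1) + (x $ j * x $ j) / (2 * (x \<bullet> x))" for j
  proof -
    have dc: "(\<lambda>y. (\<lambda>t. (1/4) * (ln t - ?c + 1)) (y \<bullet> y)) differentiable (at x)"
      by (rule differentiable_compose[where f="\<lambda>t. (1/4) * (ln t - ?c + 1)", OF _ smoothD[OF smooth_inner_self]])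
         (use d2[OF pos[OF x]] in \<open>auto simp: has_field_derivative_def differentiable_def\<close>)
    have "pd j (pd j (rad_pot \<epsilon>)) x
       = pd j (\<lambda>y. y $ j * (\<lambda>t. (1/4) * (ln t - ?c + 1)) (y \<bullet> y)) x"
      by (rule pd_cong_open[OF open_outside _ x]) (rule D1)
    also have "\<dots> = x $ j * pd j (\<lambda>y. (\<lambda>t. (1/4) * (ln t - ?c + 1)) (y \<bullet> y)) x
        + pd j (\<lambda>y. y $ j) x * (\<lambda>t. (1/4) * (ln t - ?c + 1)) (x \<bullet> x)"
      by (rule pd_mult[OF smoothD[OF smooth_nth] dc])
    also have "pd j (\<lambda>y. (\<lambda>t. (1/4) * (ln t - ?c + 1)) (y \<bullet> y)) x = (1/4) / (x \<bullet> x) * pd j (\<lambda>x. x \<bullet> x) x"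
      by (rule pd_compose[OF d2[OF pos[OF x]] smoothD[OF smooth_inner_self]])
    finally show ?thesis by (simp add: pd_inner_self kron_def)
  qed
  then have "lap (rad_pot \<epsilon>) x = (1/2) * (ln (x \<bullet> x) - ?c + 1) + (x $ 1 * x $ 1 + x $ 2 * x $ 2) / (2 * (x \<bullet> x))"
    by (simp add: lap_def sum_2 add_divide_distrib)
  also have "x $ 1 * x $ 1 + x $ 2 * x $ 2 = x \<bullet> x" by (simp add: inner_vec_def sum_2)
  finally show ?thesis using pos[OF x] by (simp add: algebra_simps)
qed

lemma kern_outside:
  assumes "\<epsilon> > 0" "norm x > \<epsilon>"
  shows "kern m \<epsilon> x = x $ m / (x \<bullet> x)"
proof -
  have pos: "x \<bullet> x > 0" using assms by auto
  let ?c = "1 - ln (\<epsilon>\<^sup>2) / 2"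
  have "kern m \<epsilon> x = pd m (\<lambda>y. (\<lambda>t. (1/2) * ln t + ?c) (y \<bullet> y)) x"
    unfolding kern_def
    by (rule pd_cong_open[OF open_outside, of \<epsilon>]) (use lap_rad_pot_outside assms in auto)
  also have "\<dots> = (1/2) / (x \<bullet> x) * pd m (\<lambda>x. x \<bullet> x) x"
    by (rule pd_compose[OF _ smoothD[OF smooth_inner_self]])
       (use pos in \<open>auto intro!: derivative_eq_intros\<close>)
  finally show ?thesis by (simp add: pd_inner_self)
qed

lemma pd_kern_outside:
  assumes "\<epsilon> > 0" "norm x > \<epsilon>"
  shows "pd j (kern m \<epsilon>) x = kron m j / (x \<bullet> x) - 2 * x $ m * x $ j / (x \<bullet> x)\<^sup>2"
proof -
  have pos: "x \<bullet> x > 0" using assms by auto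
  have di: "(inverse has_real_derivative - inverse ((x \<bullet> x)\<^sup>2)) (at (x \<bullet> x))"
    using DERIV_inverse[of "x \<bullet> x"] pos by (simp add: power2_eq_square power_inverse)
  have "pd j (kern m \<epsilon>) x = pd j (\<lambda>y. y $ m * inverse (y \<bullet> y)) x"
    by (rule pd_cong_open[OF open_outside, of \<epsilon>]) (use kern_outside assms in \<open>auto simp: divide_inverse\<close>)
  also have "\<dots> = x $ m * pd j (\<lambda>y. inverse (y \<bullet> y)) x + pd j (\<lambda>y. y $ m) x * inverse (x \<bullet> x)"
    by (rule pd_mult[OF smoothD[OF smooth_nth]])
       (use pos in \<open>auto intro!: differentiable_inverse smoothD[OF smooth_inner_self]\<close>)
  also have "pd j (\<lambda>y. inverse (y \<bullet> y)) x = - inverse ((x \<bullet> x)\<^sup>2) * pd j (\<lambda>x. x \<bullet> x) x"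
    by (rule pd_compose[OF di smoothD[OF smooth_inner_self]])
  finally show ?thesis by (simp add: pd_inner_self divide_inverse)
qed

text \<open>Harmonicity of the logarithm in the plane: the explicit Hessian has trace zero.\<close>

lemma bump_outside:
  assumes "\<epsilon> > 0" "norm x > \<epsilon>"
  shows "bump \<epsilon> x = 0"
proof -
  have pos: "x \<bullet> x > 0" using assms by auto
  have "x \<bullet> x = x $ 1 * x $ 1 + x $ 2 * x $ 2" by (simp add: inner_vec_def sum_2)
  then have "bump \<epsilon> x = 2 / (x \<bullet> x) - 2 * (x \<bullet> x) / (x \<bullet> x)\<^sup>2"
    by (simp add: bump_eq_div_kern pd_kern_outside[OF assms] sum_2 kron_def diff_divide_distrib add_divide_distrib algebra_simps)
  then show ?thesis using pos by (simp add: power2_eq_square)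
qed

lemma pd_bump_outside:
  assumes "\<epsilon> > 0" "norm x > \<epsilon>"
  shows "pd m (bump \<epsilon>) x = 0"
proof -
  have "pd m (bump \<epsilon>) x = pd m (\<lambda>x. 0) x"
    by (rule pd_cong_open[OF open_outside, of \<epsilon>]) (use bump_outside assms in auto)
  then show ?thesis by simp
qed

lemma test_function_bump: "\<epsilon> > 0 \<Longrightarrow> test_function (bump \<epsilon>)"
  using bump_outside by (auto simp: test_function_iff smooth_bump intro!: cpt_suppI[of \<epsilon>])

text \<open>\<open>rad_pot\<close> is homogeneous of degree 2 under joint scaling of
  \<open>x\<close> and \<open>\<epsilon>\<close>, and \<open>kern\<close> takes three
  derivatives.\<close>

lemma kern_scale: "\<epsilon> > 0 \<Longrightarrow> kern m \<epsilon> x = (1 / \<epsilon>) * kern m 1 ((1 / \<epsilon>) *\<^sub>R x)"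
proof -
  assume e: "\<epsilon> > 0"
  have "rad_pot \<epsilon> = (\<lambda>x. \<epsilon>\<^sup>2 * rad_pot 1 ((1 / \<epsilon>) *\<^sub>R x))"
    using e by (auto simp: rad_pot_def fun_eq_iff power2_eq_square field_simps)
  then have "kern m \<epsilon> = (\<lambda>x. (\<epsilon>\<^sup>2 * (1 / \<epsilon>)\<^sup>2 * (1 / \<epsilon>)) * kern m 1 ((1 / \<epsilon>) *\<^sub>R x))"
    by (simp add: kern_def lap_scaled smooth_rad_pot pd_scaled smooth_lap)
  then show ?thesis using e by (simp add: power2_eq_square)
qed

text \<open>After rescaling to radius 1, compactness bounds the kernel in the unit ball and the
  explicit formula bounds it outside.\<close>

lemma kern_bound:
  obtains C where "C > 0" "\<And>\<epsilon> x m. \<epsilon> > 0 \<Longrightarrow> \<bar>kern m \<epsilon> x\<bar> \<le> C / \<epsilon>"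
proof -
  have "\<exists>B>0. \<forall>x. \<bar>kern m 1 x\<bar> \<le> B" for m
  proof -
    obtain B where B: "\<And>x. norm x \<le> 1 \<Longrightarrow> \<bar>kern m 1 x\<bar> \<le> B"
      by (rule continuous_bounded_on_cball[OF smooth_continuous[OF smooth_kern]]) blast
    have "\<bar>kern m 1 x\<bar> \<le> \<bar>B\<bar> + 1" for x
    proof (cases "norm x \<le> 1")
      case True
      then show ?thesis using B[of x] by simp
    next
      case False
      then have n: "norm x > 1" by simp
      have "\<bar>kern m 1 x\<bar> = \<bar>x $ m\<bar> / (norm x)\<^sup>2"
        using kern_outside[OF _ n] by (simp add: dot_square_norm abs_divide)
      also have "\<dots> \<le> norm x / (norm x)\<^sup>2"
        by (intro divide_right_mono component_le_norm_cart) auto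
      also have "\<dots> \<le> 1" using n by (simp add: power2_eq_square divide_simps)
      finally show ?thesis by simp
    qed
    then show ?thesis by (intro exI[of _ "\<bar>B\<bar> + 1"]) auto
  qed
  then obtain B where B: "\<And>m. B m > 0" "\<And>m x. \<bar>kern m 1 x\<bar> \<le> B m" by metis
  show ?thesis
  proof (rule that[of "B 1 + B 2"])
    show "B 1 + B 2 > 0" using B by (simp add: add_pos_pos)
    fix \<epsilon> :: real and x m assume e: "\<epsilon> > 0"
    have "B m \<le> B 1 + B 2" using exhaust_2[of m] B(1)[of 1] B(1)[of 2] by auto
    then have "\<bar>kern m 1 ((1 / \<epsilon>) *\<^sub>R x)\<bar> \<le> B 1 + B 2" using B(2) order_trans by blast
    then show "\<bar>kern m \<epsilon> x\<bar> \<le> (B 1 + B 2) / \<epsilon>"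
      using e kern_scale[OF e, of m x] by (simp add: abs_mult divide_right_mono)
  qed
qed

text \<open>The constant in \<open>cut_pot\<close> replaces \<open>ln (\<epsilon>^2)\<close> by
  \<open>ln (R^2)\<close>, so no trace of \<open>\<epsilon>\<close> remains. The radius 1/2 on the
  right makes the regularised logarithm exact for \<open>norm x > R / 2\<close> on both
  sides.\<close>

lemma cut_pot_scale:
  assumes "0 < \<epsilon>" "\<epsilon> \<le> R / 2" "norm x > R / 2"
  shows "cut_pot \<epsilon> R x = R\<^sup>2 * cut_pot (1/2) 1 ((1 / R) *\<^sub>R x)"
proof -
  have R: "R > 0" using assms by linarith
  have t: "x \<bullet> x > (R / 2)\<^sup>2" using inner_self_gt[OF assms(3)] R by simp
  have e: "\<epsilon>\<^sup>2 \<le> (R / 2)\<^sup>2" using assms by (intro power_mono) auto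
  have t0: "x \<bullet> x > 0" using t by (metis zero_le_power2 le_less_trans)
  have 1: "reg_ln ((1 / \<epsilon>\<^sup>2) * (x \<bullet> x)) = ln (x \<bullet> x) - ln (\<epsilon>\<^sup>2)"
    using t e assms(1) t0 by (subst reg_ln_eq) (auto simp: field_simps ln_div)
  have y: "((1 / R) *\<^sub>R x) \<bullet> ((1 / R) *\<^sub>R x) = (x \<bullet> x) / R\<^sup>2"
    by (simp add: power2_eq_square)
  have 2: "reg_ln (1 / (1 / 2)\<^sup>2 * ((x \<bullet> x) / R\<^sup>2)) = ln (x \<bullet> x) - ln (R\<^sup>2) + ln 4"
    using t R t0 by (subst reg_ln_eq) (auto simp: field_simps ln_div ln_mult power2_eq_square)
  have 3: "ln (\<epsilon>\<^sup>2 / R\<^sup>2) = ln (\<epsilon>\<^sup>2) - ln (R\<^sup>2)" using R assms by (simp add: ln_div)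
  have 4: "ln ((1/2)\<^sup>2 / 1\<^sup>2 :: real) = - ln 4" by (simp add: power2_eq_square ln_div)
  show ?thesis unfolding cut_pot_def y 1 2 3 4 using R by simp
qed

text \<open>A potential that scales with degree 2, differentiated five times, has size
  \<open>R^(2-5)\<close>; the constant is read off from one fixed profile.\<close>

lemma bilap_cut_pot_bound:
  obtains C where "C > 0"
    "\<And>\<epsilon> R x m. 0 < \<epsilon> \<Longrightarrow> \<epsilon> \<le> R / 2 \<Longrightarrow> norm x > R / 2 \<Longrightarrow>
       \<bar>pd m (lap (lap (cut_pot \<epsilon> R))) x\<bar> \<le> C / R ^ 3"
proof -
  let ?P = "\<lambda>m. pd m (lap (lap (cut_pot (1/2) 1)))"
  have "test_function (?P m)" for m
    by (intro test_function_partial_deriv test_function_lap test_function_cut_pot) simp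
  then have "\<exists>C>0. \<forall>x. \<bar>?P m x\<bar> \<le> C" for m
    using cpt_supp_bounded[of "?P m"] unfolding test_function_iff by (metis smooth_continuous)
  then obtain B where B: "\<And>m. B m > 0" "\<And>m x. \<bar>?P m x\<bar> \<le> B m" by metis
  show ?thesis
  proof (rule that[of "B 1 + B 2"])
    show "B 1 + B 2 > 0" using B by (simp add: add_pos_pos)
    fix \<epsilon> R :: real and x :: "real^2" and m
    assume a: "0 < \<epsilon>" "\<epsilon> \<le> R / 2" "norm x > R / 2"
    have R: "R > 0" using a by linarith
    have "pd m (lap (lap (cut_pot \<epsilon> R))) x
        = pd m (lap (lap (\<lambda>x. R\<^sup>2 * cut_pot (1/2) 1 ((1 / R) *\<^sub>R x)))) x"
      by (intro pd_cong_open[OF open_outside, of "R/2"] lap_cong_open[OF open_outside, of "R/2"] cut_pot_scale)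
         (use a in auto)
    also have "\<dots> = (R\<^sup>2 * (1 / R)\<^sup>2 * (1 / R)\<^sup>2 * (1 / R)) * ?P m ((1 / R) *\<^sub>R x)"
      by (simp add: lap_scaled smooth_cut_pot smooth_lap pd_scaled)
    also have "R\<^sup>2 * (1 / R)\<^sup>2 * (1 / R)\<^sup>2 * (1 / R) = 1 / R ^ 3"
      using R by (simp add: field_simps power2_eq_square power3_eq_cube)
    finally have "\<bar>pd m (lap (lap (cut_pot \<epsilon> R))) x\<bar> = \<bar>?P m ((1 / R) *\<^sub>R x)\<bar> / R ^ 3"
      using R by (simp add: abs_mult)
    also have "\<bar>?P m ((1 / R) *\<^sub>R x)\<bar> \<le> B m" by (rule B)
    also have "B m \<le> B 1 + B 2" using exhaust_2[of m] B(1)[of 1] B(1)[of 2] by auto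
    finally show "\<bar>pd m (lap (lap (cut_pot \<epsilon> R))) x\<bar> \<le> (B 1 + B 2) / R ^ 3"
      using R by (simp add: divide_right_mono)
  qed
qed

text \<open>A neutral factor for \<open>bump\<close>, since it is 1 on the ball of radius 2; its
  derivatives live where \<open>kern\<close> no longer depends on
  \<open>\<epsilon> \<le> 1\<close>.\<close>

definition plateau :: "real^2 \<Rightarrow> real" where
  "plateau x = cutoff ((1/4) * (x \<bullet> x))"

text \<open>The flux of the gradient of \<open>ln (norm x)\<close> through a circle, that is
  \<open>2 * pi\<close>; the proof works with its positivity alone.\<close>

definition bump_mass :: real where
  "bump_mass = (LINT x|lebesgue. bump 1 x)"

lemma test_function_plateau: "test_function plateau"
proof -
  have "plateau x = 0" if "norm x > 4" for x
    using inner_self_gt[OF that] unfolding plateau_def by (intro cutoff_eq_0) simp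
  moreover have "smooth plateau"
    unfolding plateau_def[abs_def] by (intro smooth_compose[OF CkR_cutoff] smooth_mult smooth_const smooth_inner_self)
  ultimately show ?thesis unfolding test_function_iff by (auto intro!: cpt_suppI)
qed

lemma plateau_eq_1: "norm x \<le> 2 \<Longrightarrow> plateau x = 1"
  using inner_self_le[of x 2] by (simp add: plateau_def cutoff_eq_1)

lemma pd_plateau_inside: "norm x < 2 \<Longrightarrow> pd j plateau x = 0"
proof -
  assume x: "norm x < 2"
  have "pd j plateau x = pd j (\<lambda>x. 1) x"
    by (rule pd_cong_open[of "ball 0 2"]) (use x plateau_eq_1 in auto)
  then show ?thesis by simp
qed

text \<open>Moving the divergence onto \<open>plateau\<close> confines the integral to
  \<open>norm x \<ge> 2\<close>, where the kernels for all \<open>\<epsilon> \<le> 1\<close>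
  agree.\<close>

lemma integral_bump:
  assumes e: "0 < \<epsilon>" "\<epsilon> \<le> 1"
  shows "(LINT x|lebesgue. bump \<epsilon> x) = - (\<Sum>j\<in>UNIV. LINT x|lebesgue. kern j 1 x * pd j plateau x)"
proof -
  have "bump \<epsilon> x = (\<Sum>j\<in>UNIV. pd j (kern j \<epsilon>) x * plateau x)" for x
  proof (cases "norm x \<le> 2")
    case True then show ?thesis by (simp add: bump_eq_div_kern plateau_eq_1)
  next
    case False
    then have "bump \<epsilon> x = 0" using e by (intro bump_outside) auto
    then show ?thesis by (simp add: bump_eq_div_kern sum_distrib_right[symmetric])
  qed
  then have "(LINT x|lebesgue. bump \<epsilon> x) = (\<Sum>j\<in>UNIV. LINT x|lebesgue. pd j (kern j \<epsilon>) x * plateau x)"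
    using test_function_plateau unfolding test_function_iff
    by (simp, intro Bochner_Integration.integral_sum integrable_continuous_cpt_supp cpt_supp_mult continuous_intros
       smooth_continuous smooth_partial_deriv smooth_kern) auto
  also have "\<dots> = (\<Sum>j\<in>UNIV. - (LINT x|lebesgue. kern j \<epsilon> x * pd j plateau x))"
    by (simp add: integration_by_parts[OF smooth_kern test_function_plateau])
  also have "\<dots> = (\<Sum>j\<in>UNIV. - (LINT x|lebesgue. kern j 1 x * pd j plateau x))"
  proof -
    have "kern j \<epsilon> x * pd j plateau x = kern j 1 x * pd j plateau x" for j x
      by (cases "norm x < 2") (use e in \<open>auto simp: pd_plateau_inside kern_outside\<close>)
    then show ?thesis by (simp only:)
  qed
  finally show ?thesis by (simp add: sum_negf)
qed

lemma integral_bump_eq_mass: "0 < \<epsilon> \<Longrightarrow> \<epsilon> \<le> 1 \<Longrightarrow> (LINT x|lebesgue. bump \<epsilon> x) = bump_mass"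
  using integral_bump[of \<epsilon>] integral_bump[of 1] by (simp add: bump_mass_def)

text \<open>The mass is the integral of minus the radial derivative of the plateau, which is nonnegative
  and not identically zero.\<close>

lemma bump_mass_pos: "bump_mass > 0"
proof -
  obtain c' where c': "\<And>t. (cutoff has_real_derivative c' t) (at t)"
  proof -
    have "CkR (Suc 0) UNIV cutoff" by (rule CkR_cutoff)
    then show ?thesis using that by (elim CkR_SucE) auto
  qed
  have c'0: "c' t \<le> 0" for t
  proof (rule ccontr)
    assume "\<not> c' t \<le> 0"
    then obtain d where d: "d > 0" "\<And>h. 0 < h \<Longrightarrow> h < d \<Longrightarrow> cutoff t < cutoff (t + h)"
      using DERIV_pos_inc_right[OF c'] by (metis not_le)
    show False using d(2)[of "d/2"] d(1) cutoff_antimono[of t "t + d/2"] by auto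
  qed
  have D: "pd j plateau x = c' ((1/4) * (x \<bullet> x)) * (x $ j / 2)" for j x
  proof -
    have "pd j plateau x = c' ((1/4) * (x \<bullet> x)) * pd j (\<lambda>x. (1/4) * (x \<bullet> x)) x"
      unfolding plateau_def[abs_def]
      by (rule pd_compose[OF c' smoothD]) (intro smooth_mult smooth_const smooth_inner_self)
    then show ?thesis
      by (simp only: pd_cmult_smooth[OF smooth_inner_self] pd_inner_self)
  qed
  let ?f = "\<lambda>x. - (\<Sum>j\<in>UNIV. kern j 1 x * pd j plateau x)"
  have alg: "- (a / q * (c * (a / 2)) + b / q * (c * (b / 2))) = - c / 2 * ((a * a + b * b) / q)"
    for a b c q :: real
    by (cases "q = 0") (auto simp: field_simps)
  have f: "?f x = - c' ((1/4) * (x \<bullet> x)) / 2" if "norm x > 1" for x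
  proof -
    have "x \<bullet> x > 0" using that by auto
    moreover have "x \<bullet> x = x $ 1 * x $ 1 + x $ 2 * x $ 2" by (simp add: inner_vec_def sum_2)
    ultimately have "(x $ 1 * x $ 1 + x $ 2 * x $ 2) / (x \<bullet> x) = 1" by (metis divide_self less_irrefl)
    moreover have "?f x = - c' ((1/4) * (x \<bullet> x)) / 2 * ((x $ 1 * x $ 1 + x $ 2 * x $ 2) / (x \<bullet> x))"
      unfolding D sum_2 kern_outside[OF zero_less_one that] by (rule alg)
    ultimately show ?thesis by (simp only: mult_1_right)
  qed
  have f2: "?f x = 0" if "norm x < 2" for x using that by (simp add: pd_plateau_inside)
  have f0: "?f x \<ge> 0" for x
  proof (cases "norm x < 2")
    case False
    then have "norm x > 1" by simp
    from f[OF this] c'0[of "(1/4) * (x \<bullet> x)"] show ?thesis by linarith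
  qed (use f2 in simp)
  have cp: "cpt_supp (\<lambda>x. kern j 1 x * pd j plateau x)" for j
    using test_function_partial_deriv[OF test_function_plateau, of j]
    by (intro cpt_supp_mult) (simp add: test_function_iff)
  have cc: "continuous_on UNIV (\<lambda>x. kern j 1 x * pd j plateau x)" for j
    using test_function_plateau
    by (intro smooth_continuous smooth_mult smooth_kern smooth_partial_deriv) (simp add: test_function_iff)
  have i: "integrable lborel (\<lambda>x. kern j 1 x * pd j plateau x)" for j
    by (rule integrable_continuous_cpt_supp_lborel[OF cc cp])
  have cf: "continuous_on UNIV ?f" by (intro continuous_intros cc)
  have fi: "integrable lborel ?f"
    by (intro Bochner_Integration.integrable_minus Bochner_Integration.integrable_sum i)
  have mass: "bump_mass = (LINT x|lborel. ?f x)"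
    using integral_bump[of 1] by (simp add: bump_mass_def lebesgue_integral_continuous[OF cc] i)
  have "bump_mass \<noteq> 0"
  proof
    assume "bump_mass = 0"
    then have ae: "AE x in lborel. ?f x = 0"
      using integral_nonneg_eq_0_iff_AE[OF fi] f0 mass by auto
    \<comment> \<open>Continuity upgrades almost everywhere to everywhere, as a nonempty open set is
      not negligible.\<close>
    have z: "?f x = 0" for x
    proof (rule ccontr)
      assume n: "?f x \<noteq> 0"
      have "open {x. ?f x \<noteq> 0}" using cf by (intro open_Collect_neq) (auto intro: continuous_intros)
      moreover from this have "{x. ?f x \<noteq> 0} \<in> null_sets lborel"
        using ae by (subst (asm) AE_iff_null) (auto simp: borel_open)
      then have "negligible {x. ?f x \<noteq> 0}"
        unfolding negligible_iff_null_sets by (rule null_sets_completionI)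
      ultimately have "{x. ?f x \<noteq> 0} = {}" using open_not_negligible by blast
      then show False using n by blast
    qed
    \<comment> \<open>The derivative of \<open>cutoff\<close> would vanish beyond 1, although
      \<open>cutoff\<close> drops from 1 at 1 to 0 at 3.\<close>
    have "c' t = 0" if "t > 1" for t
    proof -
      define x :: "real^2" where "x = axis 1 (2 * sqrt t)"
      have xx: "x \<bullet> x = 4 * t" using that by (simp add: x_def inner_vec_def sum_2 axis_def)
      then have n: "norm x > 1" unfolding norm_eq_sqrt_inner using that by simp
      have "- c' ((1/4) * (x \<bullet> x)) / 2 = 0" using f[OF n] z[of x] by linarith
      then show ?thesis unfolding xx by simp
    qed
    then have "(cutoff has_real_derivative 0) (at t)" if "1 < t" for t using c'[of t] that by simp
    moreover have "continuous_on {1..3} cutoff"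
      by (intro continuous_at_imp_continuous_on ballI DERIV_isCont[OF c'])
    ultimately have "cutoff 3 = cutoff 1"
      by (intro DERIV_isconst2[of 1 3 cutoff 3]) auto
    then show False by (simp add: cutoff_eq_0 cutoff_eq_1)
  qed
  moreover have "bump_mass \<ge> 0" unfolding mass by (rule integral_nonneg_AE) (use f0 in auto)
  ultimately show ?thesis by simp
qed

section \<open>The Hessian of the logarithmic potential\<close>

text \<open>A crude bound by the enclosing square; only the order \<open>r^2\<close>
  matters.\<close>

lemma measure_cball_le:
  fixes z :: "real^2"
  assumes "r \<ge> 0"
  shows "measure lebesgue (cball z r) \<le> 4 * r\<^sup>2"
proof -
  have "cball z r \<subseteq> cbox (z - r *\<^sub>R One) (z + r *\<^sub>R One)"
  proof
    fix x assume x: "x \<in> cball z r"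
    have "\<bar>(x - z) \<bullet> i\<bar> \<le> r" if "i \<in> Basis" for i
      using Basis_le_norm[OF that, of "x - z"] x by (simp add: dist_norm norm_minus_commute)
    note le = this
    show "x \<in> cbox (z - r *\<^sub>R One) (z + r *\<^sub>R One)"
      unfolding mem_box
    proof
      fix i :: "real^2" assume i: "i \<in> Basis"
      then show "(z - r *\<^sub>R One) \<bullet> i \<le> x \<bullet> i \<and> x \<bullet> i \<le> (z + r *\<^sub>R One) \<bullet> i"
        using le[OF i] by (auto simp: inner_simps abs_le_iff)
    qed
  qed
  then have "measure lebesgue (cball z r) \<le> measure lebesgue (cbox (z - r *\<^sub>R One) (z + r *\<^sub>R One))"
    by (intro measure_mono_fmeasurable) auto
  also have "\<dots> = (\<Prod>i\<in>(Basis :: (real^2) set). (2 * r))"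
    using assms by (subst measure_completion, simp, subst content_cbox) (auto simp: inner_simps)
  also have "\<dots> = 4 * r\<^sup>2" by (simp add: power2_eq_square power_mult_distrib)
  finally show ?thesis .
qed

lemma bilap_cut_pot_inside:
  assumes "norm x < R"
  shows "pd m (lap (lap (cut_pot \<epsilon> R))) x = pd m (bump \<epsilon>) x"
proof (rule pd_cong_open[of "ball 0 R"])
  fix y :: "real^2" assume y: "y \<in> ball 0 R"
  have "pd j (pd j (lap (cut_pot \<epsilon> R))) y = pd j (kern j \<epsilon>) y" for j
    by (rule pd_cong_open[of "ball 0 R"]) (use y pd_cut_pot_inside in auto)
  then show "lap (lap (cut_pot \<epsilon> R)) y = bump \<epsilon> y"
    unfolding bump_eq_div_kern by (simp add: lap_def[of "lap (cut_pot \<epsilon> R)"])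
qed (use assms in auto)

lemma bilap_cut_pot_far:
  assumes "R > 0" "norm x > 2 * R"
  shows "pd m (lap (lap (cut_pot \<epsilon> R))) x = 0"
proof -
  have z: "lap (\<lambda>x. 0) = (\<lambda>x. 0)" by (simp add: lap_def[abs_def])
  have "pd m (lap (lap (cut_pot \<epsilon> R))) x = pd m (lap (lap (\<lambda>x. 0))) x"
    by (intro pd_cong_open[OF open_outside, of "2*R"] lap_cong_open[OF open_outside, of "2*R"])
       (use assms cut_pot_eq_0 in auto)
  then show ?thesis by (simp add: z)
qed

lemma tendsto_at_top_eq:
  fixes f :: "real \<Rightarrow> real"
  assumes "(f \<longlongrightarrow> l) at_top" "\<forall>\<^sub>F R in at_top. f R = c"
  shows "l = c"
  by (rule tendsto_unique[OF trivial_limit_at_top_linorder assms(1) tendsto_eventually[OF assms(2)]])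

text \<open>Here \<open>w\<close> is the deviation of the displacement from its linear part at infinity, \<open>P\<close> its
  gradient in the inclusion, and \<open>\<tau>\<close> the constant jump of the stress.\<close>

locale elastic_field =
  fixes \<Omega> :: "(real^2) set" and lam mu :: real and \<tau> P :: "real^2^2" and w :: "2 \<Rightarrow> real^2 \<Rightarrow> real"
    and q :: "real^2" and C0 R0 :: real
  assumes open_\<Omega>: "open \<Omega>" and bounded_\<Omega>: "bounded \<Omega>"
    and mu: "mu > 0" and lam: "lam + mu > 0"
    and \<tau>_sym: "\<tau> $ 2 $ 1 = \<tau> $ 1 $ 2"
    and w_integrable: "\<And>k g. continuous_on UNIV g \<Longrightarrow> cpt_supp g \<Longrightarrow> integrable lebesgue (\<lambda>x. w k x * g x)"
    and w_inside: "\<And>k x. x \<in> \<Omega> \<Longrightarrow> w k x = (\<Sum>l\<in>UNIV. P $ k $ l * x $ l) + q $ k"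
    and w_decay: "\<And>k x. norm x \<ge> R0 \<Longrightarrow> \<bar>w k x\<bar> \<le> C0 / norm x" and C0: "C0 > 0" and R0: "R0 > 0"
    and weak_eq: "\<And>\<phi> i. test_function \<phi> \<Longrightarrow>
       2 * mu * (\<Sum>j\<in>UNIV. LINT x|lebesgue. w i x * pd j (pd j \<phi>) x)
     + 2 * (lam + mu) * (\<Sum>k\<in>UNIV. LINT x|lebesgue. w k x * pd k (pd i \<phi>) x)
     = - (\<Sum>j\<in>UNIV. \<tau> $ i $ j * (LINT x|lebesgue. indicator \<Omega> x * pd j \<phi> x))"
begin

definition pair :: "2 \<Rightarrow> (real^2 \<Rightarrow> real) \<Rightarrow> real" where
  "pair k g = (LINT x|lebesgue. w k x * g x)"

definition over :: "(real^2 \<Rightarrow> real) \<Rightarrow> real" where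
  "over g = (LINT x|lebesgue. indicator \<Omega> x * g x)"

lemma pair_sum:
  assumes "\<And>j. test_function (f j)"
  shows "(\<Sum>j\<in>UNIV. pair k (f (j::2))) = pair k (\<lambda>x. \<Sum>j\<in>UNIV. f j x)"
  unfolding pair_def sum_distrib_left
  by (rule Bochner_Integration.integral_sum[symmetric], rule w_integrable)
     (use assms in \<open>auto simp: test_function_iff intro: smooth_continuous\<close>)

lemma integrable_over:
  fixes g :: "real^2 \<Rightarrow> real"
  assumes "continuous_on UNIV g" shows "integrable lebesgue (\<lambda>x. indicator \<Omega> x * g x)"
proof -
  have "\<exists>r. \<forall>x\<in>\<Omega>. norm x \<le> r" using bounded_\<Omega> by (simp add: bounded_iff)
  then obtain r where "\<forall>x\<in>\<Omega>. norm x \<le> r" ..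
  then have r: "\<Omega> \<subseteq> cball 0 r" by auto
  have "integrable lborel (\<lambda>x. indicator (cball 0 r) x *\<^sub>R g x)"
    by (intro borel_integrable_compact continuous_on_subset[OF assms]) auto
  then have "integrable lebesgue (\<lambda>x. indicator (cball 0 r) x *\<^sub>R g x)"
    by (subst integrable_completion) (auto simp: borel_measurable_integrable)
  moreover have "\<Omega> \<in> sets lebesgue" using open_\<Omega> by auto
  ultimately have "integrable lebesgue (\<lambda>x. indicator \<Omega> x *\<^sub>R (indicator (cball 0 r) x *\<^sub>R g x))"
    by (rule integrable_mult_indicator[rotated])
  moreover have "indicator \<Omega> x *\<^sub>R (indicator (cball 0 r) x *\<^sub>R g x) = indicator \<Omega> x * g x" for x
    using r by (auto simp: indicator_def)
  ultimately show ?thesis by (simp only:)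
qed

lemma over_sum:
  assumes "\<And>j. continuous_on UNIV (f j)"
  shows "(\<Sum>j\<in>UNIV. over (f (j::2))) = over (\<lambda>x. \<Sum>j\<in>UNIV. f j x)"
  unfolding over_def sum_distrib_left
  by (rule Bochner_Integration.integral_sum[symmetric], rule integrable_over[OF assms])

text \<open>The nonlocal term: minus the divergence of \<open>w\<close>, tested against second
  derivatives of \<open>lap T\<close>. It involves \<open>w\<close> outside \<open>\<Omega>\<close>,
  so it has to be eliminated.\<close>

definition hess_pair :: "(real^2 \<Rightarrow> real) \<Rightarrow> 2 \<Rightarrow> 2 \<Rightarrow> real" where
  "hess_pair T i m = (\<Sum>k\<in>UNIV. pair k (pd k (pd i (pd m (lap T)))))"

lemma weak_eq': "test_function \<phi> \<Longrightarrow>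
    2 * mu * pair i (lap \<phi>) + 2 * (lam + mu) * (\<Sum>k\<in>UNIV. pair k (pd k (pd i \<phi>)))
     = - (\<Sum>j\<in>UNIV. \<tau> $ i $ j * over (pd j \<phi>))"
  using weak_eq[of \<phi> i] pair_sum[of "\<lambda>j. pd j (pd j \<phi>)" i]
  by (simp add: test_function_partial_deriv lap_def[abs_def] pair_def over_def)

text \<open>The test function \<open>pd m (lap T)\<close> turns the first term into one with the
  bilaplacian of \<open>T\<close>, which is local when \<open>T\<close> is a fundamental solution of
  the bilaplacian.\<close>

lemma weak_eq_gradient:
  assumes T: "test_function T"
  shows "2 * mu * pair i (pd m (lap (lap T))) + 2 * (lam + mu) * hess_pair T i m
    = - (\<Sum>j\<in>UNIV. \<tau> $ i $ j * over (pd j (pd m (lap T))))"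
proof -
  have "smooth (lap T)" using T by (auto simp: test_function_iff smooth_lap)
  from pd_lap[OF this]
  show ?thesis
    using weak_eq'[of "pd m (lap T)" i] T
    by (simp add: test_function_partial_deriv test_function_lap hess_pair_def)
qed

lemma hess_pair_sym: "test_function T \<Longrightarrow> hess_pair T i m = hess_pair T m i"
  unfolding hess_pair_def
  by (subst pd_commute) (auto simp: test_function_iff smooth_lap)

text \<open>The trace brings in a second Laplacian of \<open>T\<close>, so this part of the nonlocal
  matrix becomes local in the limit.\<close>

lemma hess_pair_trace:
  assumes T: "test_function T"
  shows "hess_pair T 1 1 + hess_pair T 2 2 = (\<Sum>k\<in>UNIV. pair k (pd k (lap (lap T))))"
proof -
  have t: "test_function (lap T)" using T by (rule test_function_lap)
  then have s: "smooth (lap T)" by (simp add: test_function_iff)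
  have "(\<Sum>i\<in>UNIV. pair k (pd k (pd i (pd i (lap T))))) = pair k (pd k (lap (lap T)))" for k
  proof -
    have "pd k (lap (lap T)) = (\<lambda>x. \<Sum>i\<in>UNIV. pd k (pd i (pd i (lap T))) x)"
      unfolding lap_def[of "lap T", abs_def] by (intro pd_sum smooth_partial_deriv s)
    then show ?thesis
      by (subst pair_sum) (auto intro!: test_function_partial_deriv t)
  qed
  from this[of 1] this[of 2] show ?thesis by (simp add: hess_pair_def sum_2)
qed

text \<open>For an isotropic jump the derivatives of the Kelvin solution serve as test fields.\<close>

lemma weak_eq_kelvin:
  assumes T: "test_function T" and iso: "\<tau> $ 1 $ 2 = 0" "\<tau> $ 1 $ 1 = t" "\<tau> $ 2 $ 2 = t"
  shows "(2 * lam + 4 * mu) * hess_pair T k m = - t * over (pd k (pd m (lap T)))"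
proof -
  have s: "smooth T" using T by (simp add: test_function_iff)
  let ?F = "pd k (pd m T)"
  \<comment> \<open>The test field is the gradient of \<open>?F\<close>. For gradients both terms on
    the left reduce to \<open>hess_pair\<close>, with total weight
    \<open>2 * mu + 2 * (lam + mu)\<close>.\<close>
  let ?\<phi> = "\<lambda>i. pd i ?F"
  have F: "test_function ?F" "smooth ?F"
    by (intro test_function_partial_deriv T, intro smooth_partial_deriv s)
  have lapF: "lap ?F = pd k (pd m (lap T))"
    by (simp add: pd_lap s smooth_partial_deriv)
  have \<phi>: "test_function (?\<phi> i)" for i by (rule test_function_partial_deriv) (rule F)
  have A: "pair i (lap (?\<phi> i)) = pair i (pd i (pd k (pd m (lap T))))" for i
    by (simp add: pd_lap[OF F(2), symmetric] lapF)
  have B: "(\<Sum>i\<in>UNIV. pair n (pd n (pd i (?\<phi> i)))) = pair n (pd n (pd k (pd m (lap T))))" for n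
  proof -
    have "pd n (lap ?F) = (\<lambda>x. \<Sum>i\<in>UNIV. pd n (pd i (?\<phi> i)) x)"
      unfolding lap_def[of ?F, abs_def] by (intro pd_sum smooth_partial_deriv F)
    then show ?thesis
      by (subst pair_sum) (auto intro!: test_function_partial_deriv \<phi> simp: lapF)
  qed
  have D: "(\<Sum>i\<in>UNIV. over (pd i (?\<phi> i))) = over (pd k (pd m (lap T)))"
    unfolding lapF[symmetric] lap_def[of ?F, abs_def]
    by (rule over_sum) (intro smooth_continuous smooth_partial_deriv s)
  have B': "pair 1 (pd 1 (pd 1 (?\<phi> 1))) + pair 1 (pd 1 (pd 2 (?\<phi> 2)))
      + (pair 2 (pd 2 (pd 1 (?\<phi> 1))) + pair 2 (pd 2 (pd 2 (?\<phi> 2)))) = hess_pair T k m"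
    using B[of 1] B[of 2] by (simp add: hess_pair_def sum_2)
  have A': "pair 1 (lap (?\<phi> 1)) + pair 2 (lap (?\<phi> 2)) = hess_pair T k m"
    unfolding A by (simp add: hess_pair_def sum_2)
  have 1: "2 * mu * pair 1 (lap (?\<phi> 1)) + 2 * (lam + mu) * (pair 1 (pd 1 (pd 1 (?\<phi> 1))) + pair 2 (pd 2 (pd 1 (?\<phi> 1))))
     = - (t * over (pd 1 (?\<phi> 1)))"
    using weak_eq'[OF \<phi>, of 1 1] iso by (simp add: sum_2)
  have 2: "2 * mu * pair 2 (lap (?\<phi> 2)) + 2 * (lam + mu) * (pair 1 (pd 1 (pd 2 (?\<phi> 2))) + pair 2 (pd 2 (pd 2 (?\<phi> 2))))
     = - (t * over (pd 2 (?\<phi> 2)))"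
    using weak_eq'[OF \<phi>, of 2 2] iso \<tau>_sym by (simp add: sum_2)
  have "2 * mu * (pair 1 (lap (?\<phi> 1)) + pair 2 (lap (?\<phi> 2))) + 2 * (lam + mu) *
      (pair 1 (pd 1 (pd 1 (?\<phi> 1))) + pair 1 (pd 1 (pd 2 (?\<phi> 2)))
      + (pair 2 (pd 2 (pd 1 (?\<phi> 1))) + pair 2 (pd 2 (pd 2 (?\<phi> 2)))))
      = - t * (over (pd 1 (?\<phi> 1)) + over (pd 2 (?\<phi> 2)))"
    using arg_cong2[OF 1 2, of "(+)"] by (simp only: algebra_simps)
  then show ?thesis unfolding A' B' D[unfolded sum_2] by (simp add: algebra_simps)
qed

text \<open>The ball of mollification must lie where \<open>w\<close> is affine; the bound 1 makes
  the mass of \<open>bump\<close> independent of \<open>\<epsilon>\<close>.\<close>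

definition good :: "real^2 \<Rightarrow> real \<Rightarrow> bool" where
  "good z \<epsilon> \<longleftrightarrow> 0 < \<epsilon> \<and> \<epsilon> \<le> 1 \<and> cball z \<epsilon> \<subseteq> \<Omega>"

text \<open>The mollified Hessian at \<open>z\<close> of the logarithmic potential of
  \<open>\<Omega>\<close>.\<close>

definition hess_over :: "real^2 \<Rightarrow> real \<Rightarrow> 2 \<Rightarrow> 2 \<Rightarrow> real" where
  "hess_over z \<epsilon> j m = over (\<lambda>x. pd j (kern m \<epsilon>) (x - z))"

lemma hess_over_sym: "hess_over z \<epsilon> j m = hess_over z \<epsilon> m j"
  unfolding hess_over_def by (subst pd_kern_commute) simp

lemma integral_bump_shift: "0 < \<epsilon> \<Longrightarrow> \<epsilon> \<le> 1 \<Longrightarrow> (LINT x|lebesgue. bump \<epsilon> (x - z)) = bump_mass"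
proof -
  assume e: "0 < \<epsilon>" "\<epsilon> \<le> 1"
  have "(LINT x|lebesgue. bump \<epsilon> (x - z)) = (LINT x|lborel. bump \<epsilon> (x - z))"
    by (intro lebesgue_integral_continuous smooth_continuous smooth_shift smooth_bump)
  also have "\<dots> = (LINT x|lborel. bump \<epsilon> x)"
    using integral_translation[OF smooth_continuous[OF smooth_bump], of \<epsilon> "- z"] by simp
  also have "\<dots> = (LINT x|lebesgue. bump \<epsilon> x)"
    by (intro lebesgue_integral_continuous[symmetric] smooth_continuous smooth_bump)
  finally show ?thesis by (simp add: integral_bump_eq_mass[OF e])
qed

text \<open>The trace of the kernel matrix is \<open>bump\<close>, whose support around
  \<open>z\<close> lies in \<open>\<Omega>\<close>, so its whole mass is seen.\<close>

lemma hess_over_trace: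
  assumes "good z \<epsilon>" shows "hess_over z \<epsilon> 1 1 + hess_over z \<epsilon> 2 2 = bump_mass"
proof -
  have e: "0 < \<epsilon>" "\<epsilon> \<le> 1" "cball z \<epsilon> \<subseteq> \<Omega>" using assms by (auto simp: good_def)
  have "hess_over z \<epsilon> 1 1 + hess_over z \<epsilon> 2 2 = over (\<lambda>x. bump \<epsilon> (x - z))"
    using over_sum[of "\<lambda>j x. pd j (kern j \<epsilon>) (x - z)"]
    by (simp add: bump_eq_div_kern hess_over_def sum_2 smooth_continuous smooth_shift smooth_partial_deriv smooth_kern)
  also have "\<dots> = (LINT x|lebesgue. bump \<epsilon> (x - z))"
    unfolding over_def
  proof (rule Bochner_Integration.integral_cong[OF refl])
    fix x
    show "indicator \<Omega> x * bump \<epsilon> (x - z) = bump \<epsilon> (x - z)"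
    proof (cases "x \<in> \<Omega>")
      case False
      then have "norm (x - z) > \<epsilon>" using e(3) by (metis mem_cball dist_norm norm_minus_commute not_le subsetD)
      then show ?thesis by (simp add: bump_outside e)
    qed simp
  qed
  finally show ?thesis using integral_bump_shift[OF e(1,2)] by simp
qed

text \<open>On the support of the shifted bump \<open>w\<close> is affine with gradient
  \<open>P\<close>; integration by parts leaves this constant times the mass.\<close>

lemma pair_bump:
  assumes "good z \<epsilon>"
  shows "pair i (\<lambda>x. pd m (bump \<epsilon>) (x - z)) = - P $ i $ m * bump_mass"
proof -
  have e: "0 < \<epsilon>" "\<epsilon> \<le> 1" "cball z \<epsilon> \<subseteq> \<Omega>" using assms by (auto simp: good_def)
  let ?g = "\<lambda>x. (\<Sum>l\<in>UNIV. P $ i $ l * x $ l) + q $ i"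
  let ?b = "\<lambda>x. bump \<epsilon> (x - z)"
  have "w i x * pd m (bump \<epsilon>) (x - z) = ?g x * pd m (bump \<epsilon>) (x - z)" for x
  proof (cases "x \<in> \<Omega>")
    case False
    then have "norm (x - z) > \<epsilon>" using e(3) by (metis mem_cball dist_norm norm_minus_commute not_le subsetD)
    then show ?thesis by (simp add: pd_bump_outside e)
  qed (simp add: w_inside)
  then have "pair i (\<lambda>x. pd m (bump \<epsilon>) (x - z)) = (LINT x|lebesgue. ?g x * pd m ?b x)"
    unfolding pair_def by (simp only: pd_shift[OF smooth_bump])
  also have "\<dots> = - (LINT x|lebesgue. pd m ?g x * ?b x)"
    by (rule integration_by_parts[OF pd_affine_form(1) test_function_shift[OF test_function_bump[OF e(1)]]])
  also have "\<dots> = - (LINT x|lebesgue. P $ i $ m * ?b x)"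
    by (simp only: pd_affine_form(2))
  finally show ?thesis by (simp add: integral_bump_shift[OF e(1,2)])
qed

text \<open>Within distance \<open>R\<close> of \<open>z\<close> the truncated bilaplacian is the
  mollified delta. The remainder lives between distances \<open>R\<close> and \<open>2 * R\<close>,
  where its derivative is \<open>O(R^-3)\<close> and \<open>w\<close> is
  \<open>O(R^-1)\<close>.\<close>

lemma pair_bilap_tendsto:
  assumes g: "good z \<epsilon>"
  shows "((\<lambda>R. pair i (pd m (lap (lap (\<lambda>x. cut_pot \<epsilon> R (x - z)))))) \<longlongrightarrow> - P $ i $ m * bump_mass) at_top"
proof -
  have e: "0 < \<epsilon>" "\<epsilon> \<le> 1" "cball z \<epsilon> \<subseteq> \<Omega>" using g by (auto simp: good_def)
  obtain C1 where C1: "C1 > 0" "\<And>\<epsilon> R x m. 0 < \<epsilon> \<Longrightarrow> \<epsilon> \<le> R / 2 \<Longrightarrow> norm x > R / 2 \<Longrightarrow>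
       \<bar>pd m (lap (lap (cut_pot \<epsilon> R))) x\<bar> \<le> C1 / R ^ 3"
    by (rule bilap_cut_pot_bound) blast
  \<comment> \<open>The lower bound on \<open>R\<close> gives \<open>norm x \<ge> R / 2\<close> and
    \<open>norm x \<ge> R0\<close> on the annulus. The constant 32 is a factor 2 from the decay of
    \<open>w\<close> times a factor 16 from the area bound.\<close>
  have bound: "\<bar>pair i (pd m (lap (lap (\<lambda>x. cut_pot \<epsilon> R (x - z))))) - (- P $ i $ m * bump_mass)\<bar>
      \<le> (32 * C0 * C1) / R" if R: "R \<ge> 2 * norm z + 2 * R0 + 2" for R
  proof -
    have R2: "R \<ge> 2" "R > 0" "\<epsilon> \<le> R / 2" using R R0 e norm_ge_zero[of z] by linarith+
    let ?\<Phi> = "pd m (lap (lap (cut_pot \<epsilon> R)))"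
    let ?\<beta> = "pd m (bump \<epsilon>)"
    let ?\<Xi> = "\<lambda>x. ?\<Phi> (x - z) - ?\<beta> (x - z)"
    have t\<Phi>: "test_function ?\<Phi>"
      by (intro test_function_partial_deriv test_function_lap test_function_cut_pot R2)
    have t\<beta>: "test_function ?\<beta>"
      by (intro test_function_partial_deriv test_function_bump e)
    have sh: "pd m (lap (lap (\<lambda>x. cut_pot \<epsilon> R (x - z)))) = (\<lambda>x. ?\<Phi> (x - z))"
      by (simp add: lap_shift pd_shift smooth_cut_pot smooth_lap)
    have i1: "integrable lebesgue (\<lambda>x. w i x * ?\<Phi> (x - z))"
      using test_function_shift[OF t\<Phi>, of z] by (intro w_integrable) (auto simp: test_function_iff smooth_continuous)
    have i2: "integrable lebesgue (\<lambda>x. w i x * ?\<beta> (x - z))"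
      using test_function_shift[OF t\<beta>, of z] by (intro w_integrable) (auto simp: test_function_iff smooth_continuous)
    let ?K = "2 * C0 / R * (C1 / R ^ 3)"
    have K: "?K \<ge> 0" using C0 C1 R2 by simp
    have pt: "\<bar>w i x * ?\<Phi> (x - z) - w i x * ?\<beta> (x - z)\<bar> \<le> ?K * indicator (cball z (2 * R)) x" for x
    proof -
      consider "norm (x - z) < R" | "R \<le> norm (x - z)" "norm (x - z) \<le> 2 * R" | "norm (x - z) > 2 * R" by linarith
      then show ?thesis
      proof cases
        case 1
        have "0 \<le> ?K * indicator (cball z (2 * R)) x" by (intro mult_nonneg_nonneg K) simp
        then show ?thesis unfolding bilap_cut_pot_inside[OF 1] by (simp only: diff_self abs_zero)
      next
        case 2
        have "norm x \<ge> norm (x - z) - norm z" using norm_triangle_ineq4[of x z] by linarith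
        then have nx: "norm x \<ge> R / 2" "norm x \<ge> R0" using 2 R norm_ge_zero[of z] R0 by linarith+
        have "\<bar>w i x\<bar> \<le> C0 / norm x" by (rule w_decay[OF nx(2)])
        also have "\<dots> \<le> C0 / (R / 2)" using nx(1) R2 C0 by (intro divide_left_mono mult_pos_pos) auto
        finally have w: "\<bar>w i x\<bar> \<le> 2 * C0 / R" by (simp add: mult.commute)
        have "?\<beta> (x - z) = 0" using 2 R2 e by (intro pd_bump_outside) auto
        moreover have "\<bar>?\<Phi> (x - z)\<bar> \<le> C1 / R ^ 3" using 2 R2 e by (intro C1) auto
        then have "\<bar>w i x\<bar> * \<bar>?\<Phi> (x - z)\<bar> \<le> ?K"
          using C0 R2 by (intro mult_mono w) auto
        ultimately have "\<bar>w i x * ?\<Phi> (x - z) - w i x * ?\<beta> (x - z)\<bar> \<le> ?K"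
          by (simp only: mult_zero_right diff_zero abs_mult)
        then show ?thesis using 2 by (simp add: dist_norm norm_minus_commute)
      next
        case 3
        have "?\<beta> (x - z) = 0" using 3 R2 e by (intro pd_bump_outside) auto
        moreover have "?\<Phi> (x - z) = 0" using 3 R2 by (intro bilap_cut_pot_far) auto
        moreover have "0 \<le> ?K * indicator (cball z (2 * R)) x" by (intro mult_nonneg_nonneg K) simp
        ultimately show ?thesis by (simp only: mult_zero_right diff_self abs_zero)
      qed
    qed
    have eq: "pair i (pd m (lap (lap (\<lambda>x. cut_pot \<epsilon> R (x - z))))) - (- P $ i $ m * bump_mass)
        = (LINT x|lebesgue. w i x * ?\<Phi> (x - z) - w i x * ?\<beta> (x - z))"
      unfolding sh pair_bump[OF g, symmetric] unfolding pair_def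
      by (rule Bochner_Integration.integral_diff[OF i1 i2, symmetric])
    have "\<bar>LINT x|lebesgue. w i x * ?\<Phi> (x - z) - w i x * ?\<beta> (x - z)\<bar> \<le> (LINT x|lebesgue. \<bar>w i x * ?\<Phi> (x - z) - w i x * ?\<beta> (x - z)\<bar>)"
      by (rule integral_abs_bound)
    also have "\<dots> \<le> (LINT x|lebesgue. ?K * indicator (cball z (2 * R)) x)"
    proof (rule integral_mono)
      show "integrable lebesgue (\<lambda>x. \<bar>w i x * ?\<Phi> (x - z) - w i x * ?\<beta> (x - z)\<bar>)"
        by (intro integrable_abs Bochner_Integration.integrable_diff i1 i2)
      show "integrable lebesgue (\<lambda>x. ?K * indicator (cball z (2 * R)) x)"
        by (intro integrable_mult_right integrable_real_indicator)
           (use emeasure_bounded_finite[OF bounded_cball[of z "2*R"]] in auto)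
    qed (rule pt)
    also have "\<dots> = ?K * measure lebesgue (cball z (2 * R))" by simp
    also have "\<dots> \<le> ?K * (4 * (2 * R)\<^sup>2)"
      using R2 by (intro mult_left_mono[OF measure_cball_le K]) simp
    also have "\<dots> = 32 * C0 * C1 / R\<^sup>2" using R2 by (simp add: field_simps power2_eq_square power3_eq_cube)
    also have "\<dots> \<le> 32 * C0 * C1 / R"
      using R2 C0 C1 by (intro divide_left_mono) (auto simp: power2_eq_square)
    finally show ?thesis unfolding eq .
  qed
  show ?thesis
  proof (rule Lim_null[THEN iffD2], rule Lim_null_comparison)
    show "\<forall>\<^sub>F R in at_top. norm (pair i (pd m (lap (lap (\<lambda>x. cut_pot \<epsilon> R (x - z))))) - - P $ i $ m * bump_mass)
       \<le> (32 * C0 * C1) / R"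
      using eventually_ge_at_top[of "2 * norm z + 2 * R0 + 2"] by eventually_elim (use bound in auto)
    show "((\<lambda>R. (32 * C0 * C1) / R) \<longlongrightarrow> 0) at_top"
      by (intro real_tendsto_divide_at_top[OF tendsto_const] filterlim_ident)
  qed
qed

text \<open>\<open>\<Omega>\<close> is bounded, so for large \<open>R\<close> the truncation is not
  seen on it.\<close>

lemma over_cut_pot_eventually:
  "\<forall>\<^sub>F R in at_top. R > 0 \<and> (\<forall>j m. over (pd j (pd m (lap (\<lambda>x. cut_pot \<epsilon> R (x - z))))) = hess_over z \<epsilon> j m)"
proof -
  obtain r where r: "\<And>x. x \<in> \<Omega> \<Longrightarrow> norm x \<le> r" using bounded_\<Omega> by (auto simp: bounded_iff)
  show ?thesis
    using eventually_gt_at_top[of "r + norm z"] eventually_gt_at_top[of 0]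
  proof eventually_elim
    case (elim R)
    have sh: "pd j (pd m (lap (\<lambda>x. cut_pot \<epsilon> R (x - z)))) = (\<lambda>x. pd j (pd m (lap (cut_pot \<epsilon> R))) (x - z))" for j m
      by (simp add: lap_shift pd_shift smooth_cut_pot smooth_lap smooth_partial_deriv)
    have "indicator \<Omega> x * pd j (pd m (lap (cut_pot \<epsilon> R))) (x - z)
        = indicator \<Omega> x * pd j (kern m \<epsilon>) (x - z)" for x j m
    proof (cases "x \<in> \<Omega>")
      case True
      then have "norm (x - z) < R" using r[of x] norm_triangle_ineq4[of x z] elim by linarith
      then have "pd j (pd m (lap (cut_pot \<epsilon> R))) (x - z) = pd j (kern m \<epsilon>) (x - z)"
        by (intro pd_cong_open[of "ball 0 R"]) (use pd_cut_pot_inside in auto)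
      then show ?thesis by simp
    qed simp
    then show ?case using elim(2) unfolding sh over_def hess_over_def by (simp only: simp_thms)
  qed
qed

text \<open>The shear combinations of the limiting equations do not involve the nonlocal quantities.\<close>

lemma hess_over_shear:
  assumes g: "good z \<epsilon>"
  shows "2 * mu * bump_mass * (P $ 1 $ 2 - P $ 2 $ 1) =
      (\<tau> $ 1 $ 1 - \<tau> $ 2 $ 2) * hess_over z \<epsilon> 1 2 - \<tau> $ 1 $ 2 * (hess_over z \<epsilon> 1 1 - hess_over z \<epsilon> 2 2)"
    and "(2 * lam + 4 * mu) * bump_mass * (P $ 1 $ 1 + P $ 2 $ 2) =
      \<tau> $ 1 $ 1 * hess_over z \<epsilon> 1 1 + 2 * \<tau> $ 1 $ 2 * hess_over z \<epsilon> 1 2 + \<tau> $ 2 $ 2 * hess_over z \<epsilon> 2 2"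
proof -
  let ?T = "\<lambda>R x. cut_pot \<epsilon> R (x - z)"
  let ?\<omega> = "\<lambda>i m R. pair i (pd m (lap (lap (?T R))))"
  let ?H = "hess_over z \<epsilon>"
  have lim: "((\<lambda>R. ?\<omega> i m R) \<longlongrightarrow> - P $ i $ m * bump_mass) at_top" for i m
    by (rule pair_bilap_tendsto[OF g])
  have eqs: "\<forall>\<^sub>F R in at_top.
     2 * mu * (?\<omega> 1 2 R - ?\<omega> 2 1 R) = - ((\<tau> $ 1 $ 1 - \<tau> $ 2 $ 2) * ?H 1 2 - \<tau> $ 1 $ 2 * (?H 1 1 - ?H 2 2)) \<and>
     (2 * lam + 4 * mu) * (?\<omega> 1 1 R + ?\<omega> 2 2 R) = - (\<tau> $ 1 $ 1 * ?H 1 1 + 2 * \<tau> $ 1 $ 2 * ?H 1 2 + \<tau> $ 2 $ 2 * ?H 2 2)"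
    using over_cut_pot_eventually[where \<epsilon> = \<epsilon> and z = z]
  proof eventually_elim
    case (elim R)
    have T: "test_function (?T R)" using elim by (intro test_function_shift test_function_cut_pot) simp
    \<comment> \<open>The nonlocal term is symmetric in \<open>i\<close> and \<open>m\<close>: the
      difference of the two off-diagonal equations cancels it, and the sum of the diagonal ones
      leaves its trace.\<close>
    have E: "2 * mu * ?\<omega> i m R + 2 * (lam + mu) * hess_pair (?T R) i m = - (\<tau> $ i $ 1 * ?H 1 m + \<tau> $ i $ 2 * ?H 2 m)" for i m
      using weak_eq_gradient[OF T, of i m] elim by (simp add: sum_2)
    have tr: "hess_pair (?T R) 1 1 + hess_pair (?T R) 2 2 = ?\<omega> 1 1 R + ?\<omega> 2 2 R"
      using hess_pair_trace[OF T] by (simp add: sum_2)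
    have h21: "?H 2 1 = ?H 1 2" by (rule hess_over_sym)
    have "2 * mu * (?\<omega> 1 2 R - ?\<omega> 2 1 R) = - (\<tau> $ 1 $ 1 * ?H 1 2 + \<tau> $ 1 $ 2 * ?H 2 2) + (\<tau> $ 1 $ 2 * ?H 1 1 + \<tau> $ 2 $ 2 * ?H 1 2)"
      using E[of 1 2] E[of 2 1] hess_pair_sym[OF T, of 1 2] unfolding \<tau>_sym h21 by (simp add: algebra_simps)
    moreover have "2 * mu * (?\<omega> 1 1 R + ?\<omega> 2 2 R) + 2 * (lam + mu) * (hess_pair (?T R) 1 1 + hess_pair (?T R) 2 2)
       = - (\<tau> $ 1 $ 1 * ?H 1 1 + \<tau> $ 1 $ 2 * ?H 1 2) - (\<tau> $ 1 $ 2 * ?H 1 2 + \<tau> $ 2 $ 2 * ?H 2 2)"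
      using E[of 1 1] E[of 2 2] unfolding \<tau>_sym h21 by (simp add: algebra_simps)
    ultimately show ?case unfolding tr by (simp add: algebra_simps)
  qed
  have "2 * mu * (- P $ 1 $ 2 * bump_mass - - P $ 2 $ 1 * bump_mass) = - ((\<tau> $ 1 $ 1 - \<tau> $ 2 $ 2) * ?H 1 2 - \<tau> $ 1 $ 2 * (?H 1 1 - ?H 2 2))"
    by (rule tendsto_at_top_eq[OF _ eqs[unfolded eventually_conj_iff, THEN conjunct1]]) (intro tendsto_intros lim)
  then show "2 * mu * bump_mass * (P $ 1 $ 2 - P $ 2 $ 1) = (\<tau> $ 1 $ 1 - \<tau> $ 2 $ 2) * ?H 1 2 - \<tau> $ 1 $ 2 * (?H 1 1 - ?H 2 2)"
    by (simp add: algebra_simps)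
  have "(2 * lam + 4 * mu) * (- P $ 1 $ 1 * bump_mass + - P $ 2 $ 2 * bump_mass) = - (\<tau> $ 1 $ 1 * ?H 1 1 + 2 * \<tau> $ 1 $ 2 * ?H 1 2 + \<tau> $ 2 $ 2 * ?H 2 2)"
    by (rule tendsto_at_top_eq[OF _ eqs[unfolded eventually_conj_iff, THEN conjunct2]]) (intro tendsto_intros lim)
  then show "(2 * lam + 4 * mu) * bump_mass * (P $ 1 $ 1 + P $ 2 $ 2) = \<tau> $ 1 $ 1 * ?H 1 1 + 2 * \<tau> $ 1 $ 2 * ?H 1 2 + \<tau> $ 2 $ 2 * ?H 2 2"
    by (simp add: algebra_simps)
qed

text \<open>Gradient test fields express \<open>hess_pair\<close> through \<open>hess_over\<close>;
  inserting this into the general equation yields every entry of \<open>P\<close>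
  separately.\<close>

lemma hess_over_isotropic:
  assumes g: "good z \<epsilon>" and iso: "\<tau> $ 1 $ 2 = 0" "\<tau> $ 1 $ 1 = t" "\<tau> $ 2 $ 2 = t"
  shows "(2 * lam + 4 * mu) * bump_mass * P $ i $ m = t * hess_over z \<epsilon> i m"
proof -
  let ?T = "\<lambda>R x. cut_pot \<epsilon> R (x - z)"
  let ?\<omega> = "\<lambda>i m R. pair i (pd m (lap (lap (?T R))))"
  let ?H = "hess_over z \<epsilon>"
  have lim: "((\<lambda>R. ?\<omega> i m R) \<longlongrightarrow> - P $ i $ m * bump_mass) at_top"
    by (rule pair_bilap_tendsto[OF g])
  have eqs: "\<forall>\<^sub>F R in at_top. (2 * lam + 4 * mu) * ?\<omega> i m R = - t * ?H i m"
    using over_cut_pot_eventually[where \<epsilon> = \<epsilon> and z = z]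
  proof eventually_elim
    case (elim R)
    have T: "test_function (?T R)" using elim by (intro test_function_shift test_function_cut_pot) simp
    have "(\<Sum>j\<in>UNIV. \<tau> $ i $ j * ?H j m) = t * ?H i m"
      using exhaust_2[of i] iso \<tau>_sym by (auto simp: sum_2)
    then have E: "2 * mu * ?\<omega> i m R + 2 * (lam + mu) * hess_pair (?T R) i m = - (t * ?H i m)"
      using weak_eq_gradient[OF T, of i m] elim by simp
    have K: "(2 * lam + 4 * mu) * hess_pair (?T R) i m = - t * ?H i m"
      using weak_eq_kelvin[OF T iso, of i m] elim by simp
    have "2 * mu * ?\<omega> i m R = 2 * mu * hess_pair (?T R) i m"
    proof -
      have "(2 * lam + 4 * mu) * hess_pair (?T R) i m = 2 * (lam + mu) * hess_pair (?T R) i m + 2 * mu * hess_pair (?T R) i m"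
        by (simp add: algebra_simps)
      then show ?thesis using E K by linarith
    qed
    then have "?\<omega> i m R = hess_pair (?T R) i m" using mu by simp
    then show ?case using K by simp
  qed
  have "(2 * lam + 4 * mu) * (- P $ i $ m * bump_mass) = - t * ?H i m"
    by (rule tendsto_at_top_eq[OF _ eqs]) (intro tendsto_intros lim)
  then show ?thesis by (simp add: algebra_simps)
qed

text \<open>The difference of two such Hessians is symmetric and trace-free. The shear equations
  make it solve a homogeneous system whose matrix is a scaled orthogonal matrix, invertible unless
  \<open>\<tau>\<close> is isotropic.\<close>

lemma hess_over_const:
  assumes nz: "\<tau> \<noteq> 0 \<or> P \<noteq> 0" and g: "good z \<epsilon>" "good z' \<epsilon>'"
  shows "hess_over z \<epsilon> j m = hess_over z' \<epsilon>' j m"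
proof (cases "\<tau> $ 1 $ 2 = 0 \<and> \<tau> $ 1 $ 1 = \<tau> $ 2 $ 2")
  case True
  define t where "t = \<tau> $ 2 $ 2"
  have iso: "\<tau> $ 1 $ 2 = 0" "\<tau> $ 1 $ 1 = t" "\<tau> $ 2 $ 2 = t" using True by (auto simp: t_def)
  note iso1 = hess_over_isotropic[OF g(1) iso] and iso2 = hess_over_isotropic[OF g(2) iso]
  \<comment> \<open>With \<open>t = 0\<close> the jump and, by \<open>iso1\<close>, also
    \<open>P\<close> would vanish.\<close>
  have "t \<noteq> 0"
  proof
    assume "t = 0"
    then have "P $ i $ m = 0" for i m
      using iso1[of i m] bump_mass_pos mu lam by simp
    moreover have "\<tau> = 0" using iso \<open>t = 0\<close> \<tau>_sym by (simp add: vec_eq_iff forall_2)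
    ultimately show False using nz by (auto simp: vec_eq_iff)
  qed
  then show ?thesis using iso1[of j m] iso2[of j m] by simp
next
  case False
  define a where "a = hess_over z \<epsilon> 1 1 - hess_over z' \<epsilon>' 1 1"
  define b where "b = hess_over z \<epsilon> 1 2 - hess_over z' \<epsilon>' 1 2"
  define d where "d = \<tau> $ 1 $ 1 - \<tau> $ 2 $ 2"
  define s where "s = 2 * \<tau> $ 1 $ 2"
  have a2: "hess_over z \<epsilon> 2 2 - hess_over z' \<epsilon>' 2 2 = - a"
    using hess_over_trace[OF g(1)] hess_over_trace[OF g(2)] by (simp add: a_def)
  have 1: "d * b - s * a = 0"
  proof -
    have "d * b - \<tau> $ 1 $ 2 * (a - (hess_over z \<epsilon> 2 2 - hess_over z' \<epsilon>' 2 2)) = 0"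
      using hess_over_shear(1)[OF g(1)] hess_over_shear(1)[OF g(2)] unfolding a_def b_def d_def
      by (simp add: algebra_simps)
    then show ?thesis unfolding a2 s_def by (simp add: algebra_simps)
  qed
  have 2: "d * a + s * b = 0"
  proof -
    have "\<tau> $ 1 $ 1 * a + s * b + \<tau> $ 2 $ 2 * (hess_over z \<epsilon> 2 2 - hess_over z' \<epsilon>' 2 2) = 0"
      using hess_over_shear(2)[OF g(1)] hess_over_shear(2)[OF g(2)] unfolding a_def b_def s_def
      by (simp add: algebra_simps)
    then show ?thesis unfolding a2 d_def by (simp add: algebra_simps)
  qed
  \<comment> \<open>\<open>d^2 + s^2\<close> is the determinant of the system up to sign.\<close>
  have "(d\<^sup>2 + s\<^sup>2) * a = 0" "(d\<^sup>2 + s\<^sup>2) * b = 0"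
    using 1 2 by algebra+
  moreover have "d \<noteq> 0 \<or> s \<noteq> 0" using False by (auto simp: d_def s_def)
  then have "d\<^sup>2 + s\<^sup>2 \<noteq> 0" by (simp add: sum_power2_eq_zero_iff)
  ultimately have "a = 0" "b = 0" by auto
  then have "hess_over z \<epsilon> 1 1 = hess_over z' \<epsilon>' 1 1" "hess_over z \<epsilon> 2 2 = hess_over z' \<epsilon>' 2 2"
      "hess_over z \<epsilon> 1 2 = hess_over z' \<epsilon>' 1 2" "hess_over z \<epsilon> 2 1 = hess_over z' \<epsilon>' 2 1"
    using a2 hess_over_sym[of z \<epsilon> 2 1] hess_over_sym[of z' \<epsilon>' 2 1] by (auto simp: a_def b_def)
  then show ?thesis using exhaust_2[of j] exhaust_2[of m] by auto
qed

section \<open>The gradient of the logarithmic potential\<close>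

lemma abs_over_le:
  fixes g :: "real^2 \<Rightarrow> real"
  assumes g: "continuous_on UNIV g" and le: "\<And>x. x \<in> \<Omega> \<Longrightarrow> \<bar>g x\<bar> \<le> B" and B: "B \<ge> 0"
  shows "\<bar>over g\<bar> \<le> B * measure lebesgue \<Omega>"
proof -
  have \<Omega>i: "integrable lebesgue (indicator \<Omega> :: _ \<Rightarrow> real)"
    using integrable_over[of "\<lambda>x. 1"] by simp
  have "\<bar>over g\<bar> \<le> (LINT x|lebesgue. \<bar>indicator \<Omega> x * g x\<bar>)"
    unfolding over_def by (rule integral_abs_bound)
  also have "\<dots> \<le> (LINT x|lebesgue. B * indicator \<Omega> x)"
  proof (rule integral_mono)
    show "integrable lebesgue (\<lambda>x. \<bar>indicator \<Omega> x * g x\<bar>)" by (intro integrable_abs integrable_over g)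
    show "integrable lebesgue (\<lambda>x. B * indicator \<Omega> x)" by (intro integrable_mult_right \<Omega>i)
    show "\<bar>indicator \<Omega> x * g x\<bar> \<le> B * indicator \<Omega> x" for x
      using le[of x] by (cases "x \<in> \<Omega>") auto
  qed
  also have "\<dots> = B * measure lebesgue \<Omega>" by simp
  finally show ?thesis .
qed

lemma over_diff:
  fixes f g :: "real^2 \<Rightarrow> real"
  assumes "continuous_on UNIV f" "continuous_on UNIV g"
  shows "over (\<lambda>x. f x - g x) = over f - over g"
  unfolding over_def right_diff_distrib
  by (intro Bochner_Integration.integral_diff integrable_over assms)

lemma over_cmult: "over (\<lambda>x. c * g x) = c * over g"
  unfolding over_def by (simp add: mult.left_commute)

text \<open>Differentiation under the integral: the Taylor remainder is quadratic uniformly over the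
  bounded set of points \<open>x - z\<close> with \<open>x\<close> in
  \<open>\<Omega>\<close>.\<close>

lemma over_shift_has_derivative:
  assumes f: "smooth f"
  shows "((\<lambda>z. over (\<lambda>x. f (x - z))) has_derivative
     (\<lambda>d. - (\<Sum>j\<in>UNIV. d $ j * over (\<lambda>x. pd j f (x - z))))) (at z)"
proof -
  have "\<exists>r. \<forall>x\<in>\<Omega>. norm x \<le> r" using bounded_\<Omega> by (simp add: bounded_iff)
  then obtain r where r: "\<And>x. x \<in> \<Omega> \<Longrightarrow> norm x \<le> r" by blast
  obtain M where M: "M \<ge> 0" "\<And>x y. norm x \<le> r + norm z + 1 \<Longrightarrow> norm y \<le> r + norm z + 1 \<Longrightarrow>
      \<bar>f x - f y - (\<Sum>j\<in>UNIV. (x - y) $ j * pd j f y)\<bar> \<le> M * (norm (x - y))\<^sup>2"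
    by (rule smooth_taylor_on_cball[OF f, of "r + norm z + 1"]) blast
  let ?L = "\<lambda>d. - (\<Sum>j\<in>UNIV. d $ j * over (\<lambda>x. pd j f (x - z)))"
  let ?F = "\<lambda>z. over (\<lambda>x. f (x - z))"
  have cont: "continuous_on UNIV (\<lambda>x. f (x - a))" "continuous_on UNIV (\<lambda>x. pd j f (x - a))" for a j
    by (intro smooth_continuous smooth_shift smooth_partial_deriv f)+
  have est: "\<bar>?F (z + d) - ?F z - ?L d\<bar> \<le> (M * measure lebesgue \<Omega>) * (norm d)\<^sup>2" if d: "norm d \<le> 1" for d
  proof -
    let ?R = "\<lambda>x. f (x - (z + d)) - f (x - z) - (\<Sum>j\<in>UNIV. (- d) $ j * pd j f (x - z))"
    let ?g = "\<lambda>j x. (- d) $ j * pd j f (x - z)"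
    have c: "continuous_on UNIV (?g j)" for j by (intro continuous_intros cont)
    have c1: "continuous_on UNIV (\<lambda>x. \<Sum>j\<in>UNIV. ?g j x)" by (intro continuous_on_sum c)
    have c2: "continuous_on UNIV (\<lambda>x. f (x - (z + d)) - f (x - z))" by (intro continuous_on_diff cont)
    have "over ?R = ?F (z + d) - ?F z - over (\<lambda>x. \<Sum>j\<in>UNIV. ?g j x)"
      unfolding over_diff[OF c2 c1] over_diff[OF cont(1) cont(1)] ..
    also have "over (\<lambda>x. \<Sum>j\<in>UNIV. ?g j x) = (\<Sum>j\<in>UNIV. (- d) $ j * over (\<lambda>x. pd j f (x - z)))"
      unfolding over_sum[of ?g, OF c, symmetric] over_cmult ..
    also have "\<dots> = ?L d" by (simp add: sum_negf)
    finally have eq: "?F (z + d) - ?F z - ?L d = over ?R" by simp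
    have "\<bar>over ?R\<bar> \<le> (M * (norm d)\<^sup>2) * measure lebesgue \<Omega>"
    proof (rule abs_over_le)
      show "continuous_on UNIV ?R" by (intro continuous_intros cont)
      fix x assume x: "x \<in> \<Omega>"
      have 1: "norm (x - z) \<le> r + norm z + 1" using r[OF x] norm_triangle_ineq4[of x z] by linarith
      have 2: "norm (x - (z + d)) \<le> r + norm z + 1"
        using r[OF x] norm_triangle_ineq4[of x "z + d"] norm_triangle_ineq[of z d] d by linarith
      show "\<bar>?R x\<bar> \<le> M * (norm d)\<^sup>2" using M(2)[OF 2 1] by simp
    qed (use M in auto)
    then show ?thesis unfolding eq by (simp only: mult_ac)
  qed
  have bl: "bounded_linear ?L"
    by (intro bounded_linear_minus bounded_linear_sum bounded_linear_mult_const bounded_linear_vec_nth)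
  let ?K = "M * measure lebesgue \<Omega>"
  show ?thesis unfolding has_derivative_at
  proof (intro conjI bl)
    show "(\<lambda>d. norm (?F (z + d) - ?F z - ?L d) / norm d) \<midarrow>0\<rightarrow> 0"
    proof (rule Lim_null_comparison)
      show "\<forall>\<^sub>F d in at 0. norm (norm (?F (z + d) - ?F z - ?L d) / norm d) \<le> ?K * norm d"
        unfolding eventually_at
      proof (intro exI[of _ 1] conjI ballI impI)
        fix d :: "real^2" assume d: "d \<noteq> 0 \<and> dist d 0 < 1"
        then have "\<bar>?F (z + d) - ?F z - ?L d\<bar> \<le> ?K * (norm d)\<^sup>2" by (intro est) auto
        then show "norm (norm (?F (z + d) - ?F z - ?L d) / norm d) \<le> ?K * norm d"
          using d by (simp add: divide_le_eq power2_eq_square mult.assoc)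
      qed simp
      have "((\<lambda>d. norm d) \<longlongrightarrow> 0) (at (0::real^2))" by (rule tendsto_norm_zero[OF tendsto_ident_at])
      from tendsto_mult[OF tendsto_const this] show "((\<lambda>d. ?K * norm d) \<longlongrightarrow> 0) (at (0::real^2))" by simp
    qed
  qed
qed

text \<open>A mollified component of minus the gradient of the logarithmic potential; halving the
  radii gives a geometric majorant for the increments.\<close>

definition pot :: "2 \<Rightarrow> nat \<Rightarrow> real^2 \<Rightarrow> real" where
  "pot m n z = over (\<lambda>x. kern m ((1/2) ^ n) (x - z))"

lemma pot_has_derivative:
  "(pot m n has_derivative (\<lambda>d. - (\<Sum>j\<in>UNIV. d $ j * hess_over z ((1/2) ^ n) j m))) (at z)"
  unfolding pot_def[abs_def] hess_over_def by (rule over_shift_has_derivative[OF smooth_kern])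

lemma pot_continuous: "continuous_on S (pot m n)"
  by (rule continuous_at_imp_continuous_on) (use has_derivative_continuous[OF pot_has_derivative] in blast)

text \<open>Consecutive kernels differ only on a disc of radius \<open>2^-n\<close>, by at most
  \<open>3 * C * 2^n\<close>; the area contributes at most \<open>4 * 4^-n\<close>.\<close>

lemma pot_Suc_bound:
  obtains K where "K \<ge> 0" "\<And>m n z. \<bar>pot m (Suc n) z - pot m n z\<bar> \<le> K * (1/2) ^ n"
proof -
  obtain C where C: "C > 0" "\<And>\<epsilon> x m. \<epsilon> > 0 \<Longrightarrow> \<bar>kern m \<epsilon> x\<bar> \<le> C / \<epsilon>"
    by (rule kern_bound) blast
  show ?thesis
  proof (rule that[of "12 * C"])
    fix m n z
    let ?e = "(1/2) ^ n :: real"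
    let ?k = "\<lambda>x. kern m ((1/2) ^ Suc n) (x - z) - kern m ?e (x - z)"
    have cont: "continuous_on UNIV (\<lambda>x. kern m \<epsilon> (x - z))" for \<epsilon>
      by (intro smooth_continuous smooth_shift smooth_kern)
    have ck: "continuous_on UNIV ?k" by (intro continuous_intros cont)
    have e: "?e > 0" by simp
    have eq: "pot m (Suc n) z - pot m n z = over ?k"
      unfolding pot_def by (rule over_diff[OF cont cont, symmetric])
    have "\<bar>over ?k\<bar> \<le> (LINT x|lebesgue. \<bar>indicator \<Omega> x * ?k x\<bar>)"
      unfolding over_def by (rule integral_abs_bound)
    also have "\<dots> \<le> (LINT x|lebesgue. (3 * C / ?e) * indicator (cball z ?e) x)"
    proof (rule integral_mono)
      show "integrable lebesgue (\<lambda>x. \<bar>indicator \<Omega> x * ?k x\<bar>)" by (intro integrable_abs integrable_over ck)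
      show "integrable lebesgue (\<lambda>x. (3 * C / ?e) * indicator (cball z ?e) x)"
        by (intro integrable_mult_right integrable_real_indicator)
           (use emeasure_bounded_finite[OF bounded_cball[of z ?e]] in auto)
      show "\<bar>indicator \<Omega> x * ?k x\<bar> \<le> (3 * C / ?e) * indicator (cball z ?e) x" for x
      proof (cases "norm (x - z) \<le> ?e")
        case True
        have "\<bar>kern m ((1/2) ^ Suc n) (x - z)\<bar> \<le> 2 * C / ?e" using C(2)[of "(1/2) ^ Suc n" m "x - z"] by (simp add: mult.commute)
        moreover have "\<bar>kern m ?e (x - z)\<bar> \<le> C / ?e" by (rule C(2)) simp
        ultimately have k: "\<bar>?k x\<bar> \<le> 3 * C / ?e" by (simp add: add_divide_distrib[symmetric])
        have "\<bar>indicator \<Omega> x * ?k x\<bar> \<le> 1 * \<bar>?k x\<bar>"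
          unfolding abs_mult by (intro mult_right_mono) (auto simp: indicator_def)
        also have "1 * \<bar>?k x\<bar> \<le> 3 * C / ?e" using k by simp
        finally have "\<bar>indicator \<Omega> x * ?k x\<bar> \<le> 3 * C / ?e" .
        moreover have "x \<in> cball z ?e" using True by (simp add: dist_norm norm_minus_commute)
        ultimately show ?thesis by simp
      next
        case False
        then have n: "norm (x - z) > ?e" by simp
        moreover have "(1/2::real) ^ Suc n \<le> ?e" by simp
        ultimately have "norm (x - z) > (1/2) ^ Suc n" by linarith
        from kern_outside[OF _ this] kern_outside[OF _ n] have "?k x = 0" by simp
        then have "\<bar>indicator \<Omega> x * ?k x\<bar> = 0" by simp
        moreover have "0 \<le> (3 * C / ?e) * indicator (cball z ?e) x" using C by (intro mult_nonneg_nonneg) auto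
        ultimately show ?thesis by linarith
      qed
    qed
    also have "\<dots> = (3 * C / ?e) * measure lebesgue (cball z ?e)" by simp
    also have "\<dots> \<le> (3 * C / ?e) * (4 * ?e\<^sup>2)"
      using C by (intro mult_left_mono measure_cball_le) auto
    also have "\<dots> = 12 * C * ?e" by (simp add: power2_eq_square)
    finally show "\<bar>pot m (Suc n) z - pot m n z\<bar> \<le> 12 * C * (1/2) ^ n" unfolding eq .
  qed (use C in simp)
qed

text \<open>The limit of \<open>pot m n\<close>, written as a telescoping series so that the
  Weierstrass test gives uniform convergence.\<close>

definition pot_lim :: "2 \<Rightarrow> real^2 \<Rightarrow> real" where
  "pot_lim m z = pot m 0 z + (\<Sum>i. pot m (Suc i) z - pot m i z)"

lemma pot_uniform_limit: "uniform_limit UNIV (pot m) (pot_lim m) sequentially"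
proof -
  obtain K where K: "K \<ge> 0" "\<And>m n z. \<bar>pot m (Suc n) z - pot m n z\<bar> \<le> K * (1/2) ^ n"
    by (rule pot_Suc_bound) blast
  have "summable (\<lambda>n. K * (1/2::real) ^ n)" by (intro summable_mult summable_geometric) simp
  then have "uniform_limit UNIV (\<lambda>n z. \<Sum>i<n. pot m (Suc i) z - pot m i z) (\<lambda>z. \<Sum>i. pot m (Suc i) z - pot m i z) sequentially"
    by (rule Weierstrass_m_test[rotated]) (use K in auto)
  from uniform_limit_add[OF uniform_limit_const this, of "pot m 0"]
  have "uniform_limit UNIV (\<lambda>n z. pot m 0 z + (\<Sum>i<n. pot m (Suc i) z - pot m i z)) (pot_lim m) sequentially"
    by (simp add: pot_lim_def[abs_def])
  moreover have "pot m 0 z + (\<Sum>i<n. pot m (Suc i) z - pot m i z) = pot m n z" for n z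
    by (induction n) auto
  ultimately show ?thesis by simp
qed

lemma pot_tendsto: "(\<lambda>n. pot m n z) \<longlonglongrightarrow> pot_lim m z"
  by (rule tendsto_uniform_limitI[OF pot_uniform_limit UNIV_I])

lemma pot_lim_continuous: "continuous_on UNIV (pot_lim m)"
proof (rule uniform_limit_theorem[OF _ pot_uniform_limit])
  show "\<forall>\<^sub>F n in sequentially. continuous_on UNIV (pot m n)"
    using pot_continuous by (intro always_eventually allI)
qed simp

text \<open>Kernels of smaller radius coincide off the ball, so the sequence is stationary from
  \<open>n\<close> on.\<close>

lemma pot_lim_eq_pot:
  assumes "\<And>x. x \<in> \<Omega> \<Longrightarrow> norm (x - z) > (1/2) ^ n"
  shows "pot_lim m z = pot m n z"
proof -
  have "pot m k z = pot m n z" if "k \<ge> n" for k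
    unfolding pot_def over_def
  proof (rule Bochner_Integration.integral_cong[OF refl])
    fix x
    have le: "(1/2::real) ^ k \<le> (1/2) ^ n" using that by (intro power_decreasing) auto
    show "indicator \<Omega> x * kern m ((1/2) ^ k) (x - z) = indicator \<Omega> x * kern m ((1/2) ^ n) (x - z)"
    proof (cases "x \<in> \<Omega>")
      case True
      have n: "norm (x - z) > (1/2) ^ n" by (rule assms[OF True])
      have k: "norm (x - z) > (1/2) ^ k" using le n by linarith
      show ?thesis by (simp only: kern_outside[OF _ n] kern_outside[OF _ k] zero_less_power zero_less_divide_1_iff zero_less_numeral)
    qed simp
  qed
  then have "(\<lambda>k. pot m k z) \<longlonglongrightarrow> pot m n z"
    by (intro tendsto_eventually eventually_sequentiallyI[of n])
  from LIMSEQ_unique[OF pot_tendsto this] show ?thesis .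
qed

text \<open>Near \<open>z\<close> the kernels are unmollified on \<open>\<Omega>\<close>. The
  derivative matrix is symmetric and, as the bump misses \<open>\<Omega>\<close>, trace-free: these
  are the Cauchy-Riemann equations for \<open>pot_lim 1 - \<i> * pot_lim 2\<close>.\<close>

lemma pot_lim_outside:
  assumes z: "z \<notin> closure \<Omega>"
  obtains a b where "(pot_lim 1 has_derivative (\<lambda>d. a * d $ 1 + b * d $ 2)) (at z)"
    "(pot_lim 2 has_derivative (\<lambda>d. b * d $ 1 - a * d $ 2)) (at z)"
proof -
  obtain e where e: "e > 0" "ball z e \<subseteq> - closure \<Omega>"
    using z open_Compl[OF closed_closure] openE by blast
  \<comment> \<open>One half of \<open>e\<close> is room for moving \<open>z\<close>, the other half
    exceeds the mollification radius.\<close>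
  obtain n where n: "(1/2::real) ^ n < e / 2" using real_arch_pow_inv[of "e/2" "1/2"] e by auto
  have far: "norm (x - y) > (1/2) ^ n" if "x \<in> \<Omega>" "y \<in> ball z (e/2)" for x y
  proof -
    have "x \<notin> ball z e" using that(1) e closure_subset by blast
    then have "e \<le> dist z x" by simp
    also have "\<dots> \<le> dist z y + dist y x" by (rule dist_triangle)
    also have "dist z y < e / 2" using that by simp
    finally have "dist y x > e / 2" by simp
    then show ?thesis using n by (simp add: dist_norm norm_minus_commute)
  qed
  let ?H = "hess_over z ((1/2) ^ n)"
  have zb: "z \<in> ball z (e/2)" using e by simp
  have "?H 1 1 + ?H 2 2 = over (\<lambda>x. bump ((1/2) ^ n) (x - z))"
    using over_sum[of "\<lambda>j x. pd j (kern j ((1/2) ^ n)) (x - z)"]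
    by (simp add: bump_eq_div_kern hess_over_def sum_2 smooth_continuous smooth_shift smooth_partial_deriv smooth_kern)
  also have "\<dots> = 0"
  proof -
    have "indicator \<Omega> x * bump ((1/2) ^ n) (x - z) = 0" for x
      using far[OF _ zb] by (cases "x \<in> \<Omega>") (auto simp: bump_outside)
    then show ?thesis unfolding over_def by (simp only: integral_zero)
  qed
  finally have tr: "?H 2 2 = - ?H 1 1" by simp
  have d: "(pot_lim m has_derivative (\<lambda>d. - (\<Sum>j\<in>UNIV. d $ j * ?H j m))) (at z)" for m
    by (rule has_derivative_transform_within_open[OF pot_has_derivative open_ball zb])
       (use far in \<open>auto intro!: pot_lim_eq_pot[symmetric]\<close>)
  show ?thesis
  proof (rule that[of "- ?H 1 1" "- ?H 1 2"])
    show "(pot_lim 1 has_derivative (\<lambda>d. - ?H 1 1 * d $ 1 + - ?H 1 2 * d $ 2)) (at z)"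
      using d[of 1] hess_over_sym[of z "(1/2)^n" 2 1] by (simp add: sum_2 mult.commute)
    show "(pot_lim 2 has_derivative (\<lambda>d. - ?H 1 2 * d $ 1 - - ?H 1 1 * d $ 2)) (at z)"
      using d[of 2] tr by (simp add: sum_2 mult.commute)
  qed
qed

lemma pot_lim_decay:
  obtains K R where "R > 0" "\<And>m z. norm z \<ge> R \<Longrightarrow> \<bar>pot_lim m z\<bar> \<le> K / norm z"
proof -
  have "\<exists>r. \<forall>x\<in>\<Omega>. norm x \<le> r" using bounded_\<Omega> by (simp add: bounded_iff)
  then obtain r where r: "\<And>x. x \<in> \<Omega> \<Longrightarrow> norm x \<le> r" by blast
  \<comment> \<open>Large enough for \<open>norm (x - z)\<close> to be at least
    \<open>norm z / 2\<close> and to exceed 1, the mollification radius at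
    \<open>n = 0\<close>.\<close>
  define R where "R = 2 * \<bar>r\<bar> + 4"
  show ?thesis
  proof (rule that[of R "2 * measure lebesgue \<Omega>"])
    show "R > 0" by (simp add: R_def)
    fix m and z :: "real^2" assume z: "norm z \<ge> R"
    have far: "norm (x - z) \<ge> norm z / 2" "norm (x - z) > 1" if "x \<in> \<Omega>" for x
      using norm_triangle_ineq2[of z x] r[OF that] z abs_ge_self[of r] unfolding R_def norm_minus_commute[of z x] by linarith+
    have nz: "norm z > 0" using z abs_ge_zero[of r] unfolding R_def by linarith
    have "pot_lim m z = pot m 0 z" using far by (intro pot_lim_eq_pot) auto
    also have "\<bar>pot m 0 z\<bar> \<le> (2 / norm z) * measure lebesgue \<Omega>"
      unfolding pot_def
    proof (rule abs_over_le)
      show "continuous_on UNIV (\<lambda>x. kern m ((1/2) ^ 0) (x - z))"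
        by (intro smooth_continuous smooth_shift smooth_kern)
      fix x assume x: "x \<in> \<Omega>"
      have n0: "norm (x - z) > 0" using far(2)[OF x] by linarith
      have "\<bar>kern m ((1/2) ^ 0) (x - z)\<bar> = \<bar>(x - z) $ m\<bar> / (norm (x - z))\<^sup>2"
        using far(2)[OF x] by (simp add: kern_outside dot_square_norm abs_divide)
      also have "\<dots> \<le> norm (x - z) / (norm (x - z))\<^sup>2"
        by (intro divide_right_mono component_le_norm_cart) auto
      also have "\<dots> = 1 / norm (x - z)" using n0 by (simp add: power2_eq_square)
      also have "\<dots> \<le> 1 / (norm z / 2)" using far(1)[OF x] nz n0 by (intro divide_left_mono mult_pos_pos) auto
      finally show "\<bar>kern m ((1/2) ^ 0) (x - z)\<bar> \<le> 2 / norm z" by simp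
    qed simp
    finally show "\<bar>pot_lim m z\<bar> \<le> 2 * measure lebesgue \<Omega> / norm z" by simp
  qed
qed

text \<open>For small radii the derivative of \<open>pot m n\<close> is a constant matrix, so adding
  a linear function makes it constant on small discs. This passes to the limit and spreads by
  connectedness.\<close>

lemma pot_lim_inside:
  assumes nz: "\<tau> \<noteq> 0 \<or> P \<noteq> 0" and conn: "connected \<Omega>" and ne: "\<Omega> \<noteq> {}"
  obtains h c where "h 1 1 + h 2 2 = bump_mass" "h 1 2 = h 2 1"
    "\<And>m z. z \<in> \<Omega> \<Longrightarrow> pot_lim m z = c m - (\<Sum>j\<in>UNIV. h j m * z $ j)"
proof -
  \<comment> \<open>The doubled radius leaves room for mollification balls around the points of
    \<open>ball z r\<close>.\<close>
  have ex: "\<exists>r. 0 < r \<and> r \<le> 1 \<and> ball z (2 * r) \<subseteq> \<Omega>" if z: "z \<in> \<Omega>" for z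
  proof -
    obtain e where e: "e > 0" "ball z e \<subseteq> \<Omega>"
      using open_\<Omega> z unfolding open_contains_ball by blast
    have "ball z (2 * min (e/2) 1) \<subseteq> ball z e" by (rule subset_ball) simp
    then have "ball z (2 * min (e/2) 1) \<subseteq> \<Omega>" using e(2) by (rule subset_trans)
    moreover have "0 < min (e/2) 1" "min (e/2) 1 \<le> 1" using e(1) by auto
    ultimately show ?thesis by (intro exI[of _ "min (e/2) 1"] conjI)
  qed
  obtain z0 where z0: "z0 \<in> \<Omega>" using ne by blast
  then obtain r0 where r0: "0 < r0" "r0 \<le> 1" "ball z0 (2 * r0) \<subseteq> \<Omega>" using ex by blast
  have "cball z0 r0 \<subseteq> ball z0 (2 * r0)" using r0 by (auto simp: subset_eq)
  then have g0: "good z0 r0" unfolding good_def using r0 by blast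
  define h where "h = hess_over z0 r0"
  have hc: "hess_over z \<epsilon> j m = h j m" if "good z \<epsilon>" for z \<epsilon> j m
    unfolding h_def by (rule hess_over_const[OF nz that g0])
  let ?l = "\<lambda>m z. \<Sum>j\<in>UNIV. h j m * z $ j"
  have loc: "pot_lim m y + ?l m y = pot_lim m z + ?l m z"
    if r: "0 < r" "r \<le> 1" "ball z (2 * r) \<subseteq> \<Omega>" and y: "y \<in> ball z r" for m z y r
  proof -
    obtain N where N: "(1/2::real) ^ N < r" using real_arch_pow_inv[of r "1/2"] r by auto
    have "pot m n y + ?l m y = pot m n z + ?l m z" if n: "n \<ge> N" for n
    proof -
      have "(1/2::real) ^ n \<le> (1/2) ^ N" by (rule power_decreasing[OF n]) auto
      then have en: "(1/2::real) ^ n < r" using N by linarith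
      have g: "good x ((1/2) ^ n)" if x: "x \<in> ball z r" for x
      proof -
        have "cball x ((1/2) ^ n) \<subseteq> ball z (2 * r)"
        proof
          fix v assume "v \<in> cball x ((1/2) ^ n)"
          then have "dist x v \<le> (1/2) ^ n" "dist z x < r" using x by auto
          then show "v \<in> ball z (2 * r)" using en dist_triangle[of z v x] unfolding mem_ball by linarith
        qed
        then show ?thesis using r(3) by (auto simp: good_def power_le_one)
      qed
      have "((\<lambda>x. pot m n x + ?l m x) has_derivative (\<lambda>d. 0)) (at x)" if "x \<in> ball z r" for x
      proof -
        have "((\<lambda>x. pot m n x + ?l m x) has_derivative
            (\<lambda>d. - (\<Sum>j\<in>UNIV. d $ j * hess_over x ((1/2) ^ n) j m) + (\<Sum>j\<in>UNIV. h j m * d $ j))) (at x)"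
          by (intro has_derivative_add[OF pot_has_derivative] bounded_linear_imp_has_derivative
              bounded_linear_sum bounded_linear_const_mult bounded_linear_vec_nth)
        then show ?thesis unfolding hc[OF g[OF that]] by (simp add: mult.commute)
      qed
      then have "((\<lambda>x. pot m n x + ?l m x) has_derivative (\<lambda>d. 0)) (at x within ball z r)" if "x \<in> ball z r" for x
        using that has_derivative_at_withinI by blast
      from has_derivative_zero_unique[OF convex_ball this y, of z] show ?thesis using r by simp
    qed
    then have "\<forall>\<^sub>F n in sequentially. pot m n y + ?l m y = pot m n z + ?l m z"
      by (auto simp: eventually_sequentially)
    moreover have "(\<lambda>n. pot m n y + ?l m y) \<longlonglongrightarrow> pot_lim m y + ?l m y"
      by (intro tendsto_add pot_tendsto tendsto_const)
    ultimately have "(\<lambda>n. pot m n z + ?l m z) \<longlonglongrightarrow> pot_lim m y + ?l m y"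
      by (rule Lim_transform_eventually[rotated])
    moreover have "(\<lambda>n. pot m n z + ?l m z) \<longlonglongrightarrow> pot_lim m z + ?l m z"
      by (intro tendsto_add pot_tendsto tendsto_const)
    ultimately show ?thesis by (rule LIMSEQ_unique)
  qed
  have const: "pot_lim m y + ?l m y = pot_lim m z0 + ?l m z0" if y: "y \<in> \<Omega>" for m y
  proof -
    have "((\<lambda>z. pot_lim m z + ?l m z) has_derivative (\<lambda>d. 0)) (at z)" if z: "z \<in> \<Omega>" for z
    proof -
      obtain r where r: "0 < r" "r \<le> 1" "ball z (2 * r) \<subseteq> \<Omega>" using ex[OF z] by blast
      have "z \<in> ball z r" using r by simp
      from has_derivative_transform_within_open[OF has_derivative_const open_ball this loc[OF r, symmetric]]
      show ?thesis .
    qed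
    from has_derivative_zero_unique_connected[OF open_\<Omega> conn this y z0] show ?thesis .
  qed
  show ?thesis
  proof (rule that[of h "\<lambda>m. pot_lim m z0 + ?l m z0"])
    show "h 1 1 + h 2 2 = bump_mass" unfolding h_def by (rule hess_over_trace[OF g0])
    show "h 1 2 = h 2 1" unfolding h_def by (rule hess_over_sym)
    show "pot_lim m z = (pot_lim m z0 + ?l m z0) - (\<Sum>j\<in>UNIV. h j m * z $ j)" if "z \<in> \<Omega>" for m z
      using const[OF that, of m] by linarith
  qed
qed

end

section \<open>Domains with a Schwarz function of linear growth\<close>

text \<open>Dividing powers of the function by a linear factor removes the point at infinity from the
  maximum principle.\<close>

lemma norm_le_1_unbounded_domain:
  assumes V: "open V" "ball z0 r \<inter> V = {}" "r > 0"
    and H: "H holomorphic_on V" "continuous_on (closure V) H"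
    and M: "\<And>z. z \<in> closure V \<Longrightarrow> norm (H z) \<le> M"
    and fr: "\<And>z. z \<in> frontier V \<Longrightarrow> norm (H z) \<le> 1"
    and z: "z \<in> V"
  shows "norm (H z) \<le> 1"
proof (rule ccontr)
  assume "\<not> norm (H z) \<le> 1"
  \<comment> \<open>Chosen against the final estimate
    \<open>norm (H z) ^ n \<le> norm (z - z0) / r\<close>.\<close>
  then obtain n where n: "norm (z - z0) / r < norm (H z) ^ n"
    using real_arch_pow[of "norm (H z)" "norm (z - z0) / r"] by auto
  \<comment> \<open>On the outer circle the linear factor has to absorb the bound
    \<open>\<bar>M\<bar> ^ n\<close>.\<close>
  define \<rho> where "\<rho> = \<bar>M\<bar> ^ n * r + norm (z - z0) + r + 1"
  have \<rho>: "\<rho> > norm (z - z0)" "\<rho> \<ge> \<bar>M\<bar> ^ n * r" "\<rho> > 0"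
    using V(3) by (auto simp: \<rho>_def add_pos_nonneg add_nonneg_pos intro!: add_nonneg_nonneg)
  let ?U = "V \<inter> ball z0 \<rho>"
  let ?K = "\<lambda>w. H w ^ n * (of_real r / (w - z0))"
  have far: "r \<le> norm (w - z0)" if "w \<in> closure V" for w
  proof -
    have "ball z0 r \<inter> closure V = {}" using V(2) by (simp add: open_Int_closure_eq_empty)
    then have "w \<notin> ball z0 r" using that by blast
    then show ?thesis by (simp add: dist_norm norm_minus_commute not_less)
  qed
  have nz: "w \<noteq> z0" if "w \<in> closure V" for w using far[OF that] V(3) by auto
  have sub: "?U \<subseteq> V" "closure ?U \<subseteq> closure V" by (auto intro: closure_mono[THEN subsetD])
  have "norm (?K z) \<le> 1"
  proof (rule maximum_modulus_frontier[of ?K ?U])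
    show "?K holomorphic_on interior ?U"
      using V(1) nz closure_subset[of V]
      by (intro holomorphic_intros holomorphic_on_subset[OF H(1)]) (auto simp: interior_open open_Int)
    show "continuous_on (closure ?U) ?K"
      using nz sub by (intro continuous_intros continuous_on_subset[OF H(2)]) auto
    show "bounded ?U" by (rule bounded_subset[OF bounded_ball]) auto
    show "z \<in> ?U" using z \<rho> by (simp add: dist_norm norm_minus_commute)
    fix w assume w: "w \<in> frontier ?U"
    have cw: "w \<in> closure ?U" "w \<notin> ?U" using w V(1) by (auto simp: frontier_def interior_open open_Int)
    then have wV: "w \<in> closure V" using sub by blast
    have r: "r \<le> norm (w - z0)" "0 < norm (w - z0)" using far[OF wV] V(3) by linarith+
    show "norm (?K w) \<le> 1"
    proof (cases "w \<in> V")
      case False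
      then have "w \<in> frontier V" using wV V(1) by (simp add: frontier_def interior_open)
      then have "norm (H w) ^ n \<le> 1" using fr by (simp add: power_le_one)
      moreover have "r / norm (w - z0) \<le> 1" using r by simp
      ultimately have "norm (H w) ^ n * (r / norm (w - z0)) \<le> 1 * 1"
        using V(3) by (intro mult_mono) auto
      then show ?thesis using V(3) by (simp add: norm_mult norm_power norm_divide)
    next
      case True
      then have "\<rho> \<le> norm (w - z0)" using cw(2) by (simp add: dist_norm norm_minus_commute)
      then have "r / norm (w - z0) \<le> r / \<rho>" using V(3) \<rho> by (intro divide_left_mono mult_pos_pos) auto
      moreover have "norm (H w) ^ n \<le> \<bar>M\<bar> ^ n"
        using M[OF wV] by (intro power_mono) auto
      ultimately have "norm (H w) ^ n * (r / norm (w - z0)) \<le> \<bar>M\<bar> ^ n * (r / \<rho>)"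
        using V(3) by (intro mult_mono) auto
      also have "\<dots> \<le> 1" using \<rho> by (simp add: divide_le_eq)
      finally show ?thesis using V(3) by (simp add: norm_mult norm_power norm_divide)
    qed
  qed
  moreover have "norm (z - z0) > 0" using nz[of z] closure_subset z by auto
  ultimately have "norm (H z) ^ n * r \<le> norm (z - z0)"
    using V(3) by (simp add: norm_mult norm_power norm_divide divide_le_eq)
  then show False using n V(3) by (simp add: divide_less_eq not_less[symmetric])
qed

text \<open>\<open>exp (\<i> * F)\<close> and \<open>exp (- \<i> * F)\<close> have moduli
  \<open>exp (- Im F)\<close> and \<open>exp (Im F)\<close>. Both functions are bounded and have
  modulus 1 on the frontier.\<close>

lemma Im_eq_0_from_frontier:
  assumes V: "open V" "ball z0 r \<inter> V = {}" "r > 0"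
    and F: "F holomorphic_on V" "continuous_on (closure V) F"
    and M: "\<And>z. z \<in> closure V \<Longrightarrow> norm (F z) \<le> M"
    and fr: "\<And>z. z \<in> frontier V \<Longrightarrow> Im (F z) = 0"
    and z: "z \<in> V"
  shows "Im (F z) = 0"
proof -
  have *: "norm (exp (c * F z)) \<le> 1" if c: "c = \<i> \<or> c = - \<i>" for c
  proof (rule norm_le_1_unbounded_domain[OF V _ _ _ _ z])
    show "(\<lambda>z. exp (c * F z)) holomorphic_on V" by (intro holomorphic_intros F)
    show "continuous_on (closure V) (\<lambda>z. exp (c * F z))" by (intro continuous_intros F)
    show "norm (exp (c * F w)) \<le> exp M" if "w \<in> closure V" for w
      using M[OF that] c complex_Re_le_cmod[of "c * F w"] by (auto simp: norm_mult)
    show "norm (exp (c * F w)) \<le> 1" if "w \<in> frontier V" for w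
      using fr[OF that] c by auto
  qed
  show ?thesis using *[of \<i>] *[of "-\<i>"] by simp
qed

text \<open>A nonconstant holomorphic map is open, and the real line contains no disc.\<close>

lemma constant_on_if_Im_eq_0:
  assumes W: "open W" "connected W" and F: "F holomorphic_on W" and im: "\<And>z. z \<in> W \<Longrightarrow> Im (F z) = 0"
  shows "F constant_on W"
proof (rule ccontr)
  assume nc: "\<not> F constant_on W"
  then obtain w where w: "w \<in> W" by (auto simp: constant_on_def)
  have "open (F ` W)" by (rule open_mapping_thm[OF F W W(1) _ nc]) simp
  then obtain e where e: "e > 0" "ball (F w) e \<subseteq> F ` W" using w open_contains_ball by blast
  have "F w + \<i> * of_real (e / 2) \<in> ball (F w) e" using e by (simp add: dist_norm norm_mult)
  then obtain v where "v \<in> W" "F w + \<i> * of_real (e / 2) = F v" using e by blast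
  then show False using im[of v] im[OF w] e
    by (metis Im_complex_of_real Im_i_times Re_complex_of_real add_0 half_gt_zero less_irrefl plus_complex.sel(2))
qed

text \<open>On a bounded component \<open>z + S z\<close> and \<open>\<i> * (z - S z)\<close> would
  be real on the frontier, hence constant inside, and so would be \<open>z\<close>. Thus every
  component is unbounded, and a bounded set has only one unbounded complementary component.\<close>

lemma connected_complement_closure:
  assumes D: "open D" "bounded D" "D \<noteq> {}"
    and S: "continuous_on UNIV S" "S holomorphic_on (- closure D)"
    and bd: "\<And>z. z \<in> closure D \<Longrightarrow> S z = cnj z"
  shows "connected (- closure D)"
proof -
  let ?V = "- closure D"
  have bV: "bounded (- ?V)" using D(2) by (simp add: bounded_closure)
  have unb: "\<not> bounded W" if W: "W \<in> components ?V" for W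
  proof
    assume bW: "bounded W"
    have oW: "open W" by (rule open_components[OF open_Compl[OF closed_closure] W])
    have cW: "connected W" "W \<noteq> {}" "W \<subseteq> ?V"
      using W in_components_connected in_components_nonempty in_components_subset by blast+
    obtain z0 r where z0: "r > 0" "ball z0 r \<subseteq> D" using D openE by (metis ex_in_conv)
    have dis: "ball z0 r \<inter> W = {}" using z0 cW closure_subset[of D] by blast
    have frW: "w \<in> closure D" if "w \<in> frontier W" for w
    proof -
      have "frontier W \<subseteq> frontier ?V" by (rule frontier_of_components_subset[OF W])
      also have "\<dots> \<subseteq> closure D" using frontier_closures[of ?V] by (auto simp: closure_complement)
      finally show ?thesis using that by blast
    qed
    have const: "F constant_on W"
      if F: "F holomorphic_on W" "continuous_on UNIV F" and re: "\<And>w. w \<in> frontier W \<Longrightarrow> Im (F w) = 0" for F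
    proof (rule constant_on_if_Im_eq_0[OF oW cW(1) F(1)])
      have "compact (F ` closure W)"
        using bW by (intro compact_continuous_image continuous_on_subset[OF F(2)]) (auto simp: compact_closure)
      then obtain M where "\<forall>w\<in>F ` closure W. norm w \<le> M" using compact_imp_bounded bounded_iff by metis
      then show "Im (F z) = 0" if "z \<in> W" for z
        using Im_eq_0_from_frontier[OF oW dis z0(1) F(1) continuous_on_subset[OF F(2) subset_UNIV] _ re that, of M] by blast
    qed
    have SW: "S holomorphic_on W" by (rule holomorphic_on_subset[OF S(2) cW(3)])
    have "(\<lambda>z. z + S z) constant_on W"
      by (rule const) (auto intro!: holomorphic_intros SW continuous_intros S simp: bd frW)
    moreover have "(\<lambda>z. \<i> * (z - S z)) constant_on W"
      by (rule const) (auto intro!: holomorphic_intros SW continuous_intros S simp: bd frW)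
    ultimately obtain c1 c2 where c: "\<And>z. z \<in> W \<Longrightarrow> z + S z = c1" "\<And>z. z \<in> W \<Longrightarrow> \<i> * (z - S z) = c2"
      by (auto simp: constant_on_def)
    have one: "z = (c1 - \<i> * c2) / 2" if "z \<in> W" for z
    proof -
      have "c1 - \<i> * c2 = (z + S z) - \<i> * (\<i> * (z - S z))" by (simp only: c[OF that])
      also have "\<dots> = 2 * z" by (simp add: algebra_simps)
      finally show ?thesis by simp
    qed
    then have "W \<subseteq> {(c1 - \<i> * c2) / 2}" by blast
    then have "finite W" using finite_subset by blast
    then show False using oW cW(2) finite_imp_not_open by blast
  qed
  have "?V \<noteq> {}"
  proof
    assume "?V = {}"
    then have "bounded (UNIV :: complex set)" using bV by simp
    then show False by simp
  qed
  have "connected_component_set ?V x = connected_component_set ?V y" if "x \<in> ?V" "y \<in> ?V" for x y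
  proof (rule cobounded_unique_unbounded_components[OF bV])
    show "connected_component_set ?V x \<in> components ?V" "connected_component_set ?V y \<in> components ?V"
      using that by (auto simp: components_def)
    then show "\<not> bounded (connected_component_set ?V x)" "\<not> bounded (connected_component_set ?V y)"
      using unb by blast+
  qed simp
  then have "\<forall>x\<in>?V. \<forall>y\<in>?V. connected_component ?V x y"
    using connected_component_refl by (metis mem_Collect_eq)
  then show ?thesis by (simp add: connected_iff_connected_component)
qed

section \<open>Domains whose frontier lies on a conic\<close>

definition quad :: "complex \<Rightarrow> complex \<Rightarrow> complex \<Rightarrow> real" where
  "quad d e z = (norm z)\<^sup>2 + 2 * Re (d * z\<^sup>2) + 2 * Re (e * z)"

lemma quad_expand:
  "quad d e (x + of_real t * v) = quad d e x
    + t * (2 * Re (x * cnj v) + 4 * Re (d * x * v) + 2 * Re (e * v)) + t\<^sup>2 * ((norm v)\<^sup>2 + 2 * Re (d * v\<^sup>2))"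
  unfolding quad_def cmod_power2 by (simp add: power2_eq_square algebra_simps)

text \<open>The eigenvalues of the form are \<open>1 + 2 * norm d\<close> and
  \<open>1 - 2 * norm d\<close>.\<close>

lemma quad_form_pos:
  assumes "norm d < 1/2" "v \<noteq> 0" shows "(norm v)\<^sup>2 + 2 * Re (d * v\<^sup>2) > 0"
proof -
  have "\<bar>Re (d * v\<^sup>2)\<bar> \<le> norm d * (norm v)\<^sup>2"
    using abs_Re_le_cmod[of "d * v\<^sup>2"] by (simp add: norm_mult norm_power)
  moreover have "norm d * (norm v)\<^sup>2 < (1/2) * (norm v)\<^sup>2"
    using assms by (intro mult_strict_right_mono) auto
  ultimately show ?thesis by linarith
qed

text \<open>The value at a convex combination falls short of the combination of the values by
  \<open>u * v\<close> times the form at \<open>y - x\<close>.\<close>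

lemma convex_quad_sublevel:
  assumes d: "norm d < 1/2" shows "convex {z. quad d e z < k}"
proof (rule convexI)
  fix x y :: complex and u v :: real
  assume x: "x \<in> {z. quad d e z < k}" and y: "y \<in> {z. quad d e z < k}" and uv: "0 \<le> u" "0 \<le> v" "u + v = 1"
  define q where "q = (norm (y - x))\<^sup>2 + 2 * Re (d * (y - x)\<^sup>2)"
  define s where "s = 2 * Re (x * cnj (y - x)) + 4 * Re (d * x * (y - x)) + 2 * Re (e * (y - x))"
  have u: "u = 1 - v" using uv by simp
  have comb: "u *\<^sub>R x + v *\<^sub>R y = x + of_real v * (y - x)"
    unfolding u by (simp add: scaleR_conv_of_real algebra_simps)
  have ex: "quad d e (x + of_real t * (y - x)) = quad d e x + t * s + t\<^sup>2 * q" for t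
    by (simp only: quad_expand s_def q_def)
  have q: "q \<ge> 0" using quad_form_pos[OF d, of "y - x"] unfolding q_def by (cases "y = x") auto
  have "quad d e y = quad d e x + s + q" using ex[of 1] by simp
  then have "quad d e (u *\<^sub>R x + v *\<^sub>R y) = (1 - v) * quad d e x + v * quad d e y - v * (1 - v) * q"
    unfolding comb ex by (simp add: algebra_simps power2_eq_square)
  also have "\<dots> \<le> (1 - v) * quad d e x + v * quad d e y"
    using uv q u by (simp add: mult_nonneg_nonneg)
  also have "\<dots> < k"
  proof (cases "v = 0")
    case True then show ?thesis using x by simp
  next
    case False
    then have "v * quad d e y < v * k" using uv y by simp
    moreover have "(1 - v) * quad d e x \<le> (1 - v) * k" using uv x by (intro mult_left_mono) auto
    ultimately show ?thesis by (simp add: algebra_simps)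
  qed
  finally show "u *\<^sub>R x + v *\<^sub>R y \<in> {z. quad d e z < k}" by simp
qed

text \<open>The ray is connected, starts in the open set and leaves the bounded one.\<close>

lemma ray_meets_frontier:
  fixes D :: "complex set"
  assumes D: "open D" "bounded D" and x: "x \<in> D" and v: "v \<noteq> 0"
  obtains t where "t > 0" "x + of_real t * v \<in> frontier D"
proof -
  let ?R = "(\<lambda>t. x + of_real t * v) ` {0..}"
  have "connected ?R" by (intro connected_continuous_image continuous_intros) (auto simp: connected_iff_interval)
  moreover have "x \<in> ?R" by (rule image_eqI[of _ _ 0]) auto
  then have "?R \<inter> D \<noteq> {}" using x by blast
  moreover have "?R - D \<noteq> {}"
  proof -
    obtain B where B: "\<And>z. z \<in> D \<Longrightarrow> norm z \<le> B" using D(2) bounded_iff by metis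
    define t where "t = (\<bar>B\<bar> + norm x + 1) / norm v"
    have "norm (of_real t * v) = t * norm v" unfolding norm_mult norm_of_real by (simp add: t_def)
    then have "norm (of_real t * v) = \<bar>B\<bar> + norm x + 1" using v by (simp add: t_def)
    then have "norm (x + of_real t * v) > B" using norm_triangle_ineq4[of "x + of_real t * v" x] by auto
    then have "x + of_real t * v \<notin> D" using B by fastforce
    moreover have "t \<ge> 0" by (simp add: t_def)
    ultimately show ?thesis by auto
  qed
  ultimately obtain t where t: "t \<ge> 0" "x + of_real t * v \<in> frontier D"
    using connected_Int_frontier by blast
  have "t \<noteq> 0" using t(2) x D(1) by (auto simp: frontier_def interior_open)
  then show ?thesis using t that[of t] by simp
qed

text \<open>From a point of \<open>D\<close>, in a direction of nonnegative slope,
  \<open>quad\<close> increases strictly up to the frontier value \<open>k\<close>. Conversely the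
  sublevel set is convex, hence connected, and avoids the frontier.\<close>

lemma sublevel_if_frontier_quad:
  assumes D: "open D" "bounded D" "D \<noteq> {}" and d: "norm d < 1/2"
    and fr: "\<And>z. z \<in> frontier D \<Longrightarrow> quad d e z = k"
  shows "D = {z. quad d e z < k}"
proof
  show sub: "D \<subseteq> {z. quad d e z < k}"
  proof
    fix x assume x: "x \<in> D"
    let ?s = "\<lambda>v. 2 * Re (x * cnj v) + 4 * Re (d * x * v) + 2 * Re (e * v)"
    have "?s (-1) = - ?s 1" by simp
    then obtain v :: complex where v: "v \<noteq> 0" "?s v \<ge> 0"
      by (metis linear neg_0_le_iff_le neg_equal_0_iff_equal one_neq_zero)
    obtain t where t: "t > 0" "x + of_real t * v \<in> frontier D" by (rule ray_meets_frontier[OF D(1,2) x v(1)])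
    have "k = quad d e x + t * ?s v + t\<^sup>2 * ((norm v)\<^sup>2 + 2 * Re (d * v\<^sup>2))"
      using fr[OF t(2)] unfolding quad_expand by simp
    moreover have "t\<^sup>2 * ((norm v)\<^sup>2 + 2 * Re (d * v\<^sup>2)) > 0" using t quad_form_pos[OF d v(1)] by simp
    moreover have "t * ?s v \<ge> 0" using t v by simp
    ultimately show "x \<in> {z. quad d e z < k}" by simp
  qed
  show "{z. quad d e z < k} \<subseteq> D"
  proof (rule ccontr)
    assume "\<not> {z. quad d e z < k} \<subseteq> D"
    then have "{z. quad d e z < k} - D \<noteq> {}" by blast
    moreover have "{z. quad d e z < k} \<inter> D \<noteq> {}" using sub D(3) by blast
    ultimately have "{z. quad d e z < k} \<inter> frontier D \<noteq> {}"
      by (intro connected_Int_frontier convex_connected convex_quad_sublevel d)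
    then show False using fr by auto
  qed
qed

text \<open>In the degenerate case the frontier would lie on two parallel lines.\<close>

lemma frontier_quad_degenerate:
  assumes D: "open D" "bounded D" "D \<noteq> {}" and \<alpha>: "norm \<alpha> = 1"
    and fr: "\<And>z. z \<in> frontier D \<Longrightarrow> quad (\<alpha> / 2) 0 z = k"
  shows False
proof -
  \<comment> \<open>The null direction of the form: \<open>\<alpha> * v^2 = -1\<close> makes
    \<open>quad\<close> constant along \<open>v\<close>, so following rays to the frontier it equals
    \<open>k\<close> on all of \<open>D\<close>.\<close>
  define v where "v = csqrt (- cnj \<alpha>)"
  have v2: "v\<^sup>2 = - cnj \<alpha>" by (simp add: v_def)
  have "(norm v)\<^sup>2 = 1" using \<alpha> by (metis complex_mod_cnj norm_minus_cancel norm_power v2)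
  then have nv: "norm v = 1" by (simp add: power2_eq_1_iff abs_if split: if_splits) (smt (verit) norm_ge_zero)
  have av2: "\<alpha> * v\<^sup>2 = -1" using \<alpha> by (simp add: v2 complex_norm_square[symmetric])
  have av: "\<alpha> * v = - cnj v"
  proof -
    have "v * cnj v = 1" using nv by (simp add: complex_norm_square[symmetric])
    moreover have "(\<alpha> * v) * v = -1" using av2 by (simp add: power2_eq_square mult.assoc)
    ultimately have "(\<alpha> * v) * v = (- cnj v) * v" by (simp add: mult.commute)
    moreover have "v \<noteq> 0" using nv by auto
    ultimately show ?thesis by (metis mult_right_cancel)
  qed
  have along: "quad (\<alpha> / 2) 0 (x + of_real t * v) = quad (\<alpha> / 2) 0 x" for x t
  proof -
    have "\<alpha> / 2 * x * v = (x * (\<alpha> * v)) / 2" by simp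
    then have "\<alpha> / 2 * x * v = - ((x * cnj v) / 2)" by (simp add: av)
    then have 1: "4 * Re (\<alpha> / 2 * x * v) = - 2 * Re (x * cnj v)" by (simp add: algebra_simps)
    have "\<alpha> / 2 * v\<^sup>2 = (\<alpha> * v\<^sup>2) / 2" by simp
    then have 2: "2 * Re (\<alpha> / 2 * v\<^sup>2) = - 1" by (simp add: av2)
    show ?thesis unfolding quad_expand 1 2 nv by simp
  qed
  have inD: "quad (\<alpha> / 2) 0 x = k" if x: "x \<in> D" for x
  proof -
    have "v \<noteq> 0" using nv by auto
    then obtain t where "t > 0" "x + of_real t * v \<in> frontier D" by (rule ray_meets_frontier[OF D(1,2) x])
    then show ?thesis using fr along by metis
  qed
  obtain x where x: "x \<in> D" using D(3) by blast
  obtain r where r: "r > 0" "ball x r \<subseteq> D" using D(1) x openE by blast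
  \<comment> \<open>Across, along \<open>\<i> * v\<close>, the form has the value 2, so
    \<open>quad\<close> is not constant there.\<close>
  let ?w = "\<i> * v"
  have "x + of_real (r/2) * ?w \<in> ball x r" "x + of_real (- r/2) * ?w \<in> ball x r"
    using r nv by (auto simp: dist_norm norm_mult)
  then have "quad (\<alpha> / 2) 0 (x + of_real (r/2) * ?w) = k" "quad (\<alpha> / 2) 0 (x + of_real (- r/2) * ?w) = k" "quad (\<alpha> / 2) 0 x = k"
    using r inD x by blast+
  moreover define p where "p = 2 * Re (x * cnj ?w) + 4 * Re (\<alpha> / 2 * x * ?w) + 2 * Re (0 * ?w)"
  moreover define q where "q = (norm ?w)\<^sup>2 + 2 * Re (\<alpha> / 2 * ?w\<^sup>2)"
  ultimately have "k = k + r/2 * p + (r/2)\<^sup>2 * q" "k = k + (- r/2) * p + (- r/2)\<^sup>2 * q"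
    unfolding quad_expand by simp_all
  moreover have "(- r/2) * p = - (r/2 * p)" "(- r/2)\<^sup>2 * q = (r/2)\<^sup>2 * q" by simp_all
  ultimately have "(r/2)\<^sup>2 * q = 0" by linarith
  then have "q = 0" using r by simp
  moreover have "\<alpha> / 2 * ?w\<^sup>2 = - (\<alpha> * v\<^sup>2) / 2" by (simp add: power_mult_distrib)
  then have "2 * Re (\<alpha> / 2 * ?w\<^sup>2) = 1" by (simp add: av2)
  ultimately show False using nv by (simp add: q_def norm_mult)
qed

text \<open>\<open>F\<close> is real wherever \<open>S z = cnj z\<close>, and its parameters
  \<open>d\<close> and \<open>e\<close> are spent on the two unbounded terms at infinity. The
  resulting \<open>d\<close> always satisfies \<open>norm d \<le> 1/2\<close>, so hyperbolas do not
  arise.\<close>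

lemma schwarz_function_quadric:
  assumes D: "open D" "bounded D" "D \<noteq> {}" "interior (closure D) = D"
    and S: "continuous_on UNIV S" "S holomorphic_on (- closure D)"
    and bd: "\<And>z. z \<in> closure D \<Longrightarrow> S z = cnj z"
    and asym: "\<And>z. norm z \<ge> R \<Longrightarrow> norm (S z + \<alpha> * z + \<beta>) \<le> K / norm z"
  obtains d e k where "norm d < 1/2" "D = {z. quad d e z < k}"
proof -
  let ?V = "- closure D"
  define m where "m = 1 + (norm \<alpha>)\<^sup>2"
  have m: "m > 0" by (simp add: m_def add_pos_nonneg)
  \<comment> \<open>The \<open>z^2\<close> coefficient of \<open>F\<close> at infinity is
    \<open>d + cnj d * \<alpha>^2 - \<alpha>\<close>; this \<open>d\<close> makes it vanish.\<close>
  define d where "d = \<alpha> / of_real m"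
  define \<gamma> where "\<gamma> = \<beta> * (1 - 2 * cnj d * \<alpha>)"
  \<comment> \<open>Vanishing of the \<open>z\<close> coefficient reads
    \<open>e - cnj e * \<alpha> = \<gamma>\<close>. This real-linear equation is singular for
    \<open>norm \<alpha> = 1\<close>, but then \<open>\<gamma> = 0\<close> and \<open>e = 0\<close>
    solves it.\<close>
  define e where "e = (if norm \<alpha> = 1 then 0 else (\<gamma> + \<alpha> * cnj \<gamma>) / of_real (1 - (norm \<alpha>)\<^sup>2))"
  have aa: "cnj \<alpha> * \<alpha> = of_real ((norm \<alpha>)\<^sup>2)" by (metis complex_norm_square mult.commute)
  have d_eq: "d + cnj d * \<alpha>\<^sup>2 = \<alpha>"
  proof -
    have "d + cnj d * \<alpha>\<^sup>2 = \<alpha> * (1 + cnj \<alpha> * \<alpha>) / of_real m"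
      by (simp add: d_def power2_eq_square add_divide_distrib algebra_simps)
    also have "1 + cnj \<alpha> * \<alpha> = of_real m" unfolding aa by (simp add: m_def)
    finally show ?thesis using m by simp
  qed
  have e_eq: "e - cnj e * \<alpha> = \<gamma>"
  proof (cases "norm \<alpha> = 1")
    case True
    then have "2 * cnj d * \<alpha> = 1" using aa by (simp add: d_def m_def)
    then show ?thesis using True by (simp add: e_def \<gamma>_def)
  next
    case False
    then have nz: "(1 - (norm \<alpha>)\<^sup>2) \<noteq> 0" by (auto simp: power2_eq_1_iff) (smt (verit) norm_ge_zero)
    have "e - cnj e * \<alpha> = (\<gamma> * (1 - cnj \<alpha> * \<alpha>)) / of_real (1 - (norm \<alpha>)\<^sup>2)"
      using False by (simp add: e_def diff_divide_distrib add_divide_distrib algebra_simps)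
    also have "1 - cnj \<alpha> * \<alpha> = of_real (1 - (norm \<alpha>)\<^sup>2)" unfolding aa by simp
    also have "\<gamma> * of_real (1 - (norm \<alpha>)\<^sup>2) / of_real (1 - (norm \<alpha>)\<^sup>2) = \<gamma>"
      using nz by (metis nonzero_mult_div_cancel_right of_real_eq_0_iff)
    finally show ?thesis .
  qed
  define F where "F z = z * S z + d * z\<^sup>2 + cnj d * (S z)\<^sup>2 + e * z + cnj e * S z" for z
  have cF: "continuous_on A F" for A
    unfolding F_def by (intro continuous_intros continuous_on_subset[OF S(1)]) auto
  have hF: "F holomorphic_on ?V"
    unfolding F_def by (intro holomorphic_intros S)
  have F_bd: "F z = of_real (quad d e z)" if "z \<in> closure D" for z
    unfolding F_def bd[OF that] quad_def cmod_power2 complex_eq_iff by (simp add: power2_eq_square algebra_simps)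
  \<comment> \<open>With the growing terms cancelled, only constants and the quantities
    \<open>\<rho>\<close> and \<open>z * \<rho>\<close> remain, both bounded for large
    \<open>z\<close>.\<close>
  have F_exp: "F z = z * \<rho> + cnj d * (\<beta>\<^sup>2 - 2 * \<alpha> * (z * \<rho>) - 2 * \<beta> * \<rho> + \<rho>\<^sup>2) - cnj e * \<beta> + cnj e * \<rho>"
    if \<rho>: "\<rho> = S z + \<alpha> * z + \<beta>" for z \<rho>
  proof -
    have s: "S z = \<rho> - \<alpha> * z - \<beta>" using \<rho> by simp
    have "F z = z\<^sup>2 * (d + cnj d * \<alpha>\<^sup>2 - \<alpha>) + z * ((e - cnj e * \<alpha>) - \<beta> * (1 - 2 * cnj d * \<alpha>))
      + (z * \<rho> + cnj d * (\<beta>\<^sup>2 - 2 * \<alpha> * (z * \<rho>) - 2 * \<beta> * \<rho> + \<rho>\<^sup>2) - cnj e * \<beta> + cnj e * \<rho>)"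
      unfolding F_def s by (simp add: power2_eq_square algebra_simps)
    then show ?thesis unfolding d_eq e_eq \<gamma>_def by simp
  qed
  obtain M where M: "\<And>z. norm (F z) \<le> M"
  proof -
    define R1 where "R1 = max \<bar>R\<bar> 1"
    let ?G = "\<lambda>(p, \<rho>). p + cnj d * (\<beta>\<^sup>2 - 2 * \<alpha> * p - 2 * \<beta> * \<rho> + \<rho>\<^sup>2) - cnj e * \<beta> + cnj e * \<rho>"
    have "compact (?G ` (cball 0 \<bar>K\<bar> \<times> cball 0 \<bar>K\<bar>))"
      unfolding case_prod_beta
      by (intro compact_continuous_image compact_Times compact_cball continuous_intros)
    from compact_imp_bounded[OF this]
    obtain B where B: "\<And>p. p \<in> cball 0 \<bar>K\<bar> \<times> cball 0 \<bar>K\<bar> \<Longrightarrow> norm (?G p) \<le> B"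
      unfolding bounded_iff by blast
    have out: "norm (F z) \<le> B" if z: "norm z \<ge> R1" for z
    proof -
      define \<rho> where "\<rho> = S z + \<alpha> * z + \<beta>"
      have z1: "norm z \<ge> 1" "norm z \<ge> R" using z by (auto simp: R1_def)
      have "norm \<rho> \<le> K / norm z" unfolding \<rho>_def by (rule asym[OF z1(2)])
      also have "\<dots> \<le> \<bar>K\<bar> / norm z" by (intro divide_right_mono) auto
      finally have r1: "norm \<rho> \<le> \<bar>K\<bar> / norm z" .
      moreover have "norm z > 0" using z1(1) by linarith
      ultimately have "norm \<rho> * norm z \<le> \<bar>K\<bar>" by (simp only: pos_le_divide_eq)
      then have zr: "norm (z * \<rho>) \<le> \<bar>K\<bar>" by (simp add: norm_mult mult.commute)
      have "\<bar>K\<bar> / norm z \<le> \<bar>K\<bar>" using z1(1) by (simp add: divide_le_eq mult_le_cancel_left1)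
      then have r: "norm \<rho> \<le> \<bar>K\<bar>" using r1 by linarith
      show ?thesis unfolding F_exp[OF \<rho>_def] using B[of "(z * \<rho>, \<rho>)"] zr r by simp
    qed
    have "compact (F ` cball 0 R1)" by (intro compact_continuous_image cF) auto
    then obtain B' where B': "\<And>w. w \<in> F ` cball 0 R1 \<Longrightarrow> norm w \<le> B'" using compact_imp_bounded bounded_iff by metis
    show ?thesis
    proof (rule that[of "max B B'"])
      fix z show "norm (F z) \<le> max B B'"
        using out[of z] B'[of "F z"] by (cases "norm z \<ge> R1") (auto simp: le_max_iff_disj)
    qed
  qed
  obtain z0 r where z0: "r > 0" "ball z0 r \<subseteq> D" using D(1,3) openE by (metis ex_in_conv)
  have dis: "ball z0 r \<inter> ?V = {}" using z0 closure_subset[of D] by blast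
  \<comment> \<open>Regularity of \<open>D\<close> enters here; a slit would belong to the frontier
    of \<open>D\<close> but not to that of \<open>?V\<close>.\<close>
  have frV: "frontier ?V = frontier D"
  proof -
    have "frontier ?V = frontier (closure D)" by (rule frontier_complement)
    also have "\<dots> = frontier D" unfolding frontier_def closure_closure D(4) interior_open[OF D(1)] ..
    finally show ?thesis .
  qed
  have oV: "open ?V" by (rule open_Compl[OF closed_closure])
  have im: "Im (F z) = 0" if "z \<in> ?V" for z
  proof (rule Im_eq_0_from_frontier[OF oV dis z0(1) hF cF _ _ that])
    show "norm (F w) \<le> M" for w by (rule M)
    show "Im (F w) = 0" if "w \<in> frontier ?V" for w
      using that F_bd unfolding frV by (simp add: frontier_def)
  qed
  have "F constant_on ?V"
    by (rule constant_on_if_Im_eq_0[OF oV connected_complement_closure[OF D(1-3) S bd] hF im])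
  then obtain k where k: "\<And>z. z \<in> ?V \<Longrightarrow> F z = k" by (auto simp: constant_on_def)
  have kc: "F z = k" if "z \<in> closure ?V" for z
    by (rule continuous_constant_on_closure[OF cF k that])
  have fr: "quad d e z = Re k" if z: "z \<in> frontier D" for z
  proof -
    have "z \<in> closure ?V" using z frV by (auto simp: frontier_def)
    moreover have "z \<in> closure D" using z by (simp add: frontier_def)
    ultimately show ?thesis using kc[of z] F_bd[of z] by (metis Re_complex_of_real)
  qed
  have n1: "norm \<alpha> \<noteq> 1"
  proof
    assume a1: "norm \<alpha> = 1"
    then have de: "d = \<alpha> / 2" "e = 0" by (simp_all add: d_def m_def e_def)
    show False by (rule frontier_quad_degenerate[OF D(1-3) a1 fr[unfolded de]])
  qed
  have "norm d < 1/2"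
  proof -
    have "0 < (1 - norm \<alpha>)\<^sup>2" using n1 by simp
    then have "2 * norm \<alpha> < m" by (simp add: m_def power2_eq_square algebra_simps)
    moreover have "norm d = norm \<alpha> / m" using m by (simp add: d_def norm_divide)
    ultimately show ?thesis using m by (simp add: divide_less_eq)
  qed
  moreover from this have "D = {z. quad d e z < Re k}" by (rule sublevel_if_frontier_quad[OF D(1-3) _ fr])
  ultimately show ?thesis by (rule that)
qed

section \<open>The inclusion is an ellipse\<close>

definition to_cx :: "real^2 \<Rightarrow> complex" where
  "to_cx x = Complex (x $ 1) (x $ 2)"

definition of_cx :: "complex \<Rightarrow> real^2" where
  "of_cx z = (\<chi> i. if i = 1 then Re z else Im z)"

lemma of_cx_nth [simp]: "of_cx z $ 1 = Re z" "of_cx z $ 2 = Im z"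
  by (simp_all add: of_cx_def)

lemma Re_to_cx [simp]: "Re (to_cx x) = x $ 1" and Im_to_cx [simp]: "Im (to_cx x) = x $ 2"
  by (simp_all add: to_cx_def)

lemma to_cx_of_cx [simp]: "to_cx (of_cx z) = z"
  by (simp add: complex_eq_iff)

lemma of_cx_to_cx [simp]: "of_cx (to_cx x) = x"
  by (simp add: vec_eq_iff forall_2)

lemma linear_of_cx: "linear of_cx"
  by (rule linearI) (simp_all add: vec_eq_iff forall_2)

lemma linear_to_cx: "linear to_cx"
  by (rule linearI) (simp_all add: complex_eq_iff)

lemma norm_of_cx [simp]: "norm (of_cx z) = norm z"
  by (simp add: norm_vec_def L2_set_def sum_2 cmod_def)

lemma inj_to_cx: "inj to_cx"
  by (metis injI of_cx_to_cx)

lemma surj_to_cx: "surj to_cx"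
  by (metis surjI to_cx_of_cx)

lemma mem_to_cx_image: "z \<in> to_cx ` A \<longleftrightarrow> of_cx z \<in> A"
  by (metis image_iff of_cx_to_cx to_cx_of_cx)

lemma closure_to_cx: "closure (to_cx ` A) = to_cx ` closure A"
  by (rule closure_injective_linear_image[OF linear_to_cx inj_to_cx, symmetric])

lemma interior_to_cx: "interior (to_cx ` A) = to_cx ` interior A"
  by (rule interior_bijective_linear_image[OF linear_to_cx]) (simp add: bij_def inj_to_cx surj_to_cx)

lemma of_cx_has_derivative: "(of_cx has_derivative of_cx) (at z)"
  by (simp add: linear_imp_has_derivative linear_of_cx)

text \<open>A rotation \<open>\<omega>\<close> that makes \<open>d * \<omega>^2\<close> real and
  nonnegative brings the form to principal axes, with eigenvalues \<open>1 + \<delta>\<close> and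
  \<open>1 - \<delta>\<close>; completing the squares gives centre and semiaxes.\<close>

lemma is_ellipse_quad:
  assumes d: "norm d < 1/2" and ne: "\<Omega> \<noteq> {}" and \<Omega>: "to_cx ` \<Omega> = {z. quad d e z < k}"
  shows "is_ellipse \<Omega>"
proof -
  define \<delta> where "\<delta> = 2 * norm d"
  have \<delta>: "0 \<le> \<delta>" "\<delta> < 1" using d by (auto simp: \<delta>_def)
  obtain \<omega> where \<omega>: "norm \<omega> = 1" "d * \<omega>\<^sup>2 = of_real (norm d)"
  proof (cases "d = 0")
    case True
    then show ?thesis using that[of 1] by simp
  next
    case False
    define \<omega> where "\<omega> = csqrt (cnj d / of_real (norm d))"
    have w2: "\<omega>\<^sup>2 = cnj d / of_real (norm d)" by (simp add: \<omega>_def)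
    have "(norm \<omega>)\<^sup>2 = norm (cnj d / of_real (norm d))" unfolding w2[symmetric] norm_power ..
    also have "\<dots> = 1" using False by (simp add: norm_divide)
    finally have "norm \<omega> = 1" using norm_ge_zero[of \<omega>] by (simp add: power2_eq_1_iff)
    moreover have "d * \<omega>\<^sup>2 = of_real (norm d)"
    proof -
      have "d * cnj d = of_real (norm d) * of_real (norm d)"
        using complex_norm_square[of d] by (simp add: power2_eq_square)
      then show ?thesis using False unfolding w2 by (simp add: field_simps)
    qed
    ultimately show ?thesis by (rule that)
  qed
  have ww: "\<omega> * cnj \<omega> = 1" using complex_norm_square[of \<omega>] \<omega> by simp
  define m where "m = Re (e * \<omega>)"
  define n where "n = Im (e * \<omega>)"
  define X where "X z = Re (cnj \<omega> * z)" for z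
  define Y where "Y z = Im (cnj \<omega> * z)" for z
  define x0 where "x0 = - m / (1 + \<delta>)"
  define y0 where "y0 = n / (1 - \<delta>)"
  define T where "T = k + m\<^sup>2 / (1 + \<delta>) + n\<^sup>2 / (1 - \<delta>)"
  have quad: "quad d e z = (1 + \<delta>) * (X z - x0)\<^sup>2 + (1 - \<delta>) * (Y z - y0)\<^sup>2 - m\<^sup>2 / (1 + \<delta>) - n\<^sup>2 / (1 - \<delta>)" for z
  proof -
    define \<zeta> where "\<zeta> = cnj \<omega> * z"
    have z: "z = \<omega> * \<zeta>" using ww by (simp add: \<zeta>_def mult.assoc[symmetric])
    have "d * z\<^sup>2 = (d * \<omega>\<^sup>2) * \<zeta>\<^sup>2" by (simp add: z power_mult_distrib mult.assoc)
    then have 1: "Re (d * z\<^sup>2) = norm d * ((X z)\<^sup>2 - (Y z)\<^sup>2)"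
      unfolding \<omega>(2) X_def Y_def \<zeta>_def[symmetric] by (simp add: power2_eq_square)
    have "e * z = (e * \<omega>) * \<zeta>" by (simp add: z mult.assoc)
    then have 2: "Re (e * z) = m * X z - n * Y z"
      unfolding X_def Y_def \<zeta>_def[symmetric] m_def n_def by (simp only: times_complex.sel)
    have "norm z = norm \<zeta>" by (simp add: z norm_mult \<omega>)
    then have 3: "(norm z)\<^sup>2 = (X z)\<^sup>2 + (Y z)\<^sup>2" unfolding X_def Y_def \<zeta>_def[symmetric] by (simp add: cmod_power2)
    have "quad d e z = (1 + \<delta>) * (X z)\<^sup>2 + (1 - \<delta>) * (Y z)\<^sup>2 + 2 * m * X z - 2 * n * Y z"
      unfolding quad_def 1 2 3 \<delta>_def by (simp add: algebra_simps)
    moreover have sq: "D * (t - s / D)\<^sup>2 = D * t\<^sup>2 - 2 * s * t + s\<^sup>2 / D" if "D \<noteq> 0" for D t s :: real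
      using that by (simp add: power2_eq_square field_simps)
    have "(1 + \<delta>) * (X z - x0)\<^sup>2 = (1 + \<delta>) * (X z)\<^sup>2 + 2 * m * X z + m\<^sup>2 / (1 + \<delta>)"
      using sq[of "1 + \<delta>" "X z" "- m"] \<delta> by (simp add: x0_def)
    moreover have "(1 - \<delta>) * (Y z - y0)\<^sup>2 = (1 - \<delta>) * (Y z)\<^sup>2 - 2 * n * Y z + n\<^sup>2 / (1 - \<delta>)"
      using sq[of "1 - \<delta>" "Y z" n] \<delta> by (simp add: y0_def)
    ultimately show ?thesis by linarith
  qed
  have mem: "x \<in> \<Omega> \<longleftrightarrow> (1 + \<delta>) * (X (to_cx x) - x0)\<^sup>2 + (1 - \<delta>) * (Y (to_cx x) - y0)\<^sup>2 < T" for x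
  proof -
    have "x \<in> \<Omega> \<longleftrightarrow> to_cx x \<in> to_cx ` \<Omega>" by (simp add: mem_to_cx_image)
    then show ?thesis unfolding \<Omega> by (auto simp: quad T_def)
  qed
  \<comment> \<open>Positivity of the level comes from a point of \<open>\<Omega>\<close>, where a
    nonnegative form is below \<open>T\<close>.\<close>
  have T: "T > 0"
  proof -
    obtain x where "x \<in> \<Omega>" using ne by blast
    moreover have "(1 + \<delta>) * (X (to_cx x) - x0)\<^sup>2 + (1 - \<delta>) * (Y (to_cx x) - y0)\<^sup>2 \<ge> 0" using \<delta> by simp
    ultimately show ?thesis unfolding mem by linarith
  qed
  define c where "c = of_cx (\<omega> * Complex x0 y0)"
  define u where "u = of_cx \<omega>"
  define v where "v = of_cx (\<i> * \<omega>)"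
  define a where "a = sqrt (T / (1 + \<delta>))"
  define b where "b = sqrt (T / (1 - \<delta>))"
  have ab: "a > 0" "b > 0" "a\<^sup>2 = T / (1 + \<delta>)" "b\<^sup>2 = T / (1 - \<delta>)"
    using T \<delta> by (simp_all add: a_def b_def)
  have nn: "Re \<omega> * Re \<omega> + Im \<omega> * Im \<omega> = 1"
    using \<omega>(1) cmod_power2[of \<omega>] by (simp add: power2_eq_square)
  have Xe: "(x - c) \<bullet> u = X (to_cx x) - x0" for x
  proof -
    have "c \<bullet> u = x0 * (Re \<omega> * Re \<omega> + Im \<omega> * Im \<omega>)"
      by (simp add: c_def u_def inner_vec_def sum_2 algebra_simps)
    then show ?thesis unfolding nn
      by (simp add: inner_diff_left X_def u_def inner_vec_def sum_2 algebra_simps)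
  qed
  have Ye: "(x - c) \<bullet> v = Y (to_cx x) - y0" for x
  proof -
    have "c \<bullet> v = y0 * (Re \<omega> * Re \<omega> + Im \<omega> * Im \<omega>)"
      by (simp add: c_def v_def inner_vec_def sum_2 algebra_simps)
    then show ?thesis unfolding nn
      by (simp add: inner_diff_left Y_def v_def inner_vec_def sum_2 algebra_simps)
  qed
  have "\<Omega> = {x. (((x - c) \<bullet> u) / a)\<^sup>2 + (((x - c) \<bullet> v) / b)\<^sup>2 < 1}"
  proof (rule set_eqI)
    fix x
    have "((X (to_cx x) - x0) / a)\<^sup>2 + ((Y (to_cx x) - y0) / b)\<^sup>2
      = ((1 + \<delta>) * (X (to_cx x) - x0)\<^sup>2 + (1 - \<delta>) * (Y (to_cx x) - y0)\<^sup>2) / T"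
      unfolding power_divide ab(3,4) using \<delta> T by (simp add: add_divide_distrib mult.commute)
    then show "x \<in> \<Omega> \<longleftrightarrow> x \<in> {x. (((x - c) \<bullet> u) / a)\<^sup>2 + (((x - c) \<bullet> v) / b)\<^sup>2 < 1}"
      unfolding mem_Collect_eq Xe Ye mem using T by (simp add: divide_less_eq)
  qed
  moreover have "norm u = 1" "norm v = 1" using \<omega> by (simp_all add: u_def v_def norm_mult)
  moreover have "u \<bullet> v = 0" by (simp add: u_def v_def inner_vec_def sum_2)
  ultimately show ?thesis unfolding is_ellipse_def using ab by blast
qed

lemma (in elastic_field) is_ellipse_\<Omega>:
  assumes nz: "\<tau> \<noteq> 0 \<or> P \<noteq> 0" and conn: "connected \<Omega>" and ne: "\<Omega> \<noteq> {}" and reg: "interior (closure \<Omega>) = \<Omega>"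
  shows "is_ellipse \<Omega>"
proof -
  obtain h c where h: "h 1 1 + h 2 2 = bump_mass" "h 1 2 = h 2 1"
    and inside: "\<And>m z. z \<in> \<Omega> \<Longrightarrow> pot_lim m z = c m - (\<Sum>j\<in>UNIV. h j m * z $ j)"
    by (rule pot_lim_inside[OF nz conn ne]) blast
  obtain K R where R: "R > 0" and decay: "\<And>m z. norm z \<ge> R \<Longrightarrow> \<bar>pot_lim m z\<bar> \<le> K / norm z"
    by (rule pot_lim_decay) blast
  \<comment> \<open>The Cauchy transform: \<open>x / (x \<bullet> x)\<close> corresponds to
    \<open>1 / cnj z\<close>, so \<open>g z\<close> is the integral of
    \<open>1 / (\<zeta> - z)\<close> over \<open>\<zeta>\<close> in the domain.\<close>
  define g where "g z = of_real (pot_lim 1 (of_cx z)) - \<i> * of_real (pot_lim 2 (of_cx z))" for z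
  \<comment> \<open>In \<open>g\<close> the trace-free part of \<open>- h\<close> acts as
    multiplication by \<open>a\<close>, and the trace part as a multiple of \<open>cnj z\<close>,
    which \<open>\<kappa>\<close> normalises.\<close>
  define a where "a = Complex ((h 2 2 - h 1 1) / 2) (h 1 2)"
  define b where "b = of_real (c 1) - \<i> * of_real (c 2)"
  define \<kappa> where "\<kappa> = complex_of_real (2 / bump_mass)"
  define S where "S z = - \<kappa> * (g z - a * z - b)" for z
  let ?D = "to_cx ` \<Omega>"
  have of_cx_cont: "continuous_on A of_cx" for A
    by (simp add: linear_continuous_on linear_conv_bounded_linear[symmetric] linear_of_cx)
  have pc: "continuous_on UNIV (\<lambda>z. pot_lim m (of_cx z))" for m
    by (rule continuous_on_compose2[OF pot_lim_continuous of_cx_cont]) simp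
  have Sc: "continuous_on UNIV S"
    unfolding S_def g_def by (intro continuous_intros pc)
  have S_in: "S z = cnj z" if z: "z \<in> ?D" for z
  proof -
    have zi: "of_cx z \<in> \<Omega>" using z by (simp add: mem_to_cx_image)
    have "g z = a * z + b - of_real (bump_mass / 2) * cnj z"
      unfolding g_def inside[OF zi] h(1)[symmetric] using h(2)
      by (simp add: sum_2 a_def b_def complex_eq_iff field_simps)
    then show ?thesis using bump_mass_pos by (simp add: S_def \<kappa>_def)
  qed
  have S_bd: "S z = cnj z" if "z \<in> closure ?D" for z
  proof -
    have "S z - cnj z = 0"
      by (rule continuous_constant_on_closure[of ?D "\<lambda>z. S z - cnj z"])
         (use that S_in in \<open>auto intro!: continuous_intros continuous_on_subset[OF Sc]\<close>)
    then show ?thesis by simp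
  qed
  have hol: "S holomorphic_on - closure ?D"
    unfolding S_def
  proof (intro holomorphic_intros)
    show "g holomorphic_on - closure ?D"
      unfolding holomorphic_on_def
    proof
      fix z assume "z \<in> - closure ?D"
      then have "of_cx z \<notin> closure \<Omega>" by (simp add: closure_to_cx mem_to_cx_image)
      then obtain p q where d: "(pot_lim 1 has_derivative (\<lambda>d. p * d $ 1 + q * d $ 2)) (at (of_cx z))"
        "(pot_lim 2 has_derivative (\<lambda>d. q * d $ 1 - p * d $ 2)) (at (of_cx z))"
        by (rule pot_lim_outside)
      have "(g has_derivative (\<lambda>d. of_real (p * of_cx d $ 1 + q * of_cx d $ 2) - \<i> * of_real (q * of_cx d $ 1 - p * of_cx d $ 2))) (at z)"
        unfolding g_def
        by (intro has_derivative_diff has_derivative_mult_right has_derivative_of_real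
            has_derivative_compose[OF of_cx_has_derivative d(1)] has_derivative_compose[OF of_cx_has_derivative d(2)])
      moreover have "(\<lambda>d. of_real (p * of_cx d $ 1 + q * of_cx d $ 2) - \<i> * of_real (q * of_cx d $ 1 - p * of_cx d $ 2)) = (*) (Complex p (- q))"
        by (simp add: fun_eq_iff complex_eq_iff)
      ultimately have "(g has_field_derivative Complex p (- q)) (at z)"
        unfolding has_field_derivative_def by simp
      then show "g field_differentiable at z within - closure ?D"
        using field_differentiable_at_within field_differentiable_def by blast
    qed
  qed
  \<comment> \<open>Decay of the potential leaves only the affine part of \<open>S\<close> at
    infinity.\<close>
  have asym: "norm (S z + (- \<kappa> * a) * z + (- \<kappa> * b)) \<le> (norm \<kappa> * (2 * K)) / norm z" if z: "norm z \<ge> R" for z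
  proof -
    have "norm (g z) \<le> \<bar>pot_lim 1 (of_cx z)\<bar> + \<bar>pot_lim 2 (of_cx z)\<bar>"
      unfolding g_def by (rule order_trans[OF norm_triangle_ineq4]) (simp add: norm_mult)
    also have "\<dots> \<le> K / norm z + K / norm z"
      using decay[of "of_cx z" 1] decay[of "of_cx z" 2] z by simp
    finally have "norm \<kappa> * norm (g z) \<le> norm \<kappa> * (K / norm z + K / norm z)" by (intro mult_left_mono) auto
    moreover have eq: "S z + (- \<kappa> * a) * z + (- \<kappa> * b) = - \<kappa> * g z"
      by (simp add: S_def algebra_simps)
    ultimately show ?thesis unfolding eq by (simp add: norm_mult algebra_simps)
  qed
  have D: "open ?D" "bounded ?D" "?D \<noteq> {}" "interior (closure ?D) = ?D"
    using open_\<Omega> bounded_\<Omega> ne reg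
    by (auto simp: closure_to_cx interior_to_cx open_surjective_linear_image[OF _ linear_to_cx surj_to_cx]
        intro!: bounded_linear_image linear_to_cx[unfolded linear_conv_bounded_linear])
  obtain d e k where "norm d < 1/2" "?D = {z. quad d e z < k}"
    by (rule schwarz_function_quadric[OF D Sc hol S_bd asym])
  then show ?thesis using is_ellipse_quad ne by blast
qed

theorem theorem1p6:
  fixes \<Omega> :: "(real^2) set"
    and lam mu lam' mu' :: real
    and A :: "real^2^2"
    and u :: "real^2 \<Rightarrow> real^2"
  assumes "open \<Omega>" and "connected \<Omega>" and "\<Omega> \<noteq> {}"
    and "bounded \<Omega>" and "simply_connected \<Omega>" and "lipschitz_boundary \<Omega>"
    and "mu > 0" and "2 * lam + 2 * mu > 0"
    and "mu' > 0" and "2 * lam' + 2 * mu' > 0"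
    and "(lam - lam') * (mu - mu') \<ge> 0"
    and "A \<noteq> 0"
    and "contract (iso_tensor lam mu) (A + transpose A)
           \<noteq> contract (iso_tensor lam' mu') (A + transpose A)"
    and "weak_elastic_solution (composite_tensor \<Omega> lam mu lam' mu') u"
    and "(\<lambda>x. norm (u x - A *v x)) \<in> O[at_infinity](\<lambda>x. 1 / norm x)"
    and "\<exists>(B :: real^2^2) (b :: real^2). \<forall>x\<in>\<Omega>. u x = B *v x + b"
  shows "is_ellipse \<Omega>"
proof -
  obtain B b where B: "\<And>x. x \<in> \<Omega> \<Longrightarrow> u x = B *v x + b" using assms(16) by blast
  define \<tau> where "\<tau> = contract (iso_tensor lam mu) (B + transpose B) - contract (iso_tensor lam' mu') (B + transpose B)"
  define w where "w k x = (u x - A *v x) $ k" for k x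
  have w: "w k x = u x $ k - (\<Sum>l\<in>UNIV. A $ k $ l * x $ l)" for k x
    by (simp add: w_def matrix_vector_mult_def)
  have lin_smooth: "smooth (\<lambda>x. (\<Sum>l\<in>UNIV. A $ k $ l * x $ l))" for k
    using pd_affine_form(1)[of "\<lambda>l. A $ k $ l" 0] by simp
  have lin_deriv: "pd m (\<lambda>x. (\<Sum>l\<in>UNIV. A $ k $ l * x $ l)) x = A $ k $ m" for k m x
    using pd_affine_form(2)[of m "\<lambda>l. A $ k $ l" 0] by simp
  obtain G where "H1_loc_grad u G" using assms(14) by (auto simp: weak_elastic_solution_def)
  then have ul: "L2_loc (\<lambda>x. u x $ k)" for k by (auto simp: H1_loc_grad_def)
  have ui: "integrable lebesgue (\<lambda>x. u x $ k * g x)" if "continuous_on UNIV g" "cpt_supp g" for g k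
    by (rule L2_loc_integrable_mult[OF ul that])
  have li: "integrable lebesgue (\<lambda>x. (\<Sum>l\<in>UNIV. A $ k $ l * x $ l) * g x)" if "continuous_on UNIV g" "cpt_supp g" for g k
    using that by (intro integrable_continuous_cpt_supp cpt_supp_mult continuous_intros)
  have wi: "integrable lebesgue (\<lambda>x. w k x * g x)" if "continuous_on UNIV g" "cpt_supp g" for g k
    unfolding w left_diff_distrib by (intro Bochner_Integration.integrable_diff ui li that)
  \<comment> \<open>The linear part drops out: its derivatives are constant, and the derivative of a
    test function has integral zero.\<close>
  have wu: "(LINT x|lebesgue. w k x * pd i (pd j \<phi>) x) = (LINT x|lebesgue. u x $ k * pd i (pd j \<phi>) x)"
    if \<phi>: "test_function \<phi>" for k i j \<phi>
  proof -
    let ?g = "pd i (pd j \<phi>)"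
    have tj: "test_function (pd j \<phi>)" by (rule test_function_partial_deriv[OF \<phi>])
    have t: "continuous_on UNIV ?g" "cpt_supp ?g"
      using test_function_partial_deriv[OF tj, of i] by (auto simp: test_function_iff smooth_continuous)
    have "(LINT x|lebesgue. (\<Sum>l\<in>UNIV. A $ k $ l * x $ l) * ?g x) = - (LINT x|lebesgue. A $ k $ i * pd j \<phi> x)"
      unfolding integration_by_parts[OF lin_smooth tj] lin_deriv ..
    also have "\<dots> = 0" using integral_pd_eq_0[of \<phi> j] \<phi> by (simp add: test_function_iff)
    finally have 0: "(LINT x|lebesgue. (\<Sum>l\<in>UNIV. A $ k $ l * x $ l) * ?g x) = 0" .
    show ?thesis
      unfolding w left_diff_distrib Bochner_Integration.integral_diff[OF ui[OF t] li[OF t]] 0 by simp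
  qed
  obtain C0 R0 where C0: "C0 > 0" "R0 > 0" and decay: "\<And>x. norm x \<ge> R0 \<Longrightarrow> norm (u x - A *v x) \<le> C0 / norm x"
  proof -
    obtain c where c: "c > 0" "\<forall>\<^sub>F x in at_infinity. norm (norm (u x - A *v x)) \<le> c * norm (1 / norm x)"
      using assms(15) by (elim landau_o.bigE)
    then obtain r where r: "\<And>x. norm x \<ge> r \<Longrightarrow> norm (u x - A *v x) \<le> c / norm x"
      by (auto simp: eventually_at_infinity)
    show ?thesis by (rule that[of c "\<bar>r\<bar> + 1"]) (use c r in auto)
  qed
  have fr: "negligible (frontier \<Omega>)"
    by (rule negligible_frontier_lipschitz[OF assms(1,4,6)])
  interpret elastic_field \<Omega> lam mu \<tau> "B - A" w b C0 R0
  proof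
    show "\<tau> $ 2 $ 1 = \<tau> $ 1 $ 2"
      by (simp add: \<tau>_def contract_iso_tensor kron_def add.commute)
    show "w k x = (\<Sum>l\<in>UNIV. (B - A) $ k $ l * x $ l) + b $ k" if "x \<in> \<Omega>" for k x
      unfolding w B[OF that] by (simp add: matrix_vector_mult_def sum_2 algebra_simps)
    show "\<bar>w k x\<bar> \<le> C0 / norm x" if "R0 \<le> norm x" for k x
      unfolding w_def using component_le_norm_cart[of "u x - A *v x" k] decay[OF that] by linarith
    show "2 * mu * (\<Sum>j\<in>UNIV. LINT x|lebesgue. w i x * pd j (pd j \<phi>) x) +
       2 * (lam + mu) * (\<Sum>k\<in>UNIV. LINT x|lebesgue. w k x * pd k (pd i \<phi>) x) =
       - (\<Sum>j\<in>UNIV. \<tau> $ i $ j * (LINT x|lebesgue. indicat_real \<Omega> x * pd j \<phi> x))"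
      if "test_function \<phi>" for \<phi> i
      unfolding wu[OF that] \<tau>_def by (rule weak_equation[OF assms(1) fr assms(14) B that])
  qed (use assms C0 wi in auto)
  \<comment> \<open>If both vanished, \<open>B = A\<close> would turn \<open>\<tau> = 0\<close> into
    the excluded equality of stresses.\<close>
  have "\<tau> \<noteq> 0 \<or> B - A \<noteq> 0"
    using assms(13) by (auto simp: \<tau>_def)
  then show ?thesis
    using is_ellipse_\<Omega> assms(2,3) interior_closure_lipschitz[OF assms(1,6)] by blast
qed

end
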